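(* Let $X$ be a $2$-convex Banach sequence lattice and let $(J_m)$ be a sequence of index sets, each of degree at most $m$. Then there is a constant $C>0$ depending only on the $2$-convexity constant of $X$ such that for all $n$ and all $m$ with $\Lambda_T(m)\subset J_m$, $$C^{-m}\Big(1+\frac nm\Big)^{\frac m2}\le\boldsymbol{\lambda}\big(\mathcal{P}_{J_m}(X_n)\big)\le C^m\Big(1+\frac nm\Big)^{\frac m2}$$ and $$C^{-m}\Big(1+\frac nm\Big)^{\frac{m-1}2}\le\boldsymbol{\chi_{\mathrm{mon}}}\big(\mathcal{P}_{J_m}(X_n)\big)\le C^m\Big(1+\frac nm\Big)^{\frac{m-1}2}.$$
   Context: A Banach sequence lattice $X$ over $\mathbb{N}$ is a Banach space of complex sequences with the ideal property; $X$ is $2$-convex with constant $M^{(2)}(X)$ if $\|(\sum_k|x_k|^2)^{1/2}\|_X\le M^{(2)}(X)(\sum_k\|x_k\|_X^2)^{1/2}$ for all finite families. $X_n$ is $\mathbb{C}^n$ with $\|z\|=\|\sum_{k\le n}|z_k|e_k\|_X$. An index set is a subset of $\mathbb{N}_0^{(\mathbb{N})}$, of degree at most $m$ if $|\alpha|\le m$ for all its elements; $\Lambda_T(m)$ is the set of multi-indices with entries in $\{0,1\}$ and $|\alpha|=m$. $\mathcal{P}_J(X_n)$: polynomials $\sum_{\alpha\in J\cap\mathbb{N}_0^n}c_\alpha z^\alpha$ with sup norm over the open unit ball of $X_n$. $\boldsymbol{\lambda}$: projection constant; $\boldsymbol{\chi_{\mathrm{mon}}}$: unconditional basis constant of the monomial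 basis.
   Formalization: Assumes J_m contains a multi-index in N_0^n; otherwise (e.g. J_m = Λ_T(m), n < m) the polynomial space is {0} and the lower bounds fail. λ is taken as the least projection norm from ℓ_∞ of the unit ball; for m = 0, n/m is read as 0. *)

theory Defs
  imports "HOL-Analysis.Analysis"
begin

definition banach_seq_lattice :: "(nat \<Rightarrow> complex) set \<Rightarrow> ((nat \<Rightarrow> complex) \<Rightarrow> real) \<Rightarrow> bool" where
  "banach_seq_lattice X N \<longleftrightarrow>
     (\<lambda>_. 0) \<in> X \<and>
     (\<forall>x\<in>X. \<forall>y\<in>X. (\<lambda>k. x k + y k) \<in> X) \<and>
     (\<forall>a::complex. \<forall>x\<in>X. (\<lambda>k. a * x k) \<in> X) \<and>
     (\<forall>x\<in>X. 0 \<le> N x \<and> (N x = 0 \<longleftrightarrow> x = (\<lambda>_. 0))) \<and>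
     (\<forall>x\<in>X. \<forall>y\<in>X. N (\<lambda>k. x k + y k) \<le> N x + N y) \<and>
     (\<forall>a::complex. \<forall>x\<in>X. N (\<lambda>k. a * x k) = cmod a * N x) \<and>
     (\<forall>x y. y \<in> X \<and> (\<forall>k. cmod (x k) \<le> cmod (y k)) \<longrightarrow> x \<in> X \<and> N x \<le> N y) \<and>
     (\<forall>j. (\<lambda>k. if k = j then 1 else 0) \<in> X) \<and>
     (\<forall>s::nat \<Rightarrow> nat \<Rightarrow> complex. (\<forall>i. s i \<in> X) \<and>
        (\<forall>e>0. \<exists>K. \<forall>i\<ge>K. \<forall>j\<ge>K. N (\<lambda>k. s i k - s j k) < e) \<longrightarrow>
        (\<exists>x\<in>X. (\<lambda>i. N (\<lambda>k. s i k - x k)) \<longlonglongrightarrow> 0))"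

definition two_convex_with :: "(nat \<Rightarrow> complex) set \<Rightarrow> ((nat \<Rightarrow> complex) \<Rightarrow> real) \<Rightarrow> real \<Rightarrow> bool" where
  "two_convex_with X N M \<longleftrightarrow>
     (\<forall>(xs :: nat \<Rightarrow> nat \<Rightarrow> complex) (K::nat). (\<forall>i<K. xs i \<in> X) \<longrightarrow>
        N (\<lambda>k. complex_of_real (sqrt (\<Sum>i<K. (cmod (xs i k))\<^sup>2)))
          \<le> M * sqrt (\<Sum>i<K. (N (xs i))\<^sup>2))"

definition two_convex :: "(nat \<Rightarrow> complex) set \<Rightarrow> ((nat \<Rightarrow> complex) \<Rightarrow> real) \<Rightarrow> bool" where
  "two_convex X N \<longleftrightarrow> (\<exists>M. two_convex_with X N M)"

definition two_convexity_const :: "(nat \<Rightarrow> complex) set \<Rightarrow> ((nat \<Rightarrow> complex) \<Rightarrow> real) \<Rightarrow> real" where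
  "two_convexity_const X N = Inf {M. two_convex_with X N M}"

text \<open>Multi-indices are finitely supported functions nat => nat.\<close>

definition mdeg :: "(nat \<Rightarrow> nat) \<Rightarrow> nat" where
  "mdeg \<alpha> = sum \<alpha> {k. \<alpha> k \<noteq> 0}"

definition index_set :: "(nat \<Rightarrow> nat) set \<Rightarrow> bool" where
  "index_set J \<longleftrightarrow> (\<forall>\<alpha>\<in>J. finite {k. \<alpha> k \<noteq> 0})"

definition degree_at_most :: "(nat \<Rightarrow> nat) set \<Rightarrow> nat \<Rightarrow> bool" where
  "degree_at_most J m \<longleftrightarrow> (\<forall>\<alpha>\<in>J. mdeg \<alpha> \<le> m)"

definition Lambda_T :: "nat \<Rightarrow> (nat \<Rightarrow> nat) set" where
  "Lambda_T m = {\<alpha>. (\<forall>k. \<alpha> k \<le> 1) \<and> finite {k. \<alpha> k \<noteq> 0} \<and> mdeg \<alpha> = m}"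

text \<open>Multi-indices in N_0^n (variables z_0, ..., z_(n-1)).\<close>

definition mi :: "nat \<Rightarrow> (nat \<Rightarrow> nat) set" where
  "mi n = {\<alpha>. \<forall>k\<ge>n. \<alpha> k = 0}"

text \<open>Points of C^n are sequences vanishing from index n on. Open unit ball of X_n.\<close>

definition ballX :: "((nat \<Rightarrow> complex) \<Rightarrow> real) \<Rightarrow> nat \<Rightarrow> (nat \<Rightarrow> complex) set" where
  "ballX N n = {z. (\<forall>k\<ge>n. z k = 0) \<and>
     N (\<lambda>k. if k < n then complex_of_real (cmod (z k)) else 0) < 1}"

definition mono :: "nat \<Rightarrow> (nat \<Rightarrow> nat) \<Rightarrow> (nat \<Rightarrow> complex) \<Rightarrow> complex" where
  "mono n \<alpha> z = (\<Prod>k<n. z k ^ \<alpha> k)"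

definition polyfun :: "((nat \<Rightarrow> complex) \<Rightarrow> real) \<Rightarrow> (nat \<Rightarrow> nat) set \<Rightarrow> nat
     \<Rightarrow> ((nat \<Rightarrow> nat) \<Rightarrow> complex) \<Rightarrow> (nat \<Rightarrow> complex) \<Rightarrow> complex" where
  "polyfun N J n c = (\<lambda>z. if z \<in> ballX N n then (\<Sum>\<alpha>\<in>J \<inter> mi n. c \<alpha> * mono n \<alpha> z) else 0)"

definition PJ :: "((nat \<Rightarrow> complex) \<Rightarrow> real) \<Rightarrow> (nat \<Rightarrow> nat) set \<Rightarrow> nat
     \<Rightarrow> ((nat \<Rightarrow> complex) \<Rightarrow> complex) set" where
  "PJ N J n = range (polyfun N J n)"

definition supn :: "'a set \<Rightarrow> ('a \<Rightarrow> complex) \<Rightarrow> real" where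
  "supn S f = Sup ((\<lambda>z. cmod (f z)) ` S)"

definition Linf :: "'a set \<Rightarrow> ('a \<Rightarrow> complex) set" where
  "Linf S = {f. (\<exists>b. \<forall>z\<in>S. cmod (f z) \<le> b) \<and> (\<forall>z. z \<notin> S \<longrightarrow> f z = 0)}"

text \<open>Projection constant of a subspace V of l_infinity(S): the infimum of the norms of
bounded linear projections from l_infinity(S) onto V. Since l_infinity(S) is injective and
P_J(X_n) embeds isometrically into l_infinity(B_{X_n}) (by the very definition of its norm),
this is the (absolute) projection constant of P_J(X_n).\<close>

definition proj_const :: "'a set \<Rightarrow> ('a \<Rightarrow> complex) set \<Rightarrow> real" where
  "proj_const S V = Inf {t. t \<ge> 0 \<and> (\<exists>P.
      (\<forall>f\<in>Linf S. \<forall>g\<in>Linf S. P (\<lambda>z. f z + g z) = (\<lambda>z. P f z + P g z)) \<and>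
      (\<forall>a::complex. \<forall>f\<in>Linf S. P (\<lambda>z. a * f z) = (\<lambda>z. a * P f z)) \<and>
      (\<forall>f\<in>Linf S. P f \<in> V) \<and> (\<forall>v\<in>V. P v = v) \<and>
      (\<forall>f\<in>Linf S. supn S (P f) \<le> t * supn S f))}"

definition lambda_PJ :: "((nat \<Rightarrow> complex) \<Rightarrow> real) \<Rightarrow> (nat \<Rightarrow> nat) set \<Rightarrow> nat \<Rightarrow> real" where
  "lambda_PJ N J n = proj_const (ballX N n) (PJ N J n)"

definition chi_mon :: "((nat \<Rightarrow> complex) \<Rightarrow> real) \<Rightarrow> (nat \<Rightarrow> nat) set \<Rightarrow> nat \<Rightarrow> real" where
  "chi_mon N J n = Inf {t. t \<ge> 0 \<and> (\<forall>c \<epsilon>. (\<forall>\<alpha>. cmod (\<epsilon> \<alpha>) = 1) \<longrightarrow>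
      supn (ballX N n) (polyfun N J n (\<lambda>\<alpha>. \<epsilon> \<alpha> * c \<alpha>))
        \<le> t * supn (ballX N n) (polyfun N J n c))}"

end

theory Submission
  imports Defs "HOL-Complex_Analysis.Complex_Analysis"
begin

text \<open>
  Two extremal choices carry the upper bounds and the geometry. Maximising \<open>\<Prod>\<alpha>. \<integral> \<bar>w\<^sup>\<alpha>\<bar>\<^sup>2 d\<mu>\<close> over
  probability measures on the ball gives a measure for which the monomials satisfy the Kadets--Snobar
  bound, whence \<open>\<lambda>\<close> is at most the square root of the number of monomials. The same argument for
  the coordinates and 2-convexity give a point \<open>w\<close> such that, in the coordinates \<open>z / w\<close>, the ball lies
  between the polydisc and a multiple of \<open>sqrt n\<close> times the Euclidean ball.

  Lower bound for \<open>\<lambda>\<close>: apply a projection to Riesz products, which are bounded on the ball after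
  scaling but whose average contains all tetrahedral monomials. Upper bound for \<open>\<chi>\<close>: estimate the
  coefficients of the partial derivatives, of degree at most \<open>m - 1\<close>, by Cauchy--Schwarz against the
  extremal measure, the comparison of \<open>L\<^sup>2\<close> and \<open>L\<^sup>1\<close> norms on the torus and Cauchy's inequality. Lower
  bound for \<open>\<chi>\<close>: a tetrahedral polynomial with sign coefficients and small norm.

  Averages over the torus are replaced throughout by averages over roots of unity of sufficiently
  large order.
\<close>

section \<open>Counting multi-indices\<close>

text \<open>Losses of the form \<open>C ^ m\<close> are harmless, so everything hinges on the power
  of \<open>n / m\<close>. Cauchy--Schwarz applied to the coefficients of a polynomial costs the
  square root of the number of monomials, \<open>(1 + n / m) ^ m\<close> up to such losses, which is
  half a power too much for \<open>chi_mon\<close>. The remedy: on half of the ball the moduli of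
  the partial derivatives, weighted by a point \<open>z\<close> of the ball, sum to at most twice
  the norm, with no dependence on \<open>n\<close>. In the lower bound the same half power comes
  from the factor \<open>sqrt n\<close> in the norm of the sign polynomial. For
  \<open>lambda_PJ\<close> there are at least \<open>(n / m) ^ m\<close> tetrahedral monomials when
  \<open>m \<le> n\<close>, and the scale \<open>sqrt (m / n)\<close> of the Riesz factors takes
  half of that power back. Both lower bounds draw on 2-convexity through
  \<open>ball_sandwich\<close>.

  The suprema behind the extremal choices need not be attained, since the balls are open and the
  measures finitely supported. A maximiser up to the factor 2 always exists and merely replaces the
  optimality constant 1 by 6, so neither compactness nor measure theory enters.\<close>

lemma mdeg_mi: "\<alpha> \<in> mi n \<Longrightarrow> mdeg \<alpha> = (\<Sum>k<n. \<alpha> k)"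
  unfolding mdeg_def mi_def by (rule sum.mono_neutral_left) (auto simp: not_less[symmetric])

text \<open>The common source of the counting estimates. Expanding the right side gives one
  nonnegative term for each choice of exponents, and distinct elements of \<open>A\<close> account
  for distinct choices because an element of \<open>mi n\<close> is determined by its first
  \<open>n\<close> entries.\<close>

lemma sum_prod_le_prod_sum:
  fixes h :: "nat \<Rightarrow> nat \<Rightarrow> real"
  assumes D: "\<And>k. k < n \<Longrightarrow> finite (D k)" and A: "A \<subseteq> mi n"
    and AD: "\<And>\<alpha> k. \<alpha> \<in> A \<Longrightarrow> k < n \<Longrightarrow> \<alpha> k \<in> D k" and h: "\<And>k i. 0 \<le> h k i"
  shows "finite A" "(\<Sum>\<alpha>\<in>A. \<Prod>k<n. h k (\<alpha> k)) \<le> (\<Prod>k<n. \<Sum>i\<in>D k. h k i)"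
proof -
  let ?r = "\<lambda>\<alpha>::nat\<Rightarrow>nat. restrict \<alpha> {..<n}"
  let ?E = "PiE {..<n} D"
  have inj: "inj_on ?r A"
  proof (rule inj_onI)
    fix \<alpha> \<beta> assume *: "\<alpha> \<in> A" "\<beta> \<in> A" "?r \<alpha> = ?r \<beta>"
    have "\<alpha> k = \<beta> k" for k
    proof (cases "k < n")
      case True
      then show ?thesis using fun_cong[OF *(3), of k] by simp
    next
      case False
      then show ?thesis using subsetD[OF A *(1)] subsetD[OF A *(2)] by (auto simp: mi_def)
    qed
    then show "\<alpha> = \<beta>" by auto
  qed
  have sub: "?r ` A \<subseteq> ?E" using AD by (intro image_subsetI restrict_PiE_iff[THEN iffD2]) auto
  have finE: "finite ?E" using D by (intro finite_PiE) auto
  show fin: "finite A" using finite_imageD[OF finite_subset[OF sub finE] inj] .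
  have "(\<Sum>\<alpha>\<in>A. \<Prod>k<n. h k (\<alpha> k)) = (\<Sum>\<alpha>\<in>A. \<Prod>k<n. h k (?r \<alpha> k))"
    by (intro sum.cong refl prod.cong) auto
  also have "\<dots> = (\<Sum>g\<in>?r ` A. \<Prod>k<n. h k (g k))"
    by (subst sum.reindex[OF inj]) simp
  also have "\<dots> \<le> (\<Sum>g\<in>?E. \<Prod>k<n. h k (g k))"
    by (intro sum_mono2 finE sub prod_nonneg) (auto simp: h)
  also have "\<dots> = (\<Prod>k<n. \<Sum>i\<in>D k. h k i)"
    by (subst prod_sum_PiE) (auto simp: D)
  finally show "(\<Sum>\<alpha>\<in>A. \<Prod>k<n. h k (\<alpha> k)) \<le> (\<Prod>k<n. \<Sum>i\<in>D k. h k i)" .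
qed

definition bmi :: "nat \<Rightarrow> nat \<Rightarrow> (nat \<Rightarrow> nat) set" where
  "bmi n m = {\<alpha> \<in> mi n. mdeg \<alpha> \<le> m}"

lemma bmi_le: "\<alpha> \<in> bmi n m \<Longrightarrow> \<alpha> k \<le> m"
proof (cases "k < n")
  case True
  assume a: "\<alpha> \<in> bmi n m"
  have "\<alpha> k \<le> (\<Sum>k<n. \<alpha> k)" using True by (intro member_le_sum) auto
  then show ?thesis using a mdeg_mi[of \<alpha> n] by (auto simp: bmi_def)
next
  case False
  assume "\<alpha> \<in> bmi n m"
  then show ?thesis using False by (auto simp: bmi_def mi_def)
qed

lemma finite_bmi: "finite (bmi n m)"
  by (rule sum_prod_le_prod_sum(1)[of n "\<lambda>_. {..m}" _ "\<lambda>_ _. 0"])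
    (auto simp: bmi_le, auto simp: bmi_def)

lemma zero_in_bmi: "(\<lambda>_. 0) \<in> bmi n m"
  by (auto simp: bmi_def mi_def mdeg_def)

text \<open>Rankin's trick: each multi-index is given the weight \<open>x ^ mdeg \<alpha>\<close>,
  which is at least \<open>x ^ j\<close>, and the total weight is at most a product of
  \<open>n\<close> geometric series.\<close>

lemma card_bmi_le:
  assumes x: "0 < x" "x < 1"
  shows "real (card (bmi n j)) * (x ^ j * (1 - x) ^ n) \<le> 1"
proof -
  have "real (card (bmi n j)) * x ^ j = (\<Sum>\<alpha>\<in>bmi n j. x ^ j)" by simp
  also have "\<dots> \<le> (\<Sum>\<alpha>\<in>bmi n j. \<Prod>k<n. x ^ \<alpha> k)"
  proof (rule sum_mono)
    fix \<alpha> assume "\<alpha> \<in> bmi n j"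
    then have "(\<Sum>k<n. \<alpha> k) \<le> j" by (auto simp: bmi_def mdeg_mi)
    then show "x ^ j \<le> (\<Prod>k<n. x ^ \<alpha> k)"
      using x by (simp add: power_sum[symmetric] power_decreasing)
  qed
  also have "\<dots> \<le> (\<Prod>k<n. \<Sum>i\<in>{..j}. x ^ i)"
    using x by (intro sum_prod_le_prod_sum(2)) (auto simp: bmi_le, auto simp: bmi_def)
  also have "\<dots> \<le> (\<Prod>k<n. 1 / (1 - x))"
  proof (intro prod_mono conjI sum_nonneg)
    have "(1 - x) * (\<Sum>i\<le>j. x ^ i) = 1 - x ^ Suc j" by (rule sum_gp_basic)
    also have "\<dots> \<le> 1" using x by simp
    finally show "(\<Sum>i\<le>j. x ^ i) \<le> 1 / (1 - x)" using x by (simp add: field_simps)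
  qed (use x in auto)
  also have "\<dots> = 1 / (1 - x) ^ n" by (simp add: power_one_over)
  finally have "real (card (bmi n j)) * x ^ j \<le> 1 / (1 - x) ^ n" .
  then show ?thesis using x by (simp add: field_simps)
qed

lemma one_plus_power_le_exp: "0 \<le> (y::real) \<Longrightarrow> (1 + y) ^ n \<le> exp (real n * y)"
  using power_mono[OF exp_ge_add_one_self[of y], of n] by (simp add: exp_of_nat_mult)

text \<open>The degree bound \<open>j\<close> is kept apart from \<open>m\<close> because the count
  is used for \<open>j = m\<close> (projection constant) and for \<open>j = m - 1\<close>
  (unconditional constant), both against the ratio \<open>n / m\<close>.\<close>

lemma card_bmi_le_ratio:
  assumes m: "m \<ge> 1"
  shows "real (card (bmi n j)) \<le> 3 ^ m * (2 * (1 + real n / real m)) ^ j"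
proof -
  \<comment> \<open>A near-optimal weight: \<open>1 / (1 - x) = 1 + m / (n + m)\<close> has
    \<open>n\<close>-th power at most \<open>exp m\<close>, while
    \<open>1 / x = 2 + n / m\<close>.\<close>
  define x where "x = real m / (real n + 2 * real m)"
  have pos: "0 < real n + 2 * real m" "0 < real n + real m" using m by auto
  have x: "0 < x" "x < 1" using m pos by (auto simp: x_def)
  have inv: "1 / (1 - x) = 1 + real m / (real n + real m)"
    using pos by (simp add: x_def field_simps)
  have "(1 / (1 - x)) ^ n \<le> exp (real n * (real m / (real n + real m)))"
    unfolding inv by (rule one_plus_power_le_exp) auto
  also have "\<dots> \<le> exp (real m)"
    using pos by (simp add: field_simps)
  also have "\<dots> = exp 1 ^ m" by (simp add: exp_of_nat_mult[symmetric])
  also have "\<dots> \<le> 3 ^ m" using exp_le by (intro power_mono) auto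
  finally have 1: "(1 / (1 - x)) ^ n \<le> 3 ^ m" .
  have "1 / x \<le> 2 * (1 + real n / real m)" using m by (simp add: x_def field_simps)
  then have 2: "(1 / x) ^ j \<le> (2 * (1 + real n / real m)) ^ j"
    using x by (intro power_mono) auto
  have "real (card (bmi n j)) \<le> (1 / (1 - x)) ^ n * (1 / x) ^ j"
    using card_bmi_le[OF x, of n j] x by (simp add: field_simps power_one_over)
  also have "\<dots> \<le> 3 ^ m * (2 * (1 + real n / real m)) ^ j"
    using x by (intro mult_mono 1 2) auto
  finally show ?thesis .
qed

lemma Lambda_T_bmi: "Lambda_T m \<inter> mi n \<subseteq> bmi n m"
  by (auto simp: Lambda_T_def bmi_def)

text \<open>The left side is an elementary symmetric polynomial of the \<open>v k\<close>.
  Multiplied by \<open>x ^ m\<close> it is part of the expansion of the product of the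
  \<open>1 + x * v k\<close>, which is at most \<open>exp (x * V)\<close>; the choice
  \<open>x = m / V\<close> turns this into \<open>exp m \<le> 3 ^ m\<close>.\<close>

lemma sum_Lambda_T_le:
  assumes m: "m \<ge> 1" and v: "\<And>k. 0 \<le> v k" and V: "(\<Sum>k<n. v k) \<le> V" "0 < V"
  shows "(\<Sum>\<alpha>\<in>Lambda_T m \<inter> mi n. \<Prod>k<n. v k ^ \<alpha> k) \<le> (3 * V / real m) ^ m"
proof -
  define x where "x = real m / V"
  have x: "0 < x" using m V by (simp add: x_def)
  have "x ^ m * (\<Sum>\<alpha>\<in>Lambda_T m \<inter> mi n. \<Prod>k<n. v k ^ \<alpha> k)
      = (\<Sum>\<alpha>\<in>Lambda_T m \<inter> mi n. \<Prod>k<n. (x * v k) ^ \<alpha> k)"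
    unfolding sum_distrib_left
  proof (rule sum.cong[OF refl])
    fix \<alpha> assume "\<alpha> \<in> Lambda_T m \<inter> mi n"
    then have "(\<Sum>k<n. \<alpha> k) = m" by (auto simp: Lambda_T_def mdeg_mi)
    then show "x ^ m * (\<Prod>k<n. v k ^ \<alpha> k) = (\<Prod>k<n. (x * v k) ^ \<alpha> k)"
      by (simp add: power_mult_distrib prod.distrib power_sum[symmetric])
  qed
  also have "\<dots> \<le> (\<Prod>k<n. \<Sum>i\<in>{..1}. (x * v k) ^ i)"
    using v x by (intro sum_prod_le_prod_sum(2)) (auto simp: Lambda_T_def)
  also have "\<dots> = (\<Prod>k<n. 1 + x * v k)" by simp
  also have "\<dots> \<le> (\<Prod>k<n. exp (x * v k))"
    using v x by (intro prod_mono) (auto intro: add_nonneg_nonneg exp_ge_add_one_self)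
  also have "\<dots> = exp (x * (\<Sum>k<n. v k))" by (simp add: exp_sum sum_distrib_left)
  also have "\<dots> \<le> exp (real m)" using V x m by (simp add: x_def field_simps)
  also have "\<dots> = exp 1 ^ m" by (simp add: exp_of_nat_mult[symmetric])
  also have "\<dots> \<le> 3 ^ m" using exp_le by (intro power_mono) auto
  finally have "x ^ m * (\<Sum>\<alpha>\<in>Lambda_T m \<inter> mi n. \<Prod>k<n. v k ^ \<alpha> k) \<le> 3 ^ m" .
  then show ?thesis using x V m by (simp add: x_def field_simps power_divide power_mult_distrib)
qed

lemma card_Lambda_T:
  "card (Lambda_T m \<inter> mi n) = n choose m"
proof -
  let ?S = "{A. A \<subseteq> {..<n} \<and> card A = m}"
  let ?f = "\<lambda>A k. if k \<in> A then 1 else (0::nat)"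
  have bij: "bij_betw ?f ?S (Lambda_T m \<inter> mi n)"
  proof (rule bij_betw_byWitness[where f' = "\<lambda>\<alpha>. {k. \<alpha> k \<noteq> 0}"])
    show "?f ` ?S \<subseteq> Lambda_T m \<inter> mi n"
      by (auto simp: Lambda_T_def mdeg_def mi_def dest: finite_subset)
    show "\<forall>a\<in>Lambda_T m \<inter> mi n. ?f {k. a k \<noteq> 0} = a"
    proof
      fix a assume a: "a \<in> Lambda_T m \<inter> mi n"
      have "a k \<le> 1" for k using a by (auto simp: Lambda_T_def)
      then have 01: "a k = 0 \<or> a k = 1" for k by (metis One_nat_def le_0_eq le_SucE)
      show "?f {k. a k \<noteq> 0} = a"
      proof
        show "?f {k. a k \<noteq> 0} k = a k" for k using 01[of k] by auto
      qed
    qed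
    show "(\<lambda>\<alpha>. {k. \<alpha> k \<noteq> 0}) ` (Lambda_T m \<inter> mi n) \<subseteq> ?S"
    proof safe
      fix a assume a: "a \<in> Lambda_T m" "a \<in> mi n"
      have "a k \<le> 1" for k using a by (auto simp: Lambda_T_def)
      then have 1: "a k \<noteq> 0 \<Longrightarrow> a k = 1" for k by (metis One_nat_def le_0_eq le_SucE)
      show "card {k. a k \<noteq> 0} = m"
      proof -
        have "m = sum a {k. a k \<noteq> 0}" using a by (simp add: Lambda_T_def mdeg_def)
        also have "\<dots> = (\<Sum>k\<in>{k. a k \<noteq> 0}. 1)" using 1 by (intro sum.cong) auto
        finally show ?thesis by simp
      qed
      show "\<And>x. 0 < a x \<Longrightarrow> x < n" using a by (auto simp: mi_def not_less[symmetric])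
    qed
  qed auto
  show ?thesis using bij_betw_same_card[OF bij] n_subsets[of "{..<n}" m] by simp
qed

lemma card_Lambda_T_ge:
  "m \<le> n \<Longrightarrow> (real n / real m) ^ m \<le> real (card (Lambda_T m \<inter> mi n))"
  using binomial_ge_n_over_k_pow_k[of m n, where 'a = real] by (simp add: card_Lambda_T)

text \<open>Controls the number of ways to split \<open>\<gamma>\<close> into two multi-indices, the
  source of the factor \<open>4 ^ m\<close> in \<open>torus_fourth_moment\<close>.\<close>

lemma card_below_le:
  "card {\<alpha> \<in> mi n. \<forall>k<n. \<alpha> k \<le> \<gamma> k} \<le> 2 ^ (\<Sum>k<n. \<gamma> k)"
proof -
  let ?A = "{\<alpha> \<in> mi n. \<forall>k<n. \<alpha> k \<le> \<gamma> k}"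
  have "real (card ?A) = (\<Sum>\<alpha>\<in>?A. \<Prod>k<n. 1)" by simp
  also have "\<dots> \<le> (\<Prod>k<n. \<Sum>i\<in>{..\<gamma> k}. 1)"
    by (rule sum_prod_le_prod_sum(2)[where h = "\<lambda>_ _. 1"]) auto
  also have "\<dots> \<le> (\<Prod>k<n. 2 ^ \<gamma> k)"
  proof (intro prod_mono conjI)
    fix k
    have "Suc (\<gamma> k) \<le> 2 ^ \<gamma> k" by (simp add: Suc_leI)
    then have "real (Suc (\<gamma> k)) \<le> real (2 ^ \<gamma> k)" by (simp only: of_nat_le_iff)
    then show "(\<Sum>i\<in>{..\<gamma> k}. 1) \<le> (2::real) ^ \<gamma> k" by simp
  qed auto
  also have "\<dots> = real (2 ^ (\<Sum>k<n. \<gamma> k))" by (simp add: power_sum)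
  finally show ?thesis by (simp only: of_nat_le_iff)
qed

section \<open>Averages over roots of unity\<close>

text \<open>A finite subgroup of the \<open>n\<close>-torus; averages over it agree with Haar
  averages on trigonometric polynomials of degree small compared with \<open>L\<close>. Its elements
  are \<open>undefined\<close> outside \<open>{..<n}\<close> and become points of a ball only
  through \<open>scp\<close>.\<close>

definition torus :: "nat \<Rightarrow> nat \<Rightarrow> (nat \<Rightarrow> complex) set" where
  "torus n L = PiE {..<n} (\<lambda>_. {z. z ^ L = 1})"

lemma card_torus: "L \<ge> 1 \<Longrightarrow> card (torus n L) = L ^ n"
  unfolding torus_def by (subst card_PiE) (auto simp: card_complex_roots_unity)

lemma root_unity_norm: "L \<ge> 1 \<Longrightarrow> z ^ L = 1 \<Longrightarrow> cmod z = 1"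
  using power_eq_1_iff[of z L] by auto

lemma torus_norm: "L \<ge> 1 \<Longrightarrow> \<tau> \<in> torus n L \<Longrightarrow> k < n \<Longrightarrow> cmod (\<tau> k) = 1"
  unfolding torus_def by (rule root_unity_norm) auto

text \<open>Off the diagonal, multiplication by the primitive root \<open>w\<close> permutes the
  roots and multiplies the sum by \<open>w ^ a * cnj w ^ b\<close>. This factor is not 1, since
  distinct exponents below \<open>L\<close> are incongruent modulo \<open>L\<close>; hence the sum
  vanishes.\<close>

lemma sum_root_powers:
  assumes L: "a < L" "b < L"
  shows "(\<Sum>r | r ^ L = 1. r ^ a * cnj r ^ b) = (if a = b then of_nat L else (0::complex))"
proof (cases "a = b")
  case True
  have L1: "L \<ge> 1" using L by auto
  have "r ^ a * cnj r ^ b = 1" if "r ^ L = 1" for r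
    using root_unity_norm[OF L1 that] True
    by (simp add: power_mult_distrib[symmetric] complex_norm_square[symmetric])
  then have "(\<Sum>r | r ^ L = 1. r ^ a * cnj r ^ b) = (\<Sum>r | r ^ L = (1::complex). 1)"
    by (intro sum.cong) auto
  then show ?thesis using True L1 by (simp add: card_complex_roots_unity)
next
  case False
  define w where "w = cis (2 * pi / real L)"
  have wL: "w ^ L = 1" using L by (simp add: w_def Complex.DeMoivre)
  have w0: "w \<noteq> 0" by (simp add: w_def)
  let ?S = "\<Sum>r | r ^ L = 1. r ^ a * cnj r ^ b"
  have "?S = (\<Sum>r | r ^ L = 1. (w * r) ^ a * cnj (w * r) ^ b)"
    by (rule sum.reindex_bij_witness[of _ "\<lambda>r. w * r" "\<lambda>r. r / w"])
      (auto simp: w0 wL power_mult_distrib power_divide)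
  also have "\<dots> = (w ^ a * cnj w ^ b) * ?S"
    by (simp add: sum_distrib_left power_mult_distrib mult_ac)
  finally have eq: "(1 - w ^ a * cnj w ^ b) * ?S = 0" by (simp add: algebra_simps)
  have "w ^ a * cnj w ^ b = cis ((real a - real b) * (2 * pi / real L))"
    by (simp add: w_def cis_cnj Complex.DeMoivre cis_mult algebra_simps diff_divide_distrib)
  moreover have "\<dots> \<noteq> 1"
  proof
    assume "cis ((real a - real b) * (2 * pi / real L)) = 1"
    then have "cos ((real a - real b) * (2 * pi / real L)) = 1"
      by (simp add: complex_eq_iff)
    then obtain j :: int where "(real a - real b) * (2 * pi / real L) = real_of_int j * 2 * pi"
      unfolding cos_one_2pi_int by auto
    then have "(real a - real b) * pi = (real_of_int j * real L) * pi" using L by (simp add: field_simps)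
    then have "real a - real b = real_of_int j * real L" by simp
    then have j: "int a - int b = j * int L"
      by (metis (mono_tags, lifting) of_int_diff of_int_eq_iff of_int_mult of_int_of_nat_eq)
    then have "int L dvd int a - int b" by simp
    then have "int a mod int L = int b mod int L" by (simp add: mod_eq_dvd_iff)
    then show False using L False by simp
  qed
  ultimately have "?S = 0" using eq by simp
  then show ?thesis using False by simp
qed

lemma torus_orth:
  assumes "\<alpha> \<in> mi n" "\<beta> \<in> mi n" "\<And>k. \<alpha> k < L" "\<And>k. \<beta> k < L"
  shows "(\<Sum>\<tau>\<in>torus n L. mono n \<alpha> \<tau> * cnj (mono n \<beta> \<tau>)) = (if \<alpha> = \<beta> then of_nat L ^ n else 0)"
proof -
  have L: "L \<ge> 1" using assms(3)[of 0] by auto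
  have "(\<Sum>\<tau>\<in>torus n L. mono n \<alpha> \<tau> * cnj (mono n \<beta> \<tau>))
      = (\<Sum>\<tau>\<in>torus n L. \<Prod>k<n. \<tau> k ^ \<alpha> k * cnj (\<tau> k) ^ \<beta> k)"
    by (simp add: mono_def prod.distrib)
  also have "\<dots> = (\<Prod>k<n. \<Sum>r | r ^ L = 1. r ^ \<alpha> k * cnj r ^ \<beta> k)"
    unfolding torus_def using L by (subst prod_sum_PiE) (auto simp: finite_roots_unity)
  also have "\<dots> = (\<Prod>k<n. if \<alpha> k = \<beta> k then of_nat L else 0)"
    using assms by (intro prod.cong refl sum_root_powers) auto
  also have "\<dots> = (if \<alpha> = \<beta> then of_nat L ^ n else 0)"
  proof (cases "\<alpha> = \<beta>")
    case False
    then obtain k where k: "\<alpha> k \<noteq> \<beta> k" by auto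
    then have "k < n" using assms by (cases "k < n") (auto simp: mi_def)
    then show ?thesis using k False by auto
  qed auto
  finally show ?thesis .
qed

lemma torus_coeff:
  assumes A: "finite A" "A \<subseteq> mi n" "\<forall>\<alpha>\<in>A. \<forall>k. \<alpha> k < L" and a: "\<alpha> \<in> A"
  shows "(\<Sum>\<tau>\<in>torus n L. (\<Sum>\<beta>\<in>A. b \<beta> * mono n \<beta> \<tau>) * cnj (mono n \<alpha> \<tau>)) = of_nat L ^ n * b \<alpha>"
proof -
  have "(\<Sum>\<tau>\<in>torus n L. (\<Sum>\<beta>\<in>A. b \<beta> * mono n \<beta> \<tau>) * cnj (mono n \<alpha> \<tau>))
     = (\<Sum>\<beta>\<in>A. b \<beta> * (\<Sum>\<tau>\<in>torus n L. mono n \<beta> \<tau> * cnj (mono n \<alpha> \<tau>)))"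
    unfolding sum_distrib_left sum_distrib_right by (subst sum.swap) (simp add: mult_ac)
  also have "\<dots> = (\<Sum>\<beta>\<in>A. b \<beta> * (if \<beta> = \<alpha> then of_nat L ^ n else 0))"
    using A a by (intro sum.cong refl arg_cong2[where f = "(*)"] torus_orth) auto
  also have "\<dots> = of_nat L ^ n * b \<alpha>"
    using A a by (simp add: if_distrib[where f = "\<lambda>x. b _ * x"] sum.delta cong: if_cong)
  finally show ?thesis .
qed

lemma parseval:
  assumes A: "finite A" "A \<subseteq> mi n" "\<forall>\<alpha>\<in>A. \<forall>k. \<alpha> k < L"
  shows "(\<Sum>\<tau>\<in>torus n L. (cmod (\<Sum>\<alpha>\<in>A. b \<alpha> * mono n \<alpha> \<tau>))\<^sup>2)
       = real L ^ n * (\<Sum>\<alpha>\<in>A. (cmod (b \<alpha>))\<^sup>2)"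
proof -
  let ?f = "\<lambda>\<tau>. \<Sum>\<alpha>\<in>A. b \<alpha> * mono n \<alpha> \<tau>"
  have "complex_of_real (\<Sum>\<tau>\<in>torus n L. (cmod (?f \<tau>))\<^sup>2) = (\<Sum>\<tau>\<in>torus n L. ?f \<tau> * cnj (?f \<tau>))"
    by (simp only: of_real_sum complex_norm_square)
  also have "\<dots> = (\<Sum>\<alpha>\<in>A. cnj (b \<alpha>) * (\<Sum>\<tau>\<in>torus n L. ?f \<tau> * cnj (mono n \<alpha> \<tau>)))"
    unfolding sum_distrib_left cnj_sum by (subst sum.swap) (simp add: mult_ac)
  also have "\<dots> = (\<Sum>\<alpha>\<in>A. cnj (b \<alpha>) * (of_nat L ^ n * b \<alpha>))"
    using A by (intro sum.cong refl arg_cong2[where f = "(*)"] torus_coeff) auto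
  also have "\<dots> = complex_of_real (real L ^ n * (\<Sum>\<alpha>\<in>A. (cmod (b \<alpha>))\<^sup>2))"
    unfolding of_real_mult of_real_sum complex_norm_square by (simp add: sum_distrib_left mult_ac)
  finally show ?thesis by (simp only: of_real_eq_iff)
qed

section \<open>Comparison of moments of polynomials on the torus\<close>

lemma mono_add: "mono n (\<lambda>k. \<alpha> k + \<beta> k) z = mono n \<alpha> z * mono n \<beta> z"
  by (simp add: mono_def power_add prod.distrib)

text \<open>The fourth moment is the second moment of the square, so Parseval applies to the
  coefficients \<open>d \<gamma>\<close> of the square. Each \<open>d \<gamma>\<close> collects at
  most \<open>4 ^ m\<close> pairs, and Cauchy--Schwarz on this fibre loses only that number.
  Exponents of the square reach \<open>2 * m\<close>, whence the condition on
  \<open>L\<close>.\<close>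

lemma torus_fourth_moment:
  assumes A: "A \<subseteq> bmi n m" and L: "2 * m < L"
  shows "(\<Sum>\<tau>\<in>torus n L. (cmod (\<Sum>\<alpha>\<in>A. b \<alpha> * mono n \<alpha> \<tau>)) ^ 4)
       \<le> real L ^ n * (4 ^ m * (\<Sum>\<alpha>\<in>A. (cmod (b \<alpha>))\<^sup>2)\<^sup>2)"
proof -
  have fin: "finite A" using A finite_bmi finite_subset by blast
  let ?f = "\<lambda>\<tau>. \<Sum>\<alpha>\<in>A. b \<alpha> * mono n \<alpha> \<tau>"
  let ?p = "\<lambda>(\<alpha>::nat\<Rightarrow>nat, \<beta>) k. \<alpha> k + \<beta> k"
  let ?G = "?p ` (A \<times> A)"
  let ?fib = "\<lambda>\<gamma>. {q \<in> A \<times> A. ?p q = \<gamma>}"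
  define d where "d \<gamma> = (\<Sum>(\<alpha>, \<beta>)\<in>?fib \<gamma>. b \<alpha> * b \<beta>)" for \<gamma>
  have finG: "finite ?G" using fin by simp
  have G: "?G \<subseteq> mi n" using A by (auto simp: bmi_def mi_def)
  have GL: "\<gamma> k < L" if g: "\<gamma> \<in> ?G" for \<gamma> k
  proof -
    obtain \<alpha> \<beta> where q: "\<alpha> \<in> A" "\<beta> \<in> A" "\<gamma> = (\<lambda>k. \<alpha> k + \<beta> k)" using g by auto
    have "\<alpha> k \<le> m" "\<beta> k \<le> m" using q A by (auto intro: bmi_le)
    then show ?thesis using L q(3) by simp
  qed
  have sq: "(?f \<tau>)\<^sup>2 = (\<Sum>\<gamma>\<in>?G. d \<gamma> * mono n \<gamma> \<tau>)" for \<tau>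
  proof -
    have "(?f \<tau>)\<^sup>2 = (\<Sum>q\<in>A \<times> A. (case q of (\<alpha>, \<beta>) \<Rightarrow> b \<alpha> * b \<beta>) * mono n (?p q) \<tau>)"
      unfolding power2_eq_square sum_product sum.cartesian_product
      by (intro sum.cong refl) (auto simp: mono_add)
    also have "\<dots> = (\<Sum>\<gamma>\<in>?G. \<Sum>q\<in>?fib \<gamma>. (case q of (\<alpha>, \<beta>) \<Rightarrow> b \<alpha> * b \<beta>) * mono n (?p q) \<tau>)"
      using fin by (subst sum.image_gen[of "A \<times> A" _ ?p]) auto
    also have "\<dots> = (\<Sum>\<gamma>\<in>?G. d \<gamma> * mono n \<gamma> \<tau>)"
      unfolding d_def sum_distrib_right by (intro sum.cong refl) auto
    finally show ?thesis .
  qed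
  \<comment> \<open>A pair in the fibre is determined by its first component, which lies below
    \<open>\<gamma>\<close>, and \<open>\<gamma>\<close> has degree at most
    \<open>2 * m\<close>.\<close>
  have cardfib: "real (card (?fib \<gamma>)) \<le> 4 ^ m" if gG: "\<gamma> \<in> ?G" for \<gamma>
  proof -
    have inj: "inj_on fst (?fib \<gamma>)"
    proof (rule inj_onI)
      fix p q assume *: "p \<in> ?fib \<gamma>" "q \<in> ?fib \<gamma>" "fst p = fst q"
      have "(\<lambda>k. fst p k + snd p k) = \<gamma>" "(\<lambda>k. fst q k + snd q k) = \<gamma>" using *(1,2) by auto
      then have "fst p k + snd p k = \<gamma> k" "fst q k + snd q k = \<gamma> k" for k by metis+
      then have "snd p k = snd q k" for k using *(3) by (metis add_left_cancel)
      then show "p = q" using *(3) by (auto simp: prod_eq_iff)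
    qed
    have sub: "fst ` ?fib \<gamma> \<subseteq> {\<alpha> \<in> mi n. \<forall>k<n. \<alpha> k \<le> \<gamma> k}"
      using A by (auto simp: bmi_def)
    have finb: "finite {\<alpha> \<in> mi n. \<forall>k<n. \<alpha> k \<le> \<gamma> k}"
      by (rule sum_prod_le_prod_sum(1)[of n "\<lambda>k. {..\<gamma> k}" _ "\<lambda>_ _. 0"]) auto
    obtain \<alpha> \<beta> where g: "\<alpha> \<in> A" "\<beta> \<in> A" "\<gamma> = (\<lambda>k. \<alpha> k + \<beta> k)" using gG by auto
    have "(\<Sum>k<n. \<gamma> k) = (\<Sum>k<n. \<alpha> k) + (\<Sum>k<n. \<beta> k)" using g by (simp add: sum.distrib)
    also have "\<dots> \<le> m + m" using g A by (intro add_mono) (auto simp: bmi_def mdeg_mi)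
    finally have deg: "(\<Sum>k<n. \<gamma> k) \<le> 2 * m" by simp
    have "card (?fib \<gamma>) \<le> 2 ^ (\<Sum>k<n. \<gamma> k)"
      using card_image[OF inj] card_mono[OF finb sub] card_below_le[of n \<gamma>] by simp
    also have "\<dots> \<le> 2 ^ (2 * m)" using deg by (intro power_increasing) auto
    finally have "card (?fib \<gamma>) \<le> 4 ^ m" by (simp add: power_mult)
    then have "real (card (?fib \<gamma>)) \<le> real (4 ^ m)" by (simp only: of_nat_le_iff)
    then show ?thesis by simp
  qed
  have dle: "(cmod (d \<gamma>))\<^sup>2 \<le> 4 ^ m * (\<Sum>(\<alpha>, \<beta>)\<in>?fib \<gamma>. (cmod (b \<alpha>))\<^sup>2 * (cmod (b \<beta>))\<^sup>2)"
    if "\<gamma> \<in> ?G" for \<gamma>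
  proof -
    have "cmod (d \<gamma>) \<le> (\<Sum>q\<in>?fib \<gamma>. 1 * cmod (case q of (\<alpha>, \<beta>) \<Rightarrow> b \<alpha> * b \<beta>))"
      unfolding d_def by (simp add: norm_sum)
    then have "(cmod (d \<gamma>))\<^sup>2 \<le> (\<Sum>q\<in>?fib \<gamma>. 1 * cmod (case q of (\<alpha>, \<beta>) \<Rightarrow> b \<alpha> * b \<beta>))\<^sup>2"
      by (intro power_mono) auto
    also have "\<dots> \<le> (\<Sum>q\<in>?fib \<gamma>. 1\<^sup>2) * (\<Sum>q\<in>?fib \<gamma>. (cmod (case q of (\<alpha>, \<beta>) \<Rightarrow> b \<alpha> * b \<beta>))\<^sup>2)"
      by (rule Cauchy_Schwarz_ineq_sum)
    also have "\<dots> \<le> 4 ^ m * (\<Sum>q\<in>?fib \<gamma>. (cmod (case q of (\<alpha>, \<beta>) \<Rightarrow> b \<alpha> * b \<beta>))\<^sup>2)"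
      using cardfib[OF that] by (intro mult_right_mono sum_nonneg) auto
    also have "\<dots> = 4 ^ m * (\<Sum>(\<alpha>, \<beta>)\<in>?fib \<gamma>. (cmod (b \<alpha>))\<^sup>2 * (cmod (b \<beta>))\<^sup>2)"
      by (intro arg_cong2[where f = "(*)"] refl sum.cong) (auto simp: norm_mult power_mult_distrib)
    finally show ?thesis .
  qed
  have "(\<Sum>\<tau>\<in>torus n L. (cmod (?f \<tau>)) ^ 4) = (\<Sum>\<tau>\<in>torus n L. (cmod ((?f \<tau>)\<^sup>2))\<^sup>2)"
    by (simp add: norm_power power_mult[symmetric])
  also have "\<dots> = real L ^ n * (\<Sum>\<gamma>\<in>?G. (cmod (d \<gamma>))\<^sup>2)"
    unfolding sq by (rule parseval) (use finG G GL in blast)+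
  also have "\<dots> \<le> real L ^ n * (\<Sum>\<gamma>\<in>?G. 4 ^ m * (\<Sum>(\<alpha>, \<beta>)\<in>?fib \<gamma>. (cmod (b \<alpha>))\<^sup>2 * (cmod (b \<beta>))\<^sup>2))"
    by (intro mult_left_mono sum_mono dle) auto
  also have "(\<Sum>\<gamma>\<in>?G. 4 ^ m * (\<Sum>(\<alpha>, \<beta>)\<in>?fib \<gamma>. (cmod (b \<alpha>))\<^sup>2 * (cmod (b \<beta>))\<^sup>2))
      = 4 ^ m * (\<Sum>(\<alpha>, \<beta>)\<in>A \<times> A. (cmod (b \<alpha>))\<^sup>2 * (cmod (b \<beta>))\<^sup>2)"
    using fin by (subst sum.image_gen[of "A \<times> A" _ ?p]) (auto simp: sum_distrib_left)
  also have "(\<Sum>(\<alpha>, \<beta>)\<in>A \<times> A. (cmod (b \<alpha>))\<^sup>2 * (cmod (b \<beta>))\<^sup>2) = (\<Sum>\<alpha>\<in>A. (cmod (b \<alpha>))\<^sup>2)\<^sup>2"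
    by (simp add: power2_eq_square sum_product sum.cartesian_product)
  finally show ?thesis .
qed

text \<open>An interpolation between the first and the fourth moment: the second moment is bounded
  by \<open>a\<close> times the first plus the fourth divided by \<open>a\<^sup>2\<close>, and
  \<open>torus_fourth_moment\<close> allows the last term to be absorbed. The loss is exponential in
  \<open>m\<close> but independent of \<open>n\<close>.\<close>

lemma torus_L2_le_L1:
  assumes A: "A \<subseteq> bmi n m" and L: "2 * m < L"
  shows "sqrt (\<Sum>\<alpha>\<in>A. (cmod (b \<alpha>))\<^sup>2)
     \<le> 3 * 2 ^ m * ((\<Sum>\<tau>\<in>torus n L. cmod (\<Sum>\<alpha>\<in>A. b \<alpha> * mono n \<alpha> \<tau>)) / real L ^ n)"
proof (cases "(\<Sum>\<alpha>\<in>A. (cmod (b \<alpha>))\<^sup>2) = 0")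
  case True
  then show ?thesis by (simp add: sum_nonneg)
next
  case False
  let ?f = "\<lambda>\<tau>. \<Sum>\<alpha>\<in>A. b \<alpha> * mono n \<alpha> \<tau>"
  define S where "S = (\<Sum>\<alpha>\<in>A. (cmod (b \<alpha>))\<^sup>2)"
  define q where "q = real L ^ n"
  define E where "E = (\<Sum>\<tau>\<in>torus n L. cmod (?f \<tau>))"
  have q: "q > 0" using L by (simp add: q_def)
  have fin: "finite A" using A finite_bmi finite_subset by blast
  have S: "S > 0" using False sum_nonneg[of A "\<lambda>\<alpha>. (cmod (b \<alpha>))\<^sup>2"] unfolding S_def
    by (auto simp: less_le)
  \<comment> \<open>Chosen so that the fourth moment divided by \<open>a\<^sup>2\<close> is at most
    half of the second moment \<open>q * S\<close>. The resulting factor \<open>2 * sqrt 2\<close>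
    is rounded up to 3.\<close>
  define a where "a = sqrt 2 * 2 ^ m * sqrt S"
  have a: "a > 0" using S by (simp add: a_def)
  have "(2 ^ m)\<^sup>2 = (4::real) ^ m" by (simp add: power2_eq_square power_mult_distrib[symmetric])
  then have a2: "a\<^sup>2 = 2 * 4 ^ m * S" using S by (simp add: a_def power_mult_distrib)
  have elem: "x\<^sup>2 \<le> a * x + x ^ 4 / a\<^sup>2" if x: "x \<ge> 0" for x
  proof (cases "x \<le> a")
    case True
    have "x\<^sup>2 \<le> a * x" using True x by (simp add: power2_eq_square mult_right_mono)
    then show ?thesis using a x by (simp add: add_increasing2)
  next
    case False
    have "x\<^sup>2 * a\<^sup>2 \<le> x\<^sup>2 * x\<^sup>2" using False a by (intro mult_left_mono power_mono) auto
    then have "x\<^sup>2 \<le> x ^ 4 / a\<^sup>2" using a by (simp add: field_simps power2_eq_square power4_eq_xxxx)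
    then show ?thesis using a x by (simp add: add_increasing)
  qed
  have "q * S = (\<Sum>\<tau>\<in>torus n L. (cmod (?f \<tau>))\<^sup>2)"
    unfolding q_def S_def
  proof (rule parseval[symmetric, OF fin])
    show "A \<subseteq> mi n" using A by (auto simp: bmi_def)
    show "\<forall>\<alpha>\<in>A. \<forall>k. \<alpha> k < L"
    proof (intro ballI allI)
      show "\<alpha> k < L" if "\<alpha> \<in> A" for \<alpha> k using bmi_le[of \<alpha> n m k] that A L by auto
    qed
  qed
  also have "\<dots> \<le> (\<Sum>\<tau>\<in>torus n L. a * cmod (?f \<tau>) + (cmod (?f \<tau>)) ^ 4 / a\<^sup>2)"
    by (intro sum_mono elem) auto
  also have "\<dots> = a * E + (\<Sum>\<tau>\<in>torus n L. (cmod (?f \<tau>)) ^ 4) / a\<^sup>2"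
    by (simp add: E_def sum.distrib sum_distrib_left sum_divide_distrib)
  also have "\<dots> \<le> a * E + (q * (4 ^ m * S\<^sup>2)) / a\<^sup>2"
    using torus_fourth_moment[OF A L, of b] by (simp add: q_def S_def divide_right_mono)
  also have "\<dots> = a * E + q * S / 2"
    unfolding a2 using S by (simp add: field_simps power2_eq_square)
  finally have "q * S \<le> 2 * a * E" by simp
  also have "\<dots> = (2 * sqrt 2 * 2 ^ m * E) * sqrt S" by (simp add: a_def)
  finally have "q * S \<le> (2 * sqrt 2 * 2 ^ m * E) * sqrt S" .
  moreover have "q * S = (q * sqrt S) * sqrt S" using S by (simp add: mult.assoc)
  ultimately have "(q * sqrt S) * sqrt S \<le> (2 * sqrt 2 * 2 ^ m * E) * sqrt S" by (simp only:)
  then have 1: "q * sqrt S \<le> 2 * sqrt 2 * 2 ^ m * E" by (rule mult_right_le_imp_le) (simp add: S)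
  have "E \<ge> 0" unfolding E_def by (intro sum_nonneg) auto
  moreover have "2 * sqrt 2 \<le> 3" by (rule power2_le_imp_le) (auto simp: power_mult_distrib)
  ultimately have "2 * sqrt 2 * 2 ^ m * E \<le> 3 * 2 ^ m * E" by (intro mult_right_mono) auto
  with 1 have "q * sqrt S \<le> 3 * 2 ^ m * E" by linarith
  then show ?thesis using q by (simp add: S_def q_def E_def field_simps)
qed

definition scp :: "nat \<Rightarrow> (nat \<Rightarrow> complex) \<Rightarrow> (nat \<Rightarrow> complex) \<Rightarrow> nat \<Rightarrow> complex" where
  "scp n s \<tau> = (\<lambda>k. if k < n then s k * \<tau> k else 0)"

lemma mono_scp: "mono n \<alpha> (scp n s \<tau>) = mono n \<alpha> s * mono n \<alpha> \<tau>"
  unfolding mono_def scp_def prod.distrib[symmetric] by (intro prod.cong) (auto simp: power_mult_distrib)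

section \<open>Near-optimal designs\<close>

lemma prod_one_plus_ge: "finite A \<Longrightarrow> (\<And>a. a \<in> A \<Longrightarrow> 0 \<le> r a) \<Longrightarrow> 1 + (\<Sum>a\<in>A. r a) \<le> (\<Prod>a\<in>A. 1 + (r a::real))"
proof (induction A rule: finite_induct)
  case (insert a A)
  have "1 + (\<Sum>a\<in>insert a A. r a) \<le> (1 + r a) * (1 + (\<Sum>a\<in>A. r a))"
    using insert by (simp add: algebra_simps sum_nonneg)
  also have "\<dots> \<le> (1 + r a) * (\<Prod>a\<in>A. 1 + r a)"
    using insert by (intro mult_left_mono) auto
  finally show ?case using insert by simp
qed simp

text \<open>Maximise \<open>\<Prod>a\<in>A. x a\<close> up to a factor 2; moving from the near-maximiser towards any other
  point by the fraction \<open>1 / (card A + 1)\<close> cannot increase the product by more than that factor.\<close>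

lemma near_optimal_point:
  fixes K :: "('a \<Rightarrow> real) set"
  assumes A: "finite A" "A \<noteq> {}"
    and bound: "\<And>x a. x \<in> K \<Longrightarrow> a \<in> A \<Longrightarrow> 0 \<le> x a \<and> x a \<le> B a"
    and x0: "x0 \<in> K" "\<And>a. a \<in> A \<Longrightarrow> 0 < x0 a"
    and conv: "\<And>x y t. x \<in> K \<Longrightarrow> y \<in> K \<Longrightarrow> 0 \<le> t \<Longrightarrow> t \<le> 1 \<Longrightarrow> (\<lambda>a. (1 - t) * x a + t * y a) \<in> K"
  shows "\<exists>x\<in>K. (\<forall>a\<in>A. 0 < x a) \<and> (\<forall>y\<in>K. (\<Sum>a\<in>A. y a / x a) \<le> 6 * real (card A))"
proof -
  define p where "p x = (\<Prod>a\<in>A. x a)" for x :: "'a \<Rightarrow> real"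
  have bdd: "bdd_above (p ` K)"
    unfolding p_def by (intro bdd_aboveI2[of _ _ "\<Prod>a\<in>A. B a"] prod_mono) (use bound in auto)
  define s where "s = Sup (p ` K)"
  have ps: "p x \<le> s" if "x \<in> K" for x unfolding s_def using bdd that by (intro cSUP_upper) auto
  have "0 < p x0" unfolding p_def using x0 by (intro prod_pos) auto
  then have s0: "0 < s" using ps[OF x0(1)] by linarith
  have "\<exists>y\<in>p ` K. s / 2 < y"
    by (rule less_cSupD[of "p ` K" "s / 2"]) (use x0 s0 in \<open>auto simp: s_def\<close>)
  then obtain x where x: "x \<in> K" "s / 2 < p x" by auto
  have px: "0 < p x" using x s0 by linarith
  have xpos: "0 < x a" if "a \<in> A" for a
  proof -
    have "x a \<noteq> 0" using px that A unfolding p_def by (metis less_irrefl prod_zero)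
    then show ?thesis using bound[OF x(1) that] by linarith
  qed
  define d where "d = real (card A)"
  have d: "d \<ge> 1" using A by (auto simp: d_def Suc_leI card_gt_0_iff)
  have "(\<Sum>a\<in>A. y a / x a) \<le> 6 * d" if y: "y \<in> K" for y
  proof -
    define t where "t = 1 / (d + 1)"
    have t: "0 < t" "t < 1" using d by (auto simp: t_def)
    have tt: "1 - t = d / (d + 1)" using d by (simp add: t_def field_simps)
    have r: "0 \<le> y a / x a / d" if "a \<in> A" for a
      using bound[OF y that] xpos[OF that] d by simp
    have "p (\<lambda>a. (1 - t) * x a + t * y a) \<le> s" using t by (intro ps conv x y) auto
    also have "p (\<lambda>a. (1 - t) * x a + t * y a) = (\<Prod>a\<in>A. ((1 - t) * x a) * (1 + (y a / x a) / d))"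
      unfolding p_def
    proof (rule prod.cong[OF refl])
      fix a assume "a \<in> A"
      then have "x a \<noteq> 0" using xpos[of a] by simp
      have "((1 - t) * x a) * (1 + (y a / x a) / d) = (1 - t) * x a + (1 - t) / d * y a"
        using \<open>x a \<noteq> 0\<close> by (simp add: distrib_left)
      also have "(1 - t) / d = t" unfolding tt using d by (simp add: t_def)
      finally show "(1 - t) * x a + t * y a = ((1 - t) * x a) * (1 + (y a / x a) / d)" ..
    qed
    also have "\<dots> = (1 - t) ^ card A * p x * (\<Prod>a\<in>A. 1 + (y a / x a) / d)"
      by (simp add: prod.distrib p_def)
    finally have 1: "(1 - t) ^ card A * p x * (\<Prod>a\<in>A. 1 + (y a / x a) / d) < 2 * p x"
      using x(2) by linarith
    have "1 + (\<Sum>a\<in>A. (y a / x a) / d) \<le> (\<Prod>a\<in>A. 1 + (y a / x a) / d)"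
      using A(1) r by (rule prod_one_plus_ge)
    then have "(1 - t) ^ card A * p x * (1 + (\<Sum>a\<in>A. (y a / x a) / d))
        \<le> (1 - t) ^ card A * p x * (\<Prod>a\<in>A. 1 + (y a / x a) / d)"
      using t px by (intro mult_left_mono) auto
    with 1 have "(1 - t) ^ card A * p x * (1 + (\<Sum>a\<in>A. (y a / x a) / d)) < 2 * p x"
      by linarith
    then have "p x * ((1 - t) ^ card A * (1 + (\<Sum>a\<in>A. (y a / x a) / d))) < p x * 2"
      by (simp add: mult_ac)
    then have 2: "(1 - t) ^ card A * (1 + (\<Sum>a\<in>A. (y a / x a) / d)) < 2" using px by simp
    \<comment> \<open>Since \<open>1 / (1 - t) = 1 + 1 / d\<close>, the factor lost by shrinking
      \<open>x\<close> is at most \<open>exp 1 \<le> 3\<close>. Together with the factor 2 of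
      near-maximality this is the origin of the constant 6.\<close>
    have "(1 / (1 - t)) ^ card A \<le> 3"
    proof -
      have "1 / (1 - t) = 1 + 1 / d" using d by (simp add: tt field_simps)
      then have "(1 / (1 - t)) ^ card A \<le> exp (real (card A) * (1 / d))"
        using d one_plus_power_le_exp[of "1 / d" "card A"] by simp
      also have "\<dots> = exp 1" using d by (simp add: d_def)
      finally show ?thesis using exp_le by linarith
    qed
    then have "1 \<le> 3 * (1 - t) ^ card A" using t by (simp add: field_simps power_one_over)
    then have "1 / 3 \<le> (1 - t) ^ card A" by simp
    then have "1 / 3 * (1 + (\<Sum>a\<in>A. (y a / x a) / d)) \<le> (1 - t) ^ card A * (1 + (\<Sum>a\<in>A. (y a / x a) / d))"
      using r by (intro mult_right_mono add_nonneg_nonneg sum_nonneg) auto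
    with 2 have "(\<Sum>a\<in>A. (y a / x a) / d) \<le> 6" by simp
    then have "(\<Sum>a\<in>A. y a / x a) / d \<le> 6" by (simp only: sum_divide_distrib)
    then show ?thesis using d by (simp add: pos_divide_le_eq)
  qed
  then show ?thesis using x(1) xpos unfolding d_def by blast
qed

text \<open>\<open>near_optimal_point\<close> applied to the convex hull of the vectors
  \<open>v s\<close>; the optimality inequality is then read off at the generators. This is an
  approximate Kiefer--Wolfowitz statement with \<open>l\<close> as the design.\<close>

lemma optimal_weights:
  fixes v :: "'s \<Rightarrow> 'a \<Rightarrow> real"
  assumes A: "finite A" "A \<noteq> {}"
    and bound: "\<And>s a. s \<in> S \<Longrightarrow> a \<in> A \<Longrightarrow> 0 \<le> v s a \<and> v s a \<le> B a"
    and s0: "s0 \<in> S" "\<And>a. a \<in> A \<Longrightarrow> 0 < v s0 a"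
  shows "\<exists>F l. finite F \<and> F \<subseteq> S \<and> (\<forall>s\<in>F. 0 \<le> l s) \<and> (\<Sum>s\<in>F. l s) = 1 \<and>
     (\<forall>a\<in>A. 0 < (\<Sum>s\<in>F. l s * v s a)) \<and>
     (\<forall>s\<in>S. (\<Sum>a\<in>A. v s a / (\<Sum>s\<in>F. l s * v s a)) \<le> 6 * real (card A))"
proof -
  define K where "K = {x. \<exists>F l. finite F \<and> F \<subseteq> S \<and> (\<forall>s\<in>F. 0 \<le> l s) \<and> (\<Sum>s\<in>F. l s) = 1 \<and>
      x = (\<lambda>a. \<Sum>s\<in>F. l s * v s a)}"
  have vK: "v s \<in> K" if "s \<in> S" for s
    unfolding K_def using that by (intro CollectI exI[of _ "{s}"] exI[of _ "\<lambda>_. 1"]) auto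
  have "\<exists>x\<in>K. (\<forall>a\<in>A. 0 < x a) \<and> (\<forall>y\<in>K. (\<Sum>a\<in>A. y a / x a) \<le> 6 * real (card A))"
  proof (rule near_optimal_point[OF A, of K B "v s0"])
    fix x a assume "x \<in> K" "a \<in> A"
    then obtain F l where F: "finite F" "F \<subseteq> S" "\<forall>s\<in>F. 0 \<le> l s" "(\<Sum>s\<in>F. l s) = (1::real)"
      "x = (\<lambda>a. \<Sum>s\<in>F. l s * v s a)" unfolding K_def by blast
    have "x a \<le> (\<Sum>s\<in>F. l s * B a)"
      unfolding F(5) using F bound \<open>a \<in> A\<close> by (intro sum_mono mult_left_mono) auto
    also have "\<dots> = B a" using F by (simp add: sum_distrib_right[symmetric])
    finally show "0 \<le> x a \<and> x a \<le> B a"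
      using F bound \<open>a \<in> A\<close> by (auto intro!: sum_nonneg mult_nonneg_nonneg)
  next
    fix x y and t :: real assume xy: "x \<in> K" "y \<in> K" and t: "0 \<le> t" "t \<le> 1"
    obtain F l where F: "finite F" "F \<subseteq> S" "\<forall>s\<in>F. 0 \<le> l s" "(\<Sum>s\<in>F. l s) = (1::real)"
      "x = (\<lambda>a. \<Sum>s\<in>F. l s * v s a)" using xy(1) unfolding K_def by blast
    obtain G k where G: "finite G" "G \<subseteq> S" "\<forall>s\<in>G. 0 \<le> k s" "(\<Sum>s\<in>G. k s) = (1::real)"
      "y = (\<lambda>a. \<Sum>s\<in>G. k s * v s a)" using xy(2) unfolding K_def by blast
    \<comment> \<open>Nothing is known of \<open>l\<close> outside \<open>F\<close> or of
      \<open>k\<close> outside \<open>G\<close>, so both are cut off before they are mixed on the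
      common support.\<close>
    let ?l = "\<lambda>s. if s \<in> F then l s else 0" and ?k = "\<lambda>s. if s \<in> G then k s else 0"
    have ext: "(\<Sum>s\<in>F \<union> G. ?l s * h s) = (\<Sum>s\<in>F. l s * h s)"
      "(\<Sum>s\<in>F \<union> G. ?k s * h s) = (\<Sum>s\<in>G. k s * h s)" for h :: "'s \<Rightarrow> real"
      using F(1) G(1) by (intro sum.mono_neutral_cong_right; auto)+
    have comb: "(\<Sum>s\<in>F \<union> G. ((1 - t) * ?l s + t * ?k s) * h s)
       = (1 - t) * (\<Sum>s\<in>F. l s * h s) + t * (\<Sum>s\<in>G. k s * h s)" for h :: "'s \<Rightarrow> real"
      by (simp only: ext[symmetric] sum_distrib_left sum.distrib[symmetric])
        (simp only: distrib_right mult.assoc)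
    show "(\<lambda>a. (1 - t) * x a + t * y a) \<in> K"
      unfolding K_def
    proof (intro CollectI exI[of _ "F \<union> G"] exI[of _ "\<lambda>s. (1 - t) * ?l s + t * ?k s"] conjI)
      show "(\<Sum>s\<in>F \<union> G. (1 - t) * ?l s + t * ?k s) = 1"
        using comb[of "\<lambda>_. 1"] F G by simp
      show "(\<lambda>a. (1 - t) * x a + t * y a) = (\<lambda>a. \<Sum>s\<in>F \<union> G. ((1 - t) * ?l s + t * ?k s) * v s a)"
        unfolding comb F(5) G(5) ..
    qed (use F G t in \<open>auto intro!: add_nonneg_nonneg mult_nonneg_nonneg\<close>)
  qed (use s0 vK in auto)
  then obtain x where "x \<in> K" and x: "\<forall>a\<in>A. 0 < x a" "\<forall>y\<in>K. (\<Sum>a\<in>A. y a / x a) \<le> 6 * real (card A)"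
    by blast
  then obtain F l where F: "finite F" "F \<subseteq> S" "\<forall>s\<in>F. 0 \<le> l s" "(\<Sum>s\<in>F. l s) = (1::real)"
    "x = (\<lambda>a. \<Sum>s\<in>F. l s * v s a)" unfolding K_def by blast
  show ?thesis
    by (rule exI[of _ F], rule exI[of _ l]) (use F x vK in auto)
qed

section \<open>Balls of two-convex lattices\<close>

text \<open>The features of \<open>ballX N n\<close> that the polynomial estimates rest on. Solidity
  gives invariance under rotation and contraction of coordinates, \<open>nonflat\<close> a point
  where no monomial vanishes, and \<open>midpoint\<close> the room for Cauchy's inequality around
  \<open>u / 2\<close>.\<close>

locale reinhardt_body =
  fixes B :: "(nat \<Rightarrow> complex) set" and n :: nat
  assumes vanish: "z \<in> B \<Longrightarrow> n \<le> k \<Longrightarrow> z k = 0"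
    and nonflat: "\<exists>w\<in>B. \<forall>k<n. w k \<noteq> 0"
    and solid: "z \<in> B \<Longrightarrow> (\<And>k. cmod (y k) \<le> cmod (z k)) \<Longrightarrow> y \<in> B"
    and bounded: "\<exists>b. \<forall>z\<in>B. \<forall>k. cmod (z k) \<le> b"
    and midpoint: "u \<in> B \<Longrightarrow> z \<in> B \<Longrightarrow> (\<lambda>k. (u k + z k) / 2) \<in> B"

section \<open>Unit balls of sequence lattices and the use of 2-convexity\<close>

locale seq_lattice =
  fixes X :: "(nat \<Rightarrow> complex) set" and N :: "(nat \<Rightarrow> complex) \<Rightarrow> real"
  assumes bsl: "banach_seq_lattice X N"
begin

lemma add_mem: "x \<in> X \<Longrightarrow> y \<in> X \<Longrightarrow> (\<lambda>k. x k + y k) \<in> X"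
  and scale_mem: "x \<in> X \<Longrightarrow> (\<lambda>k. a * x k) \<in> X"
  and norm_nonneg: "x \<in> X \<Longrightarrow> 0 \<le> N x"
  and norm_eq_0: "x \<in> X \<Longrightarrow> N x = 0 \<longleftrightarrow> x = (\<lambda>_. 0)"
  and norm_add: "x \<in> X \<Longrightarrow> y \<in> X \<Longrightarrow> N (\<lambda>k. x k + y k) \<le> N x + N y"
  and norm_scale: "x \<in> X \<Longrightarrow> N (\<lambda>k. a * x k) = cmod a * N x"
  and ideal_le: "y \<in> X \<Longrightarrow> (\<And>k. cmod (x k) \<le> cmod (y k)) \<Longrightarrow> N x \<le> N y"
  and unit_mem: "(\<lambda>k. if k = j then 1 else 0) \<in> X"
  and zero_mem: "(\<lambda>_. 0) \<in> X"
  using bsl unfolding banach_seq_lattice_def by blast+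

lemma finite_support_mem: "(\<forall>k\<ge>n. z k = 0) \<Longrightarrow> z \<in> X"
proof (induction n arbitrary: z)
  case 0
  then have "z = (\<lambda>_. 0)" by auto
  then show ?case using zero_mem by simp
next
  case (Suc n)
  have "z(n := 0) \<in> X"
  proof (rule Suc.IH, intro allI impI)
    fix k assume "n \<le> k"
    then show "(z(n := 0)) k = 0" using Suc.prems by (cases "k = n") auto
  qed
  then have "(\<lambda>k. (z(n := 0)) k + z n * (if k = n then 1 else 0)) \<in> X"
    by (intro add_mem scale_mem unit_mem)
  also have "(\<lambda>k. (z(n := 0)) k + z n * (if k = n then 1 else 0)) = z" by auto
  finally show ?case .
qed

lemma norm_modulus:
  assumes "\<forall>k\<ge>n. z k = 0"
  shows "N (\<lambda>k. if k < n then complex_of_real (cmod (z k)) else 0) = N z"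
proof -
  have *: "(\<lambda>k. if k < n then complex_of_real (cmod (z k)) else 0) \<in> X"
    by (rule finite_support_mem[of n]) auto
  show ?thesis using assms by (intro antisym ideal_le * finite_support_mem[of n z]) auto
qed

lemma ballX_eq: "ballX N n = {z. (\<forall>k\<ge>n. z k = 0) \<and> N z < 1}"
  unfolding ballX_def using norm_modulus[of n] by auto

lemma ballX_mem: "z \<in> ballX N n \<Longrightarrow> z \<in> X"
  unfolding ballX_eq by (auto intro: finite_support_mem)

lemma coord_bound: "\<exists>b. \<forall>z\<in>ballX N n. \<forall>k. cmod (z k) \<le> b"
proof -
  define e where "e j = (\<lambda>k::nat. if k = j then 1 else (0::complex))" for j
  have e: "e j \<in> X" "N (e j) > 0" for j
  proof -
    show m: "e j \<in> X" unfolding e_def by (rule unit_mem)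
    have "e j \<noteq> (\<lambda>_. 0)" by (auto simp: e_def fun_eq_iff)
    then show "N (e j) > 0" using norm_nonneg[OF m] norm_eq_0[OF m] by linarith
  qed
  have "cmod (z k) \<le> (\<Sum>j<n. 1 / N (e j))" if z: "z \<in> ballX N n" for z k
  proof (cases "k < n")
    case True
    have "cmod (z k) * N (e k) = N (\<lambda>i. z k * e k i)" using norm_scale[OF e(1)] by simp
    also have "\<dots> \<le> N z" using ballX_mem[OF z] by (intro ideal_le) (auto simp: e_def)
    also have "\<dots> < 1" using z by (simp add: ballX_eq)
    finally have "cmod (z k) \<le> 1 / N (e k)" using e(2)[of k] by (simp add: field_simps)
    also have "\<dots> \<le> (\<Sum>j<n. 1 / N (e j))"
      using True e(2) by (intro member_le_sum[of k "{..<n}" "\<lambda>j. 1 / N (e j)"]) (auto intro: less_imp_le)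
    finally show ?thesis .
  next
    case False
    then have "z k = 0" using z by (simp add: ballX_eq)
    then show ?thesis using e(2) by (auto intro!: sum_nonneg intro: less_imp_le)
  qed
  then show ?thesis by blast
qed

lemma ballX_scale_mem:
  assumes z: "z \<in> X" "\<forall>k\<ge>n. z k = 0" and c: "c > N z"
  shows "(\<lambda>k. z k / of_real c) \<in> ballX N n"
proof -
  have c0: "c > 0" using c norm_nonneg[OF z(1)] by linarith
  have "N (\<lambda>k. (1 / of_real c) * z k) = N z / c" using norm_scale[OF z(1), of "1 / of_real c"] c0
    by (simp add: norm_divide)
  also have "\<dots> < 1" using c c0 by simp
  finally show ?thesis using z by (simp add: ballX_eq)
qed

sublocale ball: reinhardt_body "ballX N n" n for n
proof
  show "\<And>z k. z \<in> ballX N n \<Longrightarrow> n \<le> k \<Longrightarrow> z k = 0" by (simp add: ballX_eq)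
  show "\<exists>b. \<forall>z\<in>ballX N n. \<forall>k. cmod (z k) \<le> b" by (rule coord_bound)
  show "y \<in> ballX N n" if z: "z \<in> ballX N n" and y: "\<And>k. cmod (y k) \<le> cmod (z k)" for z y
  proof -
    have "y k = 0" if "n \<le> k" for k using z y[of k] that by (simp add: ballX_eq)
    moreover have "N y \<le> N z" using ballX_mem[OF z] y by (rule ideal_le)
    ultimately show ?thesis using z by (auto simp: ballX_eq)
  qed
  show "\<exists>w\<in>ballX N n. \<forall>k<n. w k \<noteq> 0"
  proof -
    define w where "w = (\<lambda>k. if k < n then 1 else (0::complex))"
    have w: "w \<in> X" by (rule finite_support_mem[of n]) (auto simp: w_def)
    have "(\<lambda>k. w k / of_real (N w + 1)) \<in> ballX N n"
      by (rule ballX_scale_mem[OF w]) (auto simp: w_def)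
    moreover have "N w + 1 \<noteq> 0" using norm_nonneg[OF w] by linarith
    then have "complex_of_real (N w + 1) \<noteq> 0" by (simp only: of_real_eq_0_iff not_False_eq_True)
    ultimately show ?thesis by (intro bexI[of _ "\<lambda>k. w k / of_real (N w + 1)"]) (auto simp: w_def)
  qed
  show "(\<lambda>k. (u k + z k) / 2) \<in> ballX N n" if u: "u \<in> ballX N n" and z: "z \<in> ballX N n" for u z
  proof -
    have uz: "u \<in> X" "z \<in> X" using u z ballX_mem by auto
    have "N (\<lambda>k. u k + z k) \<le> N u + N z" using uz by (rule norm_add)
    also have "\<dots> < 2" using u z by (simp add: ballX_eq)
    finally have "(\<lambda>k. (u k + z k) / complex_of_real 2) \<in> ballX N n"
      using u z by (intro ballX_scale_mem add_mem uz) (auto simp: ballX_eq)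
    then show ?thesis by simp
  qed
qed

lemma two_convex_with_mono:
  assumes M: "two_convex_with X N M" and le: "M \<le> M'"
  shows "two_convex_with X N M'"
  unfolding two_convex_with_def
proof (intro allI impI)
  fix xs :: "nat \<Rightarrow> nat \<Rightarrow> complex" and K
  assume "\<forall>i<K. xs i \<in> X"
  then have "N (\<lambda>k. complex_of_real (sqrt (\<Sum>i<K. (cmod (xs i k))\<^sup>2))) \<le> M * sqrt (\<Sum>i<K. (N (xs i))\<^sup>2)"
    using M unfolding two_convex_with_def by blast
  also have "\<dots> \<le> M' * sqrt (\<Sum>i<K. (N (xs i))\<^sup>2)"
    using le by (intro mult_right_mono) (auto intro: sum_nonneg)
  finally show "N (\<lambda>k. complex_of_real (sqrt (\<Sum>i<K. (cmod (xs i k))\<^sup>2))) \<le> M' * sqrt (\<Sum>i<K. (N (xs i))\<^sup>2)" .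
qed

text \<open>The infimum defining \<open>two_convexity_const\<close> is not shown to be attained; any
  larger number is admissible, at the price of a slightly larger constant.\<close>

lemma two_convex_with_const:
  assumes "two_convex X N" and M: "two_convexity_const X N < M"
  shows "two_convex_with X N M"
proof -
  have "{M. two_convex_with X N M} \<noteq> {}" using assms(1) by (auto simp: two_convex_def)
  from cInf_lessD[OF this] M obtain M0 where "two_convex_with X N M0" "M0 < M"
    unfolding two_convexity_const_def by auto
  then show ?thesis using two_convex_with_mono less_imp_le by blast
qed

text \<open>2-convexity applied to the vectors \<open>sqrt (l s) * s\<close>, whose squared norms
  sum to at most 1. It says that the 2-concavification of the lattice has a unit ball that is convex
  up to \<open>M\<close>.\<close>

lemma two_convex_weights:
  assumes M: "two_convex_with X N M" and F: "finite F" "\<And>s. s \<in> F \<Longrightarrow> s \<in> X \<and> N s \<le> 1"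
    and l: "\<And>s. s \<in> F \<Longrightarrow> 0 \<le> l s" "(\<Sum>s\<in>F. l s) = 1" and M0: "0 \<le> M"
  shows "N (\<lambda>k. complex_of_real (sqrt (\<Sum>s\<in>F. l s * (cmod (s k))\<^sup>2))) \<le> M"
proof -
  obtain f where f: "bij_betw f {..<card F} F"
    using ex_bij_betw_nat_finite[OF F(1)] by (auto simp: atLeast0LessThan)
  define xs where "xs i = (\<lambda>k. complex_of_real (sqrt (l (f i))) * f i k)" for i
  have fF: "f i \<in> F" if "i < card F" for i using f that by (auto simp: bij_betw_def)
  have xs: "\<forall>i<card F. xs i \<in> X" unfolding xs_def using fF F by (auto intro: scale_mem)
  have 1: "(\<Sum>i<card F. (cmod (xs i k))\<^sup>2) = (\<Sum>s\<in>F. l s * (cmod (s k))\<^sup>2)" for k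
    unfolding sum.reindex_bij_betw[OF f, symmetric]
    by (intro sum.cong refl) (use fF l in \<open>auto simp: xs_def norm_mult power_mult_distrib\<close>)
  have "(\<Sum>i<card F. (N (xs i))\<^sup>2) \<le> (\<Sum>i<card F. l (f i))"
  proof (rule sum_mono)
    fix i assume "i \<in> {..<card F}"
    then have *: "f i \<in> X" "N (f i) \<le> 1" "0 \<le> l (f i)" using fF F l by auto
    have "(N (xs i))\<^sup>2 = l (f i) * (N (f i))\<^sup>2"
      unfolding xs_def norm_scale[OF *(1)] using * by (simp add: power_mult_distrib)
    also have "\<dots> \<le> l (f i) * 1\<^sup>2"
      using * norm_nonneg[OF *(1)] by (intro mult_left_mono power_mono) auto
    finally show "(N (xs i))\<^sup>2 \<le> l (f i)" by simp
  qed
  also have "\<dots> = 1" using l sum.reindex_bij_betw[OF f, of l] by simp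
  finally have "M * sqrt (\<Sum>i<card F. (N (xs i))\<^sup>2) \<le> M * 1" using M0 by (intro mult_left_mono) auto
  moreover have "N (\<lambda>k. complex_of_real (sqrt (\<Sum>i<card F. (cmod (xs i k))\<^sup>2))) \<le> M * sqrt (\<Sum>i<card F. (N (xs i))\<^sup>2)"
    using M xs unfolding two_convex_with_def by blast
  ultimately show ?thesis unfolding 1 by linarith
qed

text \<open>A Lozanovskii-type point: the near-maximiser of \<open>\<Prod>k<n. \<bar>w k\<bar>\<close> over the 2-convexified ball
  squeezes the ball between a polydisc and a multiple of the Euclidean ball in the coordinates \<open>z / w\<close>.\<close>

lemma ball_sandwich:
  assumes M: "two_convex_with X N M" "M \<ge> 1" and n: "n \<ge> 1"
  shows "\<exists>w::nat \<Rightarrow> real. (\<forall>k<n. 0 < w k) \<and>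
     (\<forall>z. (\<forall>k\<ge>n. z k = 0) \<and> (\<forall>k<n. cmod (z k) \<le> w k) \<longrightarrow> z \<in> ballX N n) \<and>
     (\<forall>z\<in>ballX N n. (\<Sum>k<n. (cmod (z k) / w k)\<^sup>2) \<le> 24 * M\<^sup>2 * real n)"
proof -
  obtain b where b: "\<And>z k. z \<in> ballX N n \<Longrightarrow> cmod (z k) \<le> b" using coord_bound by blast
  obtain s0 where s0: "s0 \<in> ballX N n" "\<And>k. k < n \<Longrightarrow> s0 k \<noteq> 0" using ball.nonflat by blast
  have "\<exists>F l. finite F \<and> F \<subseteq> ballX N n \<and> (\<forall>s\<in>F. 0 \<le> l s) \<and> (\<Sum>s\<in>F. l s) = 1 \<and>
     (\<forall>k\<in>{..<n}. 0 < (\<Sum>s\<in>F. l s * (cmod (s k))\<^sup>2)) \<and>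
     (\<forall>z\<in>ballX N n. (\<Sum>k\<in>{..<n}. (cmod (z k))\<^sup>2 / (\<Sum>s\<in>F. l s * (cmod (s k))\<^sup>2)) \<le> 6 * real (card {..<n}))"
  proof (rule optimal_weights[of _ _ "\<lambda>s k. (cmod (s k))\<^sup>2" "\<lambda>_. b\<^sup>2" s0])
    show "0 \<le> (cmod (s a))\<^sup>2 \<and> (cmod (s a))\<^sup>2 \<le> b\<^sup>2" if "s \<in> ballX N n" for s a
      using b[OF that, of a] by (auto intro: power_mono)
  qed (use n s0 in \<open>auto simp: lessThan_empty_iff\<close>)
  then obtain F l where F: "finite F" "F \<subseteq> ballX N n" "\<forall>s\<in>F. 0 \<le> l s" "(\<Sum>s\<in>F. l s) = 1"
    and pos: "\<forall>k\<in>{..<n}. 0 < (\<Sum>s\<in>F. l s * (cmod (s k))\<^sup>2)"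
    and opt: "\<forall>z\<in>ballX N n. (\<Sum>k\<in>{..<n}. (cmod (z k))\<^sup>2 / (\<Sum>s\<in>F. l s * (cmod (s k))\<^sup>2)) \<le> 6 * real (card {..<n})"
    by (elim exE conjE) blast
  define x where "x k = (\<Sum>s\<in>F. l s * (cmod (s k))\<^sup>2)" for k
  \<comment> \<open>Without the factor 2 the point would only be known to have norm at most 1;
    halving puts it inside the open ball. Squared, \<open>2 * M\<close> turns the optimality
    constant 6 into \<open>24 * M\<^sup>2\<close>.\<close>
  define w where "w k = sqrt (x k) / (2 * M)" for k
  have xpos: "0 < x k" if "k < n" for k using pos that by (auto simp: x_def)
  have x0: "x k = 0" if "n \<le> k" for k
    unfolding x_def using F(2) that by (intro sum.neutral) (auto simp: ballX_eq)
  let ?y = "\<lambda>k. complex_of_real (sqrt (x k))"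
  have yX: "?y \<in> X" by (rule finite_support_mem[of n]) (auto simp: x0)
  have "N ?y \<le> M" unfolding x_def
  proof (rule two_convex_weights[OF M(1) F(1)])
    show "s \<in> X \<and> N s \<le> 1" if "s \<in> F" for s
      using F(2) that ballX_mem[of s n] by (auto simp: ballX_eq)
  qed (use F M in auto)
  then have ball: "(\<lambda>k. ?y k / of_real (2 * M)) \<in> ballX N n"
    using M by (intro ballX_scale_mem yX) (auto simp: x0)
  show ?thesis
  proof (intro exI[of _ w] conjI allI impI ballI)
    show "0 < w k" if "k < n" for k using xpos[OF that] M by (simp add: w_def)
    show "z \<in> ballX N n" if "(\<forall>k\<ge>n. z k = 0) \<and> (\<forall>k<n. cmod (z k) \<le> w k)" for z
    proof (rule ball.solid[OF ball])
      fix k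
      show "cmod (z k) \<le> cmod (?y k / of_real (2 * M))"
      proof (cases "k < n")
        case True
        then have "cmod (z k) \<le> w k" using that by auto
        also have "w k = cmod (?y k / of_real (2 * M))"
          using xpos[OF True] M by (simp add: w_def norm_divide norm_mult)
        finally show ?thesis .
      qed (use that in auto)
    qed
    show "(\<Sum>k<n. (cmod (z k) / w k)\<^sup>2) \<le> 24 * M\<^sup>2 * real n" if z: "z \<in> ballX N n" for z
    proof -
      have "(\<Sum>k<n. (cmod (z k) / w k)\<^sup>2) = (\<Sum>k<n. 4 * M\<^sup>2 * ((cmod (z k))\<^sup>2 / x k))"
        by (intro sum.cong refl) (use xpos in \<open>auto simp: w_def power_divide power_mult_distrib less_imp_le\<close>)
      also have "\<dots> = 4 * M\<^sup>2 * (\<Sum>k<n. (cmod (z k))\<^sup>2 / x k)" by (simp add: sum_distrib_left)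
      also have "\<dots> \<le> 4 * M\<^sup>2 * (6 * real n)"
        using opt z by (intro mult_left_mono) (auto simp: x_def)
      finally show ?thesis by simp
    qed
  qed
qed

end

section \<open>The projection constant from above\<close>

lemma supn_upper: "f \<in> Linf S \<Longrightarrow> z \<in> S \<Longrightarrow> cmod (f z) \<le> supn S f"
  unfolding supn_def Linf_def by (rule cSUP_upper) (auto intro: bdd_aboveI2)

lemma supn_least: "S \<noteq> {} \<Longrightarrow> (\<And>z. z \<in> S \<Longrightarrow> cmod (f z) \<le> t) \<Longrightarrow> supn S f \<le> t"
  unfolding supn_def by (rule cSUP_least)

lemma supn_nonneg: "f \<in> Linf S \<Longrightarrow> S \<noteq> {} \<Longrightarrow> 0 \<le> supn S f"
  using supn_upper[of f S] by (metis all_not_in_conv norm_ge_zero order_trans)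

definition bounded_projection ::
  "'a set \<Rightarrow> ('a \<Rightarrow> complex) set \<Rightarrow> (('a \<Rightarrow> complex) \<Rightarrow> 'a \<Rightarrow> complex) \<Rightarrow> real \<Rightarrow> bool" where
  "bounded_projection S V P t \<longleftrightarrow>
      (\<forall>f\<in>Linf S. \<forall>g\<in>Linf S. P (\<lambda>z. f z + g z) = (\<lambda>z. P f z + P g z)) \<and>
      (\<forall>a::complex. \<forall>f\<in>Linf S. P (\<lambda>z. a * f z) = (\<lambda>z. a * P f z)) \<and>
      (\<forall>f\<in>Linf S. P f \<in> V) \<and> (\<forall>v\<in>V. P v = v) \<and>
      (\<forall>f\<in>Linf S. supn S (P f) \<le> t * supn S f)"

lemma bounded_projectionD:
  assumes "bounded_projection S V P t"
  shows "f \<in> Linf S \<Longrightarrow> g \<in> Linf S \<Longrightarrow> P (\<lambda>z. f z + g z) = (\<lambda>z. P f z + P g z)"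
    and "f \<in> Linf S \<Longrightarrow> P (\<lambda>z. a * f z) = (\<lambda>z. a * P f z)"
    and "f \<in> Linf S \<Longrightarrow> P f \<in> V" and "v \<in> V \<Longrightarrow> P v = v"
    and "f \<in> Linf S \<Longrightarrow> supn S (P f) \<le> t * supn S f"
  using assms unfolding bounded_projection_def by blast+

lemma proj_const_alt: "proj_const S V = Inf {t. t \<ge> 0 \<and> (\<exists>P. bounded_projection S V P t)}"
  unfolding proj_const_def bounded_projection_def ..

lemma proj_const_le: "0 \<le> t \<Longrightarrow> bounded_projection S V P t \<Longrightarrow> proj_const S V \<le> t"
  unfolding proj_const_alt by (rule cInf_lower) (auto intro: bdd_belowI)

text \<open>The reference projection \<open>P0\<close> ensures that the infimum is taken over a
  nonempty set; otherwise \<open>Inf\<close> would carry no information.\<close>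

lemma proj_const_ge:
  assumes "bounded_projection S V P0 t0" "0 \<le> t0"
    and "\<And>P t. 0 \<le> t \<Longrightarrow> bounded_projection S V P t \<Longrightarrow> a \<le> t"
  shows "a \<le> proj_const S V"
  unfolding proj_const_alt using assms by (intro cInf_greatest) auto

lemma Linf_add: "f \<in> Linf S \<Longrightarrow> g \<in> Linf S \<Longrightarrow> (\<lambda>z. f z + g z) \<in> Linf S"
proof -
  assume f: "f \<in> Linf S" and g: "g \<in> Linf S"
  have "cmod (f z + g z) \<le> supn S f + supn S g" if "z \<in> S" for z
    using norm_triangle_ineq[of "f z" "g z"] supn_upper[OF f that] supn_upper[OF g that] by linarith
  then show ?thesis using f g by (auto simp: Linf_def)
qed

lemma Linf_scale: "f \<in> Linf S \<Longrightarrow> (\<lambda>z. a * f z) \<in> Linf S"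
proof -
  assume f: "f \<in> Linf S"
  have "cmod (a * f z) \<le> cmod a * supn S f" if "z \<in> S" for z
    using supn_upper[OF f that] by (auto simp: norm_mult intro: mult_left_mono)
  then show ?thesis using f by (auto simp: Linf_def)
qed

lemma Linf_sum: "finite I \<Longrightarrow> (\<And>i. i \<in> I \<Longrightarrow> f i \<in> Linf S) \<Longrightarrow> (\<lambda>z. \<Sum>i\<in>I. f i z) \<in> Linf S"
proof (induction I rule: finite_induct)
  case empty
  show ?case by (auto simp: Linf_def)
next
  case (insert i I)
  then have "(\<lambda>z. f i z + (\<Sum>i\<in>I. f i z)) \<in> Linf S" by (intro Linf_add) auto
  then show ?case using insert by simp
qed

lemma bounded_projection_sum:
  assumes P: "bounded_projection S V P t" and I: "finite I" and f: "\<And>i. i \<in> I \<Longrightarrow> f i \<in> Linf S"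
  shows "P (\<lambda>z. \<Sum>i\<in>I. a i * f i z) = (\<lambda>z. \<Sum>i\<in>I. a i * P (f i) z)"
  using I f
proof (induction I rule: finite_induct)
  case empty
  have z: "(\<lambda>_. 0) \<in> Linf S" by (auto simp: Linf_def)
  from bounded_projectionD(2)[OF P z, of 0] show ?case by simp
next
  case (insert i I)
  have 1: "(\<lambda>z. a i * f i z) \<in> Linf S" using insert by (intro Linf_scale) auto
  have 2: "(\<lambda>z. \<Sum>j\<in>I. a j * f j z) \<in> Linf S" using insert by (intro Linf_sum Linf_scale) auto
  have "f i \<in> Linf S" using insert by auto
  then show ?case
    using bounded_projectionD(1)[OF P 1 2] bounded_projectionD(2)[OF P, of "f i" "a i"] insert by simp
qed

lemma weighted_Cauchy_Schwarz:
  fixes l y :: "'a \<Rightarrow> real"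
  assumes "\<And>i. i \<in> I \<Longrightarrow> 0 \<le> l i"
  shows "(\<Sum>i\<in>I. l i * y i)\<^sup>2 \<le> (\<Sum>i\<in>I. l i) * (\<Sum>i\<in>I. l i * (y i)\<^sup>2)"
proof -
  have "(\<Sum>i\<in>I. l i * y i) = (\<Sum>i\<in>I. sqrt (l i) * (sqrt (l i) * y i))"
    using assms by (intro sum.cong refl) (simp add: mult.assoc[symmetric])
  also have "(\<dots>)\<^sup>2 \<le> (\<Sum>i\<in>I. (sqrt (l i))\<^sup>2) * (\<Sum>i\<in>I. (sqrt (l i) * y i)\<^sup>2)"
    by (rule Cauchy_Schwarz_ineq_sum)
  also have "\<dots> = (\<Sum>i\<in>I. l i) * (\<Sum>i\<in>I. l i * (y i)\<^sup>2)"
    using assms by (intro arg_cong2[where f = "(*)"] sum.cong refl) (auto simp: power_mult_distrib)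
  finally show ?thesis .
qed

context reinhardt_body
begin

text \<open>The cut-off outside \<open>B\<close> makes these functions members of
  \<open>Linf B\<close> and lets them coincide with \<open>polyfun\<close>.\<close>

definition pol :: "(nat \<Rightarrow> nat) set \<Rightarrow> ((nat \<Rightarrow> nat) \<Rightarrow> complex) \<Rightarrow> (nat \<Rightarrow> complex) \<Rightarrow> complex" where
  "pol A c = (\<lambda>z. if z \<in> B then \<Sum>\<alpha>\<in>A. c \<alpha> * mono n \<alpha> z else 0)"

lemma pol_cong: "(\<And>\<alpha>. \<alpha> \<in> A \<Longrightarrow> c \<alpha> = d \<alpha>) \<Longrightarrow> pol A c = pol A d"
  unfolding pol_def by (auto intro: sum.cong)

lemma body_nonempty: "B \<noteq> {}" using nonflat by auto

lemma zero_mem: "(\<lambda>_. 0) \<in> B"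
proof -
  obtain w where "w \<in> B" using nonflat by blast
  then show ?thesis by (rule solid) simp
qed

lemma scp_mem:
  assumes "s \<in> B" "\<And>k. k < n \<Longrightarrow> cmod (\<tau> k) \<le> 1"
  shows "scp n s \<tau> \<in> B"
proof (rule solid[OF assms(1)])
  fix k
  show "cmod (scp n s \<tau> k) \<le> cmod (s k)"
    using assms(2)[of k] mult_left_mono[of "cmod (\<tau> k)" 1 "cmod (s k)"]
    by (auto simp: scp_def norm_mult)
qed

lemma mono_bounded: "\<exists>b. \<forall>z\<in>B. cmod (mono n \<alpha> z) \<le> b"
proof -
  obtain b where b: "\<forall>z\<in>B. \<forall>k. cmod (z k) \<le> b" using bounded by blast
  have "cmod (mono n \<alpha> z) \<le> (\<Prod>k<n. b ^ \<alpha> k)" if "z \<in> B" for z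
    unfolding mono_def prod_norm[symmetric] norm_power
    by (intro prod_mono) (use b that in \<open>auto intro: power_mono\<close>)
  then show ?thesis by blast
qed

lemma pol_Linf:
  assumes "finite A"
  shows "pol A c \<in> Linf B"
proof -
  have "(\<lambda>z. if z \<in> B then mono n \<alpha> z else 0) \<in> Linf B" for \<alpha>
    using mono_bounded[of \<alpha>] by (auto simp: Linf_def)
  then have "(\<lambda>z. \<Sum>\<alpha>\<in>A. c \<alpha> * (if z \<in> B then mono n \<alpha> z else 0)) \<in> Linf B"
    by (intro Linf_sum Linf_scale assms)
  also have "(\<lambda>z. \<Sum>\<alpha>\<in>A. c \<alpha> * (if z \<in> B then mono n \<alpha> z else 0)) = pol A c"
    by (auto simp: pol_def)
  finally show ?thesis .
qed

text \<open>After averaging over rotations the monomials are orthogonal, so the product of their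
  squared norms is the determinant of their Gram matrix. The weights thus form a nearly D-optimal
  design for the span of \<open>A\<close>.\<close>

lemma optimal_design:
  assumes A: "finite A" "A \<noteq> {}"
  shows "\<exists>F l. finite F \<and> F \<subseteq> B \<and> (\<forall>s\<in>F. 0 \<le> l s) \<and> (\<Sum>s\<in>F. l s) = 1 \<and>
     (\<forall>a\<in>A. 0 < (\<Sum>s\<in>F. l s * (cmod (mono n a s))\<^sup>2)) \<and>
     (\<forall>z\<in>B. (\<Sum>a\<in>A. (cmod (mono n a z))\<^sup>2 / (\<Sum>s\<in>F. l s * (cmod (mono n a s))\<^sup>2)) \<le> 6 * real (card A))"
proof -
  have "\<forall>\<alpha>. \<exists>b. \<forall>z\<in>B. cmod (mono n \<alpha> z) \<le> b" using mono_bounded by blast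
  from choice[OF this] obtain b where b: "\<forall>\<alpha>. \<forall>z\<in>B. cmod (mono n \<alpha> z) \<le> b \<alpha>" by blast
  obtain s0 where s0: "s0 \<in> B" "\<And>k. k < n \<Longrightarrow> s0 k \<noteq> 0" using nonflat by blast
  show ?thesis
  proof (rule optimal_weights[OF A, of B "\<lambda>s \<alpha>. (cmod (mono n \<alpha> s))\<^sup>2" "\<lambda>\<alpha>. (b \<alpha>)\<^sup>2" s0])
    show "0 < (cmod (mono n a s0))\<^sup>2" for a using s0 by (simp add: mono_def)
  qed (use s0 b in \<open>auto intro: power_mono\<close>)
qed

text \<open>The projection is the orthogonal one in \<open>L\<^sup>2\<close> of the rotated design.
  Its kernel at \<open>z\<close> has squared \<open>L\<^sup>2\<close> norm equal to the sum in
  \<open>optimal_design\<close>, at most \<open>6 * card A\<close>; the \<open>L\<^sup>1\<close>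
  norm of the kernel, which bounds the operator norm, is no larger than its \<open>L\<^sup>2\<close>
  norm.\<close>

lemma proj_const_upper:
  assumes A: "A \<subseteq> bmi n m" "A \<noteq> {}"
  shows "\<exists>P. bounded_projection B (range (pol A)) P (sqrt (6 * real (card A)))"
proof -
  have fin: "finite A" using A finite_bmi finite_subset by blast
  obtain F l where F: "finite F" "F \<subseteq> B" "\<forall>s\<in>F. 0 \<le> l s" "(\<Sum>s\<in>F. l s) = (1::real)"
    and pos: "\<forall>a\<in>A. 0 < (\<Sum>s\<in>F. l s * (cmod (mono n a s))\<^sup>2)"
    and opt: "\<forall>z\<in>B. (\<Sum>a\<in>A. (cmod (mono n a z))\<^sup>2 / (\<Sum>s\<in>F. l s * (cmod (mono n a s))\<^sup>2)) \<le> 6 * real (card A)"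
    using optimal_design[OF fin A(2)] by (elim exE conjE) blast
  define x where "x \<alpha> = (\<Sum>s\<in>F. l s * (cmod (mono n \<alpha> s))\<^sup>2)" for \<alpha>
  note x = x_def
  have xpos: "\<And>\<alpha>. \<alpha> \<in> A \<Longrightarrow> 0 < x \<alpha>" using pos unfolding x by blast
  have opt: "\<And>z. z \<in> B \<Longrightarrow> (\<Sum>\<alpha>\<in>A. (cmod (mono n \<alpha> z))\<^sup>2 / x \<alpha>) \<le> 6 * real (card A)"
    using opt unfolding x by blast
  have l: "\<And>s. s \<in> F \<Longrightarrow> 0 \<le> l s" using F(3) by blast
  define L where "L = m + 1"
  define q where "q = real L ^ n"
  have q: "q > 0" by (simp add: q_def L_def)
  have AL: "\<forall>\<alpha>\<in>A. \<forall>k. \<alpha> k < L"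
  proof (intro ballI allI)
    show "\<alpha> k < L" if "\<alpha> \<in> A" for \<alpha> k using bmi_le[of \<alpha> n m k] A that by (auto simp: L_def)
  qed
  have Ami: "A \<subseteq> mi n" using A by (auto simp: bmi_def)
  have L1: "L \<ge> 1" by (simp add: L_def)
  have scpB: "scp n s \<tau> \<in> B" if "s \<in> F" "\<tau> \<in> torus n L" for s \<tau>
    using F(2) that torus_norm[OF L1 that(2)] by (intro scp_mem) auto
  \<comment> \<open>The inner product of \<open>f\<close> with the monomial, divided by the squared
    norm \<open>x \<alpha>\<close> of the monomial; \<open>q\<close> normalises the sum over the
    torus.\<close>
  define cf where "cf f \<alpha> = (\<Sum>s\<in>F. of_real (l s) * (\<Sum>\<tau>\<in>torus n L. f (scp n s \<tau>) * cnj (mono n \<alpha> (scp n s \<tau>))))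
      / of_real (x \<alpha> * q)" for f \<alpha>
  have cf_add: "cf (\<lambda>z. f z + g z) \<alpha> = cf f \<alpha> + cf g \<alpha>" for f g \<alpha>
    by (simp add: cf_def distrib_left distrib_right sum.distrib add_divide_distrib)
  have cf_scale: "cf (\<lambda>z. a * f z) \<alpha> = a * cf f \<alpha>" for a f \<alpha>
    by (simp add: cf_def sum_distrib_left mult_ac)
  have cf_pol: "cf (pol A c) \<alpha> = c \<alpha>" if \<alpha>: "\<alpha> \<in> A" for c \<alpha>
  proof -
    have inner: "(\<Sum>\<tau>\<in>torus n L. pol A c (scp n s \<tau>) * cnj (mono n \<alpha> (scp n s \<tau>)))
        = of_real (q * (cmod (mono n \<alpha> s))\<^sup>2) * c \<alpha>" if s: "s \<in> F" for s
    proof -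
      have "(\<Sum>\<tau>\<in>torus n L. pol A c (scp n s \<tau>) * cnj (mono n \<alpha> (scp n s \<tau>)))
         = (\<Sum>\<tau>\<in>torus n L. (\<Sum>\<beta>\<in>A. (c \<beta> * mono n \<beta> s) * mono n \<beta> \<tau>) * cnj (mono n \<alpha> \<tau>)) * cnj (mono n \<alpha> s)"
        unfolding sum_distrib_right[of _ _ "cnj (mono n \<alpha> s)"]
        using scpB[OF s] by (intro sum.cong refl) (simp add: pol_def mono_scp mult_ac)
      also have "\<dots> = (of_nat L ^ n * (c \<alpha> * mono n \<alpha> s)) * cnj (mono n \<alpha> s)"
        by (subst torus_coeff[OF fin Ami AL \<alpha>, where b = "\<lambda>\<beta>. c \<beta> * mono n \<beta> s"]) auto
      also have "\<dots> = of_real (q * (cmod (mono n \<alpha> s))\<^sup>2) * c \<alpha>"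
        unfolding of_real_mult complex_norm_square by (simp add: q_def mult_ac)
      finally show ?thesis .
    qed
    have "(\<Sum>s\<in>F. of_real (l s) * (\<Sum>\<tau>\<in>torus n L. pol A c (scp n s \<tau>) * cnj (mono n \<alpha> (scp n s \<tau>))))
        = (\<Sum>s\<in>F. of_real (l s * (q * (cmod (mono n \<alpha> s))\<^sup>2)) * c \<alpha>)"
      by (intro sum.cong refl) (simp add: inner)
    also have "\<dots> = of_real (\<Sum>s\<in>F. l s * (q * (cmod (mono n \<alpha> s))\<^sup>2)) * c \<alpha>"
      by (simp only: of_real_sum sum_distrib_right)
    also have "(\<Sum>s\<in>F. l s * (q * (cmod (mono n \<alpha> s))\<^sup>2)) = x \<alpha> * q"
      unfolding x by (simp add: sum_distrib_left mult_ac)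
    finally show ?thesis unfolding cf_def using xpos[OF \<alpha>] q by simp
  qed
  have bound: "cmod (pol A (cf f) z) \<le> sqrt (6 * real (card A)) * supn B f"
    if f: "f \<in> Linf B" and z: "z \<in> B" for f z
  proof -
    \<comment> \<open>\<open>cnj (K s \<tau>)\<close> is the kernel of the projection at
      \<open>z\<close> and at the node \<open>scp n s \<tau>\<close>; \<open>b s\<close> lists its
      coefficients as a polynomial in \<open>\<tau>\<close>.\<close>
    define b where "b s \<alpha> = mono n \<alpha> s * cnj (mono n \<alpha> z) / of_real (x \<alpha>)" for s \<alpha>
    define K where "K s \<tau> = (\<Sum>\<alpha>\<in>A. b s \<alpha> * mono n \<alpha> \<tau>)" for s \<tau>
    have "pol A (cf f) z = (\<Sum>\<alpha>\<in>A. \<Sum>s\<in>F. \<Sum>\<tau>\<in>torus n L.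
        of_real (l s / q) * (f (scp n s \<tau>) * (cnj (b s \<alpha>) * cnj (mono n \<alpha> \<tau>))))"
      using z unfolding pol_def cf_def b_def
      by (simp add: sum_distrib_left sum_distrib_right sum_divide_distrib mono_scp mult_ac)
    also have "\<dots> = (\<Sum>s\<in>F. \<Sum>\<tau>\<in>torus n L. \<Sum>\<alpha>\<in>A.
        of_real (l s / q) * (f (scp n s \<tau>) * (cnj (b s \<alpha>) * cnj (mono n \<alpha> \<tau>))))"
      by (subst sum.swap, rule sum.cong[OF refl], rule sum.swap)
    also have "\<dots> = (\<Sum>s\<in>F. \<Sum>\<tau>\<in>torus n L. of_real (l s / q) * (f (scp n s \<tau>) * cnj (K s \<tau>)))"
      by (simp add: K_def sum_distrib_left)
    finally have "cmod (pol A (cf f) z) \<le> (\<Sum>s\<in>F. \<Sum>\<tau>\<in>torus n L. cmod (of_real (l s / q) * (f (scp n s \<tau>) * cnj (K s \<tau>))))"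
      by (simp only:) (intro order_trans[OF norm_sum] sum_mono norm_sum)
    also have "\<dots> \<le> (\<Sum>s\<in>F. \<Sum>\<tau>\<in>torus n L. l s / q * (supn B f * cmod (K s \<tau>)))"
    proof (intro sum_mono)
      fix s \<tau> assume s: "s \<in> F" and t: "\<tau> \<in> torus n L"
      have "cmod (of_real (l s / q) * (f (scp n s \<tau>) * cnj (K s \<tau>))) = l s / q * (cmod (f (scp n s \<tau>)) * cmod (K s \<tau>))"
        using l[OF s] q by (simp add: norm_mult norm_divide)
      also have "\<dots> \<le> l s / q * (supn B f * cmod (K s \<tau>))"
        using l[OF s] q supn_upper[OF f scpB[OF s t]] by (intro mult_left_mono mult_right_mono) auto
      finally show "cmod (of_real (l s / q) * (f (scp n s \<tau>) * cnj (K s \<tau>))) \<le> l s / q * (supn B f * cmod (K s \<tau>))" .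
    qed
    also have "\<dots> = supn B f * (\<Sum>s\<in>F. l s * ((\<Sum>\<tau>\<in>torus n L. cmod (K s \<tau>)) / q))"
      by (simp add: sum_distrib_left sum_divide_distrib mult_ac)
    finally have main: "cmod (pol A (cf f) z) \<le> supn B f * (\<Sum>s\<in>F. l s * ((\<Sum>\<tau>\<in>torus n L. cmod (K s \<tau>)) / q))" .
    \<comment> \<open>Cauchy--Schwarz is used twice, here over the torus for a fixed node and below
      over the weights \<open>l\<close>.\<close>
    have Ks: "((\<Sum>\<tau>\<in>torus n L. cmod (K s \<tau>)) / q)\<^sup>2 \<le> (\<Sum>\<alpha>\<in>A. (cmod (b s \<alpha>))\<^sup>2)" for s
    proof -
      have "(\<Sum>\<tau>\<in>torus n L. 1 * cmod (K s \<tau>))\<^sup>2 \<le> (\<Sum>\<tau>\<in>torus n L. 1) * (\<Sum>\<tau>\<in>torus n L. 1 * (cmod (K s \<tau>))\<^sup>2)"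
        by (rule weighted_Cauchy_Schwarz) auto
      also have "\<dots> = q * (q * (\<Sum>\<alpha>\<in>A. (cmod (b s \<alpha>))\<^sup>2))"
        using parseval[OF fin Ami AL, of "b s"] card_torus[OF L1, of n] by (simp add: K_def q_def)
      finally show ?thesis using q by (simp add: power_divide power2_eq_square field_simps)
    qed
    have "(\<Sum>s\<in>F. l s * ((\<Sum>\<tau>\<in>torus n L. cmod (K s \<tau>)) / q))\<^sup>2
        \<le> (\<Sum>s\<in>F. l s) * (\<Sum>s\<in>F. l s * ((\<Sum>\<tau>\<in>torus n L. cmod (K s \<tau>)) / q)\<^sup>2)"
      using l by (rule weighted_Cauchy_Schwarz)
    also have "\<dots> \<le> 1 * (\<Sum>s\<in>F. l s * (\<Sum>\<alpha>\<in>A. (cmod (b s \<alpha>))\<^sup>2))"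
      unfolding F(4) using l Ks by (intro mult_left_mono sum_mono) auto
    also have "\<dots> = (\<Sum>\<alpha>\<in>A. \<Sum>s\<in>F. l s * (cmod (b s \<alpha>))\<^sup>2)"
      by (simp add: sum_distrib_left) (rule sum.swap)
    also have "\<dots> = (\<Sum>\<alpha>\<in>A. (cmod (mono n \<alpha> z))\<^sup>2 / x \<alpha>)"
    proof (rule sum.cong[OF refl])
      fix \<alpha> assume \<alpha>: "\<alpha> \<in> A"
      have "(\<Sum>s\<in>F. l s * (cmod (b s \<alpha>))\<^sup>2) = (\<Sum>s\<in>F. (l s * (cmod (mono n \<alpha> s))\<^sup>2) * ((cmod (mono n \<alpha> z))\<^sup>2 / (x \<alpha>)\<^sup>2))"
        by (intro sum.cong refl) (simp add: b_def norm_mult norm_divide power_mult_distrib power_divide)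
      also have "\<dots> = x \<alpha> * ((cmod (mono n \<alpha> z))\<^sup>2 / (x \<alpha>)\<^sup>2)"
        unfolding x by (simp only: sum_distrib_right)
      also have "\<dots> = (cmod (mono n \<alpha> z))\<^sup>2 / x \<alpha>"
        using xpos[OF \<alpha>] by (simp add: power2_eq_square)
      finally show "(\<Sum>s\<in>F. l s * (cmod (b s \<alpha>))\<^sup>2) = (cmod (mono n \<alpha> z))\<^sup>2 / x \<alpha>" .
    qed
    also have "\<dots> \<le> 6 * real (card A)" using z by (rule opt)
    finally have "(\<Sum>s\<in>F. l s * ((\<Sum>\<tau>\<in>torus n L. cmod (K s \<tau>)) / q)) \<le> sqrt (6 * real (card A))"
      by (rule real_le_rsqrt)
    then have "supn B f * (\<Sum>s\<in>F. l s * ((\<Sum>\<tau>\<in>torus n L. cmod (K s \<tau>)) / q)) \<le> supn B f * sqrt (6 * real (card A))"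
      using supn_nonneg[OF f body_nonempty] by (intro mult_left_mono)
    with main show ?thesis by (simp add: mult.commute)
  qed
  have "bounded_projection B (range (pol A)) (\<lambda>f. pol A (cf f)) (sqrt (6 * real (card A)))"
    unfolding bounded_projection_def
  proof (intro conjI ballI allI)
    fix f g assume "f \<in> Linf B" "g \<in> Linf B"
    show "pol A (cf (\<lambda>z. f z + g z)) = (\<lambda>z. pol A (cf f) z + pol A (cf g) z)"
      by (auto simp: pol_def cf_add distrib_right sum.distrib)
  next
    fix a f assume "f \<in> Linf B"
    show "pol A (cf (\<lambda>z. a * f z)) = (\<lambda>z. a * pol A (cf f) z)"
      by (auto simp: pol_def cf_scale sum_distrib_left mult_ac)
  next
    fix v assume "v \<in> range (pol A)"
    then obtain c where "v = pol A c" by auto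
    then show "pol A (cf v) = v" using cf_pol by (auto intro!: pol_cong)
  next
    fix f assume "f \<in> Linf B"
    then show "supn B (pol A (cf f)) \<le> sqrt (6 * real (card A)) * supn B f"
      by (intro supn_least[OF body_nonempty] bound)
  qed auto
  then show ?thesis by blast
qed

end

section \<open>The projection constant from below\<close>

lemma sum_swap_pairs:
  "(\<Sum>a\<in>A. \<Sum>b\<in>B. \<Sum>c\<in>C. \<Sum>d\<in>D. f a b c d) = (\<Sum>c\<in>C. \<Sum>d\<in>D. \<Sum>a\<in>A. \<Sum>b\<in>B. f a b c d)"
proof -
  have "(\<Sum>a\<in>A. \<Sum>b\<in>B. \<Sum>c\<in>C. \<Sum>d\<in>D. f a b c d) = (\<Sum>a\<in>A. \<Sum>c\<in>C. \<Sum>d\<in>D. \<Sum>b\<in>B. f a b c d)"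
    by (rule sum.cong[OF refl], rule trans[OF sum.swap], rule sum.cong[OF refl], rule sum.swap)
  also have "\<dots> = (\<Sum>c\<in>C. \<Sum>d\<in>D. \<Sum>a\<in>A. \<Sum>b\<in>B. f a b c d)"
    by (rule trans[OF sum.swap], rule sum.cong[OF refl], rule sum.swap)
  finally show ?thesis .
qed

context reinhardt_body
begin

text \<open>Test the projection on the Riesz products \<open>\<Prod>k<n. 1 + \<i> Re (s k * cnj (\<theta> k))\<close>: they stay bounded
  on the Euclidean ball of radius \<open>sqrt m\<close>, while averaging over \<open>\<theta>\<close> recovers every tetrahedral
  monomial of degree \<open>m\<close> exactly.\<close>

lemma proj_const_lower:
  assumes A: "A \<subseteq> bmi n m" "Lambda_T m \<inter> mi n \<subseteq> A" and m: "1 \<le> m" "m \<le> n"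
    and w: "\<And>k. k < n \<Longrightarrow> 0 < w k"
    and poly: "\<And>z. (\<forall>k\<ge>n. z k = 0) \<Longrightarrow> (\<forall>k<n. cmod (z k) \<le> w k) \<Longrightarrow> z \<in> B"
    and R: "0 < R" "\<And>z. z \<in> B \<Longrightarrow> (\<Sum>k<n. (cmod (z k) / w k)\<^sup>2) \<le> R * real n"
    and t: "0 \<le> t" and P: "bounded_projection B (range (pol A)) P t"
  shows "(real n / real m) ^ m * (sqrt (real m / (R * real n)) / 2) ^ m \<le> t * exp (real m / 2)"
proof -
  \<comment> \<open>The scale is such that \<open>\<delta>\<^sup>2 * R * n = m\<close>, which makes
    the Riesz products at most \<open>exp (m / 2)\<close> on \<open>B\<close>.\<close>
  define \<delta> where "\<delta> = sqrt (real m / (R * real n))"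
  have \<delta>: "0 \<le> \<delta>" "\<delta>\<^sup>2 = real m / (R * real n)" using R by (auto simp: \<delta>_def)
  define s where "s u k = of_real (\<delta> / w k) * (u k :: complex)" for u k
  \<comment> \<open>A Riesz factor has the three terms \<open>1\<close>,
    \<open>\<i> / 2 * s * cnj \<theta>\<close> and \<open>\<i> / 2 * cnj s * \<theta>\<close>,
    labelled 0, 1 and 2. Here \<open>p\<close> is the part depending on the point and
    \<open>q\<close> the part depending on the rotation.\<close>
  define p where "p j x = (if j = 0 then 1 else if j = 1 then \<i> / 2 * x else \<i> / 2 * cnj x)" for j :: nat and x
  define q where "q j r = (if j = 0 then 1 else if j = 1 then cnj r else r)" for j :: nat and r
  define \<Gamma> where "\<Gamma> = PiE {..<n} (\<lambda>_. {0, 1, 2::nat})"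
  define H where "H \<gamma> u = (if u \<in> B then \<Prod>k<n. p (\<gamma> k) (s u k) else 0)" for \<gamma> u
  define ch where "ch \<gamma> \<theta> = (\<Prod>k<n. q (\<gamma> k) (\<theta> k))" for \<gamma> \<theta>
  define G where "G \<theta> = (\<lambda>u. \<Sum>\<gamma>\<in>\<Gamma>. ch \<gamma> \<theta> * H \<gamma> u)" for \<theta>
  \<comment> \<open>The terms labelled 2 raise an exponent of at most \<open>m\<close> by one, so
    exponents up to \<open>m + 1\<close> must stay below \<open>L\<close>.\<close>
  define L where "L = m + 2"
  define W where "W \<beta> = (\<Prod>k<n. complex_of_real (w k) ^ \<beta> k)" for \<beta> :: "nat \<Rightarrow> nat"
  define \<Lambda> where "\<Lambda> = Lambda_T m \<inter> mi n"
  have L1: "L \<ge> 1" by (simp add: L_def)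
  have fin: "finite A" using A(1) finite_bmi finite_subset by blast
  have fin\<Gamma>: "finite \<Gamma>" unfolding \<Gamma>_def by (intro finite_PiE) auto
  have W0: "W \<beta> \<noteq> 0" for \<beta> using w by (simp add: W_def) (metis lessThan_iff less_irrefl)
  have H_Linf: "H \<gamma> \<in> Linf B" for \<gamma>
  proof -
    obtain b where b: "\<forall>z\<in>B. \<forall>k. cmod (z k) \<le> b" using bounded by blast
    have "cmod (H \<gamma> u) \<le> (\<Prod>k<n. 1 + \<delta> / w k * b)" if u: "u \<in> B" for u
    proof -
      have "cmod (H \<gamma> u) = (\<Prod>k<n. cmod (p (\<gamma> k) (s u k)))" using u by (simp add: H_def prod_norm)
      also have "\<dots> \<le> (\<Prod>k<n. 1 + \<delta> / w k * b)"
      proof (intro prod_mono conjI)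
        fix k assume "k \<in> {..<n}"
        then have wk: "0 < w k" using w by auto
        have "cmod (p (\<gamma> k) (s u k)) \<le> 1 + cmod (s u k)" by (simp add: p_def norm_mult)
        also have "cmod (s u k) = \<delta> / w k * cmod (u k)" using wk \<delta> by (simp add: s_def norm_mult norm_divide)
        also have "\<dots> \<le> \<delta> / w k * b" using wk \<delta> b u by (intro mult_left_mono) auto
        finally show "cmod (p (\<gamma> k) (s u k)) \<le> 1 + \<delta> / w k * b" by simp
      qed auto
      finally show ?thesis .
    qed
    then show ?thesis by (auto simp: Linf_def H_def)
  qed
  have G_Linf: "G \<theta> \<in> Linf B" for \<theta>
    unfolding G_def by (intro Linf_sum Linf_scale fin\<Gamma> H_Linf)
  have G_bound: "cmod (G \<theta> u) \<le> exp (real m / 2)" if \<theta>: "\<theta> \<in> torus n L" and u: "u \<in> B" for \<theta> u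
  proof -
    have "G \<theta> u = (\<Sum>\<gamma>\<in>\<Gamma>. \<Prod>k<n. q (\<gamma> k) (\<theta> k) * p (\<gamma> k) (s u k))"
      using u by (simp add: G_def H_def ch_def prod.distrib)
    also have "\<dots> = (\<Prod>k<n. \<Sum>j\<in>{0, 1, 2}. q j (\<theta> k) * p j (s u k))"
      unfolding \<Gamma>_def by (subst prod_sum_PiE) auto
    also have "\<dots> = (\<Prod>k<n. 1 + \<i> * of_real (Re (s u k * cnj (\<theta> k))))"
    proof (rule prod.cong[OF refl])
      fix k
      have "s u k * cnj (\<theta> k) + cnj (s u k * cnj (\<theta> k)) = of_real (2 * Re (s u k * cnj (\<theta> k)))"
        by (rule complex_add_cnj)
      then have e: "complex_of_real (Re (s u k * cnj (\<theta> k))) = (s u k * cnj (\<theta> k) + cnj (s u k) * \<theta> k) / 2"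
        by simp
      show "(\<Sum>j\<in>{0, 1, 2}. q j (\<theta> k) * p j (s u k)) = 1 + \<i> * of_real (Re (s u k * cnj (\<theta> k)))"
        unfolding e by (simp add: q_def p_def field_simps)
    qed
    finally have "cmod (G \<theta> u) = (\<Prod>k<n. cmod (1 + \<i> * of_real (Re (s u k * cnj (\<theta> k)))))"
      by (simp add: prod_norm)
    also have "\<dots> \<le> (\<Prod>k<n. exp ((\<delta> * (cmod (u k) / w k))\<^sup>2 / 2))"
    proof (intro prod_mono conjI)
      fix k assume k: "k \<in> {..<n}"
      let ?y = "Re (s u k * cnj (\<theta> k))"
      have "\<bar>?y\<bar> \<le> cmod (s u k * cnj (\<theta> k))" by (rule abs_Re_le_cmod)
      also have "\<dots> = \<delta> * (cmod (u k) / w k)"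
        using torus_norm[OF L1 \<theta>, of k] k w[of k] \<delta> by (simp add: norm_mult s_def norm_divide)
      finally have "\<bar>?y\<bar>\<^sup>2 \<le> (\<delta> * (cmod (u k) / w k))\<^sup>2" by (rule power_mono) auto
      then have y: "?y\<^sup>2 \<le> (\<delta> * (cmod (u k) / w k))\<^sup>2" by simp
      \<comment> \<open>The factor \<open>\<i>\<close> removes the first-order term of the modulus,
        so that the product is governed by the sum of squares of the coordinates.\<close>
      have "(cmod (1 + \<i> * of_real ?y))\<^sup>2 = 1 + ?y\<^sup>2" by (simp add: cmod_power2)
      also have "\<dots> \<le> exp (?y\<^sup>2)" by (rule exp_ge_add_one_self)
      also have "\<dots> \<le> exp ((\<delta> * (cmod (u k) / w k))\<^sup>2)" using y by simp
      also have "\<dots> = (exp ((\<delta> * (cmod (u k) / w k))\<^sup>2 / 2))\<^sup>2" by (simp add: exp_double[symmetric])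
      finally show "cmod (1 + \<i> * of_real ?y) \<le> exp ((\<delta> * (cmod (u k) / w k))\<^sup>2 / 2)"
        by (rule power2_le_imp_le) simp
    qed auto
    also have "\<dots> = exp (\<Sum>k<n. (\<delta> * (cmod (u k) / w k))\<^sup>2 / 2)" by (simp add: exp_sum)
    also have "(\<Sum>k<n. (\<delta> * (cmod (u k) / w k))\<^sup>2 / 2) = \<delta>\<^sup>2 / 2 * (\<Sum>k<n. (cmod (u k) / w k)\<^sup>2)"
      unfolding sum_distrib_left by (intro sum.cong refl) (simp add: power_mult_distrib power_divide)
    also have "exp (\<dots>) \<le> exp (\<delta>\<^sup>2 / 2 * (R * real n))"
      by (intro iffD2[OF exp_le_cancel_iff] mult_left_mono R(2)[OF u]) auto
    also have "\<delta>\<^sup>2 / 2 * (R * real n) = real m / 2" using \<delta>(2) R(1) m by simp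
    finally show ?thesis .
  qed
  have \<Lambda>01: "\<beta> k = 0 \<or> \<beta> k = 1" if "\<beta> \<in> \<Lambda>" for \<beta> k
  proof -
    have "\<beta> k \<le> 1" using that by (auto simp: \<Lambda>_def Lambda_T_def)
    then show ?thesis by (metis One_nat_def le_0_eq le_SucE)
  qed
  have \<Lambda>deg: "(\<Sum>k<n. \<beta> k) = m" if "\<beta> \<in> \<Lambda>" for \<beta>
    using that by (auto simp: \<Lambda>_def Lambda_T_def mdeg_mi)
  define cc where "cc \<beta> = (\<lambda>\<alpha>. if \<alpha> = \<beta> then (\<i> / 2 * of_real \<delta>) ^ m / W \<beta> else 0)" for \<beta> :: "nat \<Rightarrow> nat"
  have H_pol: "H (restrict \<beta> {..<n}) = pol A (cc \<beta>)" if \<beta>: "\<beta> \<in> \<Lambda>" for \<beta>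
  proof
    fix u
    show "H (restrict \<beta> {..<n}) u = pol A (cc \<beta>) u"
    proof (cases "u \<in> B")
      case True
      have "pol A (cc \<beta>) u = (\<Sum>\<alpha>\<in>A. if \<alpha> = \<beta> then (\<i> / 2 * of_real \<delta>) ^ m / W \<beta> * mono n \<beta> u else 0)"
        using True unfolding pol_def cc_def by (auto intro!: sum.cong)
      also have "\<dots> = (\<i> / 2 * of_real \<delta>) ^ m / W \<beta> * mono n \<beta> u"
        using fin A(2) \<beta> by (auto simp: \<Lambda>_def)
      also have "\<dots> = (\<Prod>k<n. (\<i> / 2 * of_real \<delta>) ^ \<beta> k / complex_of_real (w k) ^ \<beta> k * u k ^ \<beta> k)"
        by (simp only: \<Lambda>deg[OF \<beta>, symmetric] power_sum W_def mono_def prod_dividef prod.distrib)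
      also have "\<dots> = (\<Prod>k<n. p (restrict \<beta> {..<n} k) (s u k))"
      proof (rule prod.cong[OF refl])
        fix k assume "k \<in> {..<n}"
        then show "(\<i> / 2 * of_real \<delta>) ^ \<beta> k / complex_of_real (w k) ^ \<beta> k * u k ^ \<beta> k = p (restrict \<beta> {..<n} k) (s u k)"
          using \<Lambda>01[OF \<beta>, of k] by (auto simp: p_def s_def)
      qed
      also have "\<dots> = H (restrict \<beta> {..<n}) u" using True by (simp add: H_def)
      finally show ?thesis ..
    qed (simp add: H_def pol_def)
  qed
  have inj: "\<beta> = \<beta>'" if "restrict \<beta> {..<n} = restrict \<beta>' {..<n}" "\<beta> \<in> mi n" "\<beta>' \<in> mi n" for \<beta> \<beta>' :: "nat \<Rightarrow> nat"
  proof
    fix k show "\<beta> k = \<beta>' k"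
      using that(2,3) fun_cong[OF that(1), of k] by (cases "k < n") (auto simp: mi_def)
  qed
  \<comment> \<open>Coefficients are chosen for every \<open>P (H \<gamma>)\<close>. When
    \<open>H \<gamma>\<close> is a multiple of a tetrahedral monomial of degree \<open>m\<close>, it
    is fixed by \<open>P\<close> and the choice is pinned to \<open>cc \<beta>\<close>, which avoids
    an appeal to uniqueness of coefficients.\<close>
  have "\<exists>c. P (H \<gamma>) = pol A c \<and> (\<forall>\<beta>\<in>\<Lambda>. \<gamma> = restrict \<beta> {..<n} \<longrightarrow> c = cc \<beta>)" for \<gamma>
  proof (cases "\<exists>\<beta>\<in>\<Lambda>. \<gamma> = restrict \<beta> {..<n}")
    case True
    then obtain \<beta> where \<beta>: "\<beta> \<in> \<Lambda>" "\<gamma> = restrict \<beta> {..<n}" by blast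
    have "P (H \<gamma>) = pol A (cc \<beta>)"
      unfolding \<beta>(2) H_pol[OF \<beta>(1)] by (rule bounded_projectionD(4)[OF P]) auto
    moreover have "cc \<beta> = cc \<beta>'" if "\<beta>' \<in> \<Lambda>" "\<gamma> = restrict \<beta>' {..<n}" for \<beta>'
      using inj[of \<beta> \<beta>'] \<beta> that by (auto simp: \<Lambda>_def)
    ultimately show ?thesis by blast
  next
    case False
    then show ?thesis using bounded_projectionD(3)[OF P H_Linf, of \<gamma>] by auto
  qed
  then have "\<forall>\<gamma>. \<exists>c. P (H \<gamma>) = pol A c \<and> (\<forall>\<beta>\<in>\<Lambda>. \<gamma> = restrict \<beta> {..<n} \<longrightarrow> c = cc \<beta>)" by blast
  from choice[OF this] obtain c where c: "\<And>\<gamma>. P (H \<gamma>) = pol A (c \<gamma>)"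
    "\<And>\<beta>. \<beta> \<in> \<Lambda> \<Longrightarrow> c (restrict \<beta> {..<n}) = cc \<beta>" by blast
  \<comment> \<open>Points on the distinguished boundary of the inscribed polydisc. The additional
    common rotation \<open>\<psi>\<close> serves to single out the part of degree
    \<open>m\<close>.\<close>
  define Z where "Z \<theta> \<psi> = scp n (\<lambda>k. of_real (w k)) (\<lambda>k. \<psi> * \<theta> k)" for \<theta> and \<psi> :: complex
  have ZB: "Z \<theta> \<psi> \<in> B" if "\<theta> \<in> torus n L" "\<psi> ^ L = 1" for \<theta> \<psi>
    using torus_norm[OF L1 that(1)] root_unity_norm[OF L1 that(2)] w
    by (intro poly) (auto simp: Z_def scp_def norm_mult intro: less_imp_le)
  have mono_Z: "mono n \<beta> (Z \<theta> \<psi>) = W \<beta> * \<psi> ^ (\<Sum>k<n. \<beta> k) * mono n \<beta> \<theta>" for \<beta> \<theta> \<psi>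
    by (simp add: Z_def mono_scp) (simp add: mono_def W_def power_mult_distrib prod.distrib power_sum)
  have PG: "P (G \<theta>) (Z \<theta> \<psi>) = (\<Sum>\<gamma>\<in>\<Gamma>. ch \<gamma> \<theta> * (\<Sum>\<beta>\<in>A. c \<gamma> \<beta> * (W \<beta> * \<psi> ^ (\<Sum>k<n. \<beta> k) * mono n \<beta> \<theta>)))"
    if "\<theta> \<in> torus n L" "\<psi> ^ L = 1" for \<theta> \<psi>
  proof -
    have "P (G \<theta>) = (\<lambda>z. \<Sum>\<gamma>\<in>\<Gamma>. ch \<gamma> \<theta> * P (H \<gamma>) z)"
      unfolding G_def by (rule bounded_projection_sum[OF P fin\<Gamma> H_Linf])
    then show ?thesis using ZB[OF that] by (simp add: c(1) pol_def mono_Z)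
  qed
  \<comment> \<open>Averaging over \<open>\<psi>\<close> keeps degree \<open>m\<close>; averaging
    over \<open>\<theta>\<close> keeps only the coefficient of a monomial in the image of its own
    label. The unknown images of the other \<open>H \<gamma>\<close> cancel, and each tetrahedral
    monomial contributes the same number.\<close>
  define T where "T = (\<Sum>\<theta>\<in>torus n L. \<Sum>\<psi> | \<psi> ^ L = 1. cnj \<psi> ^ m * P (G \<theta>) (Z \<theta> \<psi>))"
  have char: "(\<Sum>\<theta>\<in>torus n L. ch \<gamma> \<theta> * mono n \<beta> \<theta>) = (if \<forall>k<n. \<gamma> k = \<beta> k \<and> \<beta> k \<le> 1 then of_nat L ^ n else 0)"
    if \<gamma>: "\<gamma> \<in> \<Gamma>" and \<beta>: "\<beta> \<in> A" for \<gamma> \<beta>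
  proof -
    have "(\<Sum>\<theta>\<in>torus n L. ch \<gamma> \<theta> * mono n \<beta> \<theta>) = (\<Sum>\<theta>\<in>torus n L. \<Prod>k<n. q (\<gamma> k) (\<theta> k) * \<theta> k ^ \<beta> k)"
      by (simp add: ch_def mono_def prod.distrib)
    also have "\<dots> = (\<Prod>k<n. \<Sum>r | r ^ L = 1. q (\<gamma> k) r * r ^ \<beta> k)"
      unfolding torus_def using L1 by (subst prod_sum_PiE) (auto simp: finite_roots_unity)
    also have "\<dots> = (\<Prod>k<n. if \<gamma> k = \<beta> k \<and> \<beta> k \<le> 1 then of_nat L else 0)"
    proof (rule prod.cong[OF refl])
      fix k assume k: "k \<in> {..<n}"
      have \<beta>m: "\<beta> k \<le> m" using bmi_le A(1) \<beta> by blast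
      have "\<gamma> k \<in> {0, 1, 2}" using PiE_mem[OF \<gamma>[unfolded \<Gamma>_def] k] .
      then consider "\<gamma> k = 0" | "\<gamma> k = 1" | "\<gamma> k = 2" by auto
      then show "(\<Sum>r | r ^ L = 1. q (\<gamma> k) r * r ^ \<beta> k) = (if \<gamma> k = \<beta> k \<and> \<beta> k \<le> 1 then of_nat L else 0)"
      proof cases
        case 1
        then show ?thesis using sum_root_powers[of "\<beta> k" L 0] \<beta>m by (auto simp: q_def L_def)
      next
        case 2
        then show ?thesis using sum_root_powers[of "\<beta> k" L 1] \<beta>m by (auto simp: q_def L_def mult.commute)
      next
        case 3
        then show ?thesis using sum_root_powers[of "Suc (\<beta> k)" L 0] \<beta>m by (auto simp: q_def L_def)
      qed
    qed
    also have "\<dots> = (if \<forall>k<n. \<gamma> k = \<beta> k \<and> \<beta> k \<le> 1 then of_nat L ^ n else 0)"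
    proof (cases "\<forall>k<n. \<gamma> k = \<beta> k \<and> \<beta> k \<le> 1")
      case False
      then obtain k where "k < n" "\<not> (\<gamma> k = \<beta> k \<and> \<beta> k \<le> 1)" by blast
      then have "\<exists>k\<in>{..<n}. (if \<gamma> k = \<beta> k \<and> \<beta> k \<le> 1 then of_nat L else 0) = (0::complex)"
        by (intro bexI[of _ k]) auto
      then have "(\<Prod>k<n. if \<gamma> k = \<beta> k \<and> \<beta> k \<le> 1 then of_nat L else 0) = (0::complex)"
        by (rule prod_zero[OF finite_lessThan])
      then show ?thesis unfolding if_not_P[OF False] .
    qed simp
    finally show ?thesis .
  qed
  have deg: "(\<Sum>\<psi> | \<psi> ^ L = 1. \<psi> ^ (\<Sum>k<n. \<beta> k) * cnj \<psi> ^ m) = (if (\<Sum>k<n. \<beta> k) = m then of_nat L else 0)"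
    if "\<beta> \<in> A" for \<beta>
    using A(1) that by (intro sum_root_powers) (auto simp: L_def bmi_def mdeg_mi)
  have "T = (\<Sum>\<theta>\<in>torus n L. \<Sum>\<psi> | \<psi> ^ L = 1. \<Sum>\<gamma>\<in>\<Gamma>. \<Sum>\<beta>\<in>A.
      c \<gamma> \<beta> * W \<beta> * (\<psi> ^ (\<Sum>k<n. \<beta> k) * cnj \<psi> ^ m) * (ch \<gamma> \<theta> * mono n \<beta> \<theta>))"
    unfolding T_def by (intro sum.cong refl) (simp add: PG sum_distrib_left mult_ac)
  also have "\<dots> = (\<Sum>\<gamma>\<in>\<Gamma>. \<Sum>\<beta>\<in>A. \<Sum>\<theta>\<in>torus n L. \<Sum>\<psi> | \<psi> ^ L = 1.
      c \<gamma> \<beta> * W \<beta> * (\<psi> ^ (\<Sum>k<n. \<beta> k) * cnj \<psi> ^ m) * (ch \<gamma> \<theta> * mono n \<beta> \<theta>))"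
    by (rule sum_swap_pairs)
  also have "\<dots> = (\<Sum>\<gamma>\<in>\<Gamma>. \<Sum>\<beta>\<in>A. c \<gamma> \<beta> * W \<beta> * (\<Sum>\<psi> | \<psi> ^ L = 1. \<psi> ^ (\<Sum>k<n. \<beta> k) * cnj \<psi> ^ m) *
      (\<Sum>\<theta>\<in>torus n L. ch \<gamma> \<theta> * mono n \<beta> \<theta>))"
    by (simp only: sum_distrib_left sum_distrib_right)
  also have "\<dots> = (\<Sum>\<gamma>\<in>\<Gamma>. \<Sum>\<beta>\<in>A. if \<beta> \<in> \<Lambda> \<and> \<gamma> = restrict \<beta> {..<n} then of_nat L ^ Suc n * (\<i> / 2 * of_real \<delta>) ^ m else 0)"
  proof (intro sum.cong refl)
    fix \<gamma> \<beta> assume \<gamma>: "\<gamma> \<in> \<Gamma>" and \<beta>: "\<beta> \<in> A"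
    have \<beta>mi: "\<beta> \<in> mi n" using A(1) \<beta> by (auto simp: bmi_def)
    then have fs: "finite {k. \<beta> k \<noteq> 0}" by (auto simp: mi_def intro!: finite_subset[of _ "{..<n}"] leI)
    have iff: "(\<Sum>k<n. \<beta> k) = m \<and> (\<forall>k<n. \<gamma> k = \<beta> k \<and> \<beta> k \<le> 1) \<longleftrightarrow> \<beta> \<in> \<Lambda> \<and> \<gamma> = restrict \<beta> {..<n}"
    proof -
      have "(\<forall>k<n. \<gamma> k = \<beta> k) \<longleftrightarrow> \<gamma> = restrict \<beta> {..<n}"
        using \<gamma> by (auto simp: \<Gamma>_def fun_eq_iff PiE_iff extensional_def)
      moreover have "(\<forall>k<n. \<beta> k \<le> 1) \<longleftrightarrow> (\<forall>k. \<beta> k \<le> 1)"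
        using \<beta>mi by (auto simp: mi_def) (metis le0 not_le_imp_less)
      ultimately show ?thesis using \<beta>mi fs by (auto simp: \<Lambda>_def Lambda_T_def mdeg_mi)
    qed
    show "c \<gamma> \<beta> * W \<beta> * (\<Sum>\<psi> | \<psi> ^ L = 1. \<psi> ^ (\<Sum>k<n. \<beta> k) * cnj \<psi> ^ m) * (\<Sum>\<theta>\<in>torus n L. ch \<gamma> \<theta> * mono n \<beta> \<theta>)
      = (if \<beta> \<in> \<Lambda> \<and> \<gamma> = restrict \<beta> {..<n} then of_nat L ^ Suc n * (\<i> / 2 * of_real \<delta>) ^ m else 0)"
    proof (cases "\<beta> \<in> \<Lambda> \<and> \<gamma> = restrict \<beta> {..<n}")
      case True
      then have e: "c \<gamma> \<beta> * W \<beta> = (\<i> / 2 * of_real \<delta>) ^ m" using c(2)[of \<beta>] W0[of \<beta>] by (simp add: cc_def)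
      have 1: "(\<Sum>k<n. \<beta> k) = m" and 2: "\<forall>k<n. \<gamma> k = \<beta> k \<and> \<beta> k \<le> 1" using True iff by blast+
      show ?thesis
        unfolding deg[OF \<beta>] char[OF \<gamma> \<beta>] if_P[OF 1] if_P[OF 2] if_P[OF True] e by (simp only: power_Suc mult_ac)
    next
      case False
      then have "\<not> ((\<Sum>k<n. \<beta> k) = m \<and> (\<forall>k<n. \<gamma> k = \<beta> k \<and> \<beta> k \<le> 1))" using iff by blast
      then show ?thesis
        unfolding deg[OF \<beta>] char[OF \<gamma> \<beta>] if_not_P[OF False]
        by (cases "(\<Sum>k<n. \<beta> k) = m")
          (simp_all only: if_True if_False simp_thms mult_zero_left mult_zero_right)
    qed
  qed
  also have "\<dots> = (\<Sum>\<beta>\<in>A. \<Sum>\<gamma>\<in>\<Gamma>. if \<beta> \<in> \<Lambda> \<and> \<gamma> = restrict \<beta> {..<n} then of_nat L ^ Suc n * (\<i> / 2 * of_real \<delta>) ^ m else 0)"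
    by (rule sum.swap)
  also have "\<dots> = (\<Sum>\<beta>\<in>A. if \<beta> \<in> \<Lambda> then of_nat L ^ Suc n * (\<i> / 2 * of_real \<delta>) ^ m else 0)"
  proof (rule sum.cong[OF refl])
    fix \<beta>
    have "restrict \<beta> {..<n} \<in> \<Gamma>" if "\<beta> \<in> \<Lambda>"
    proof -
      have "\<beta> k \<in> {0, 1, 2}" for k using \<Lambda>01[OF that, of k] by auto
      then show ?thesis unfolding \<Gamma>_def restrict_PiE_iff by blast
    qed
    then show "(\<Sum>\<gamma>\<in>\<Gamma>. if \<beta> \<in> \<Lambda> \<and> \<gamma> = restrict \<beta> {..<n} then of_nat L ^ Suc n * (\<i> / 2 * of_real \<delta>) ^ m else 0)
      = (if \<beta> \<in> \<Lambda> then of_nat L ^ Suc n * (\<i> / 2 * of_real \<delta>) ^ m else 0)"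
      using fin\<Gamma> by (cases "\<beta> \<in> \<Lambda>") auto
  qed
  also have "\<dots> = of_nat (card \<Lambda>) * (of_nat L ^ Suc n * (\<i> / 2 * of_real \<delta>) ^ m)"
    using fin A(2) by (subst sum.inter_restrict[symmetric]) (auto simp: \<Lambda>_def Int_absorb1)
  finally have "cmod T = real (card \<Lambda>) * (real L ^ Suc n * (\<delta> / 2) ^ m)"
    using \<delta> by (simp add: norm_mult norm_power norm_divide)
  moreover have "cmod T \<le> real L ^ Suc n * (t * exp (real m / 2))"
  proof -
    have "cmod T \<le> (\<Sum>\<theta>\<in>torus n L. \<Sum>\<psi> | \<psi> ^ L = 1. cmod (cnj \<psi> ^ m * P (G \<theta>) (Z \<theta> \<psi>)))"
      unfolding T_def by (intro order_trans[OF norm_sum] sum_mono norm_sum)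
    also have "\<dots> \<le> (\<Sum>\<theta>\<in>torus n L. \<Sum>\<psi> | \<psi> ^ L = (1::complex). t * exp (real m / 2))"
    proof (intro sum_mono)
      fix \<theta> and \<psi> :: complex assume \<theta>: "\<theta> \<in> torus n L" and \<psi>: "\<psi> \<in> {\<psi>. \<psi> ^ L = 1}"
      obtain c' where "P (G \<theta>) = pol A c'" using bounded_projectionD(3)[OF P G_Linf, of \<theta>] by blast
      then have PGL: "P (G \<theta>) \<in> Linf B" using pol_Linf[OF fin] by simp
      have "cmod (P (G \<theta>) (Z \<theta> \<psi>)) \<le> supn B (P (G \<theta>))" using ZB \<theta> \<psi> by (intro supn_upper PGL) auto
      also have "\<dots> \<le> t * supn B (G \<theta>)" by (rule bounded_projectionD(5)[OF P G_Linf])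
      also have "\<dots> \<le> t * exp (real m / 2)"
        using G_bound[OF \<theta>] t by (intro mult_left_mono supn_least body_nonempty) auto
      finally show "cmod (cnj \<psi> ^ m * P (G \<theta>) (Z \<theta> \<psi>)) \<le> t * exp (real m / 2)"
        using root_unity_norm[OF L1, of \<psi>] \<psi> by (simp add: norm_mult norm_power)
    qed
    also have "\<dots> = real L ^ Suc n * (t * exp (real m / 2))"
      using L1 by (simp add: card_torus card_complex_roots_unity)
    finally show ?thesis .
  qed
  ultimately have "real (card \<Lambda>) * (real L ^ Suc n * (\<delta> / 2) ^ m) \<le> real L ^ Suc n * (t * exp (real m / 2))"
    by linarith
  then have "real L ^ Suc n * (real (card \<Lambda>) * (\<delta> / 2) ^ m) \<le> real L ^ Suc n * (t * exp (real m / 2))"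
    by (simp only: mult.left_commute)
  moreover have "0 < real L ^ Suc n" by (simp add: L_def)
  ultimately have "real (card \<Lambda>) * (\<delta> / 2) ^ m \<le> t * exp (real m / 2)"
    by (rule mult_left_le_imp_le)
  moreover have "(real n / real m) ^ m * (\<delta> / 2) ^ m \<le> real (card \<Lambda>) * (\<delta> / 2) ^ m"
    using card_Lambda_T_ge[OF m(2)] \<delta> by (intro mult_right_mono) (auto simp: \<Lambda>_def)
  ultimately show ?thesis unfolding \<delta>_def by linarith
qed

end

section \<open>The unconditional basis constant from above\<close>

lemma mono_upd: "k < n \<Longrightarrow> mono n (\<alpha>(k := x)) z = z k ^ x * (\<Prod>j\<in>{..<n} - {k}. z j ^ \<alpha> j)"
  unfolding mono_def by (subst prod.remove[of _ k]) (auto intro!: arg_cong2[where f = "(*)"] prod.cong)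

lemma mono_line_has_derivative:
  "((\<lambda>\<zeta>. mono n \<alpha> (\<lambda>k. a k + \<zeta> * b k)) has_field_derivative
     (\<Sum>k<n. of_nat (\<alpha> k) * (b k * mono n (\<alpha>(k := \<alpha> k - 1)) a))) (at 0)"
proof -
  have "((\<lambda>\<zeta>. \<Prod>k<n. (a k + \<zeta> * b k) ^ \<alpha> k) has_field_derivative
     (\<Sum>k<n. (of_nat (\<alpha> k) * (b k * (a k + 0 * b k) ^ (\<alpha> k - 1))) * (\<Prod>j\<in>{..<n} - {k}. (a j + 0 * b j) ^ \<alpha> j))) (at 0)"
    by (rule has_field_derivative_prod) (auto intro!: derivative_eq_intros)
  also have "(\<Sum>k<n. (of_nat (\<alpha> k) * (b k * (a k + 0 * b k) ^ (\<alpha> k - 1))) * (\<Prod>j\<in>{..<n} - {k}. (a j + 0 * b j) ^ \<alpha> j))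
      = (\<Sum>k<n. of_nat (\<alpha> k) * (b k * mono n (\<alpha>(k := \<alpha> k - 1)) a))"
    by (intro sum.cong refl) (simp add: mono_upd mult_ac)
  finally show ?thesis unfolding mono_def .
qed

lemma sum_upd_index:
  assumes "\<alpha> \<in> mi n" "k < n"
  shows "\<alpha>(k := x) \<in> mi n" "mdeg (\<alpha>(k := x)) + \<alpha> k = mdeg \<alpha> + x"
proof -
  show 1: "\<alpha>(k := x) \<in> mi n" using assms by (auto simp: mi_def)
  have "(\<Sum>j<n. (\<alpha>(k := x)) j) = x + (\<Sum>j\<in>{..<n} - {k}. \<alpha> j)"
    using assms(2) by (subst sum.remove[of _ k]) auto
  moreover have "(\<Sum>j<n. \<alpha> j) = \<alpha> k + (\<Sum>j\<in>{..<n} - {k}. \<alpha> j)"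
    using assms(2) by (subst sum.remove[of _ k]) auto
  ultimately show "mdeg (\<alpha>(k := x)) + \<alpha> k = mdeg \<alpha> + x"
    using mdeg_mi[OF 1] mdeg_mi[OF assms(1)] by simp
qed

text \<open>Terms with \<open>\<alpha> k = 0\<close> vanish, and on the others lowering the
  \<open>k\<close>-th exponent is injective and lowers the degree. \<open>F\<close> is general
  because the identity serves both for partial derivatives and for sums of moduli.\<close>

lemma sum_shift_index:
  fixes F :: "(nat \<Rightarrow> nat) \<Rightarrow> (nat \<Rightarrow> nat) \<Rightarrow> 'b::comm_semiring_1"
  assumes A: "A \<subseteq> bmi n m" and m: "1 \<le> m" and k: "k < n"
  shows "(\<Sum>\<alpha>\<in>A. of_nat (\<alpha> k) * F \<alpha> (\<alpha>(k := \<alpha> k - 1)))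
    = (\<Sum>\<beta>\<in>bmi n (m - 1). if \<beta>(k := Suc (\<beta> k)) \<in> A then of_nat (Suc (\<beta> k)) * F (\<beta>(k := Suc (\<beta> k))) \<beta> else 0)"
proof -
  have fin: "finite A" using A finite_bmi finite_subset by blast
  have "(\<Sum>\<alpha>\<in>A. of_nat (\<alpha> k) * F \<alpha> (\<alpha>(k := \<alpha> k - 1))) = (\<Sum>\<alpha>\<in>{\<alpha> \<in> A. 0 < \<alpha> k}. of_nat (\<alpha> k) * F \<alpha> (\<alpha>(k := \<alpha> k - 1)))"
    using fin by (intro sum.mono_neutral_right) auto
  also have "\<dots> = (\<Sum>\<beta>\<in>{\<beta> \<in> bmi n (m - 1). \<beta>(k := Suc (\<beta> k)) \<in> A}. of_nat (Suc (\<beta> k)) * F (\<beta>(k := Suc (\<beta> k))) \<beta>)"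
  proof (rule sum.reindex_bij_witness[of _ "\<lambda>\<beta>. \<beta>(k := Suc (\<beta> k))" "\<lambda>\<alpha>. \<alpha>(k := \<alpha> k - 1)"])
    fix \<alpha> assume \<alpha>: "\<alpha> \<in> {\<alpha> \<in> A. 0 < \<alpha> k}"
    then have "\<alpha> \<in> mi n" "mdeg \<alpha> \<le> m" using A by (auto simp: bmi_def)
    then have "\<alpha>(k := \<alpha> k - 1) \<in> bmi n (m - 1)"
      using sum_upd_index[of \<alpha> n k "\<alpha> k - 1"] k \<alpha> by (auto simp: bmi_def)
    then show "\<alpha>(k := \<alpha> k - 1) \<in> {\<beta> \<in> bmi n (m - 1). \<beta>(k := Suc (\<beta> k)) \<in> A}" using \<alpha> by simp
  qed auto
  also have "\<dots> = (\<Sum>\<beta>\<in>bmi n (m - 1). if \<beta>(k := Suc (\<beta> k)) \<in> A then of_nat (Suc (\<beta> k)) * F (\<beta>(k := Suc (\<beta> k))) \<beta> else 0)"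
    by (rule sum.inter_filter) (rule finite_bmi)
  finally show ?thesis .
qed

lemma L2_set_sum_le: "finite I \<Longrightarrow> L2_set (\<lambda>b. \<Sum>i\<in>I. f i b) T \<le> (\<Sum>i\<in>I. L2_set (f i) T)"
proof (induction I rule: finite_induct)
  case (insert i I)
  then show ?case using L2_set_triangle_ineq[of "f i" "\<lambda>b. \<Sum>i\<in>I. f i b" T] by simp
qed (simp add: L2_set_def)

context reinhardt_body
begin

text \<open>Cauchy's inequality for the restriction of the polynomial to the complex line through
  \<open>u / 2\<close> in the direction \<open>y\<close>, which is \<open>z\<close> with its
  coordinates rotated. The disc of radius \<open>1 / 2\<close> stays in \<open>B\<close>, so the
  bound is free of \<open>n\<close> and of the degree.\<close>

lemma derivative_bound:
  assumes fin: "finite A" and K: "\<And>z. z \<in> B \<Longrightarrow> cmod (\<Sum>\<alpha>\<in>A. c \<alpha> * mono n \<alpha> z) \<le> K"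
    and u: "u \<in> B" and z: "z \<in> B"
  shows "(\<Sum>k<n. cmod (z k) * cmod (\<Sum>\<alpha>\<in>A. of_nat (\<alpha> k) * (c \<alpha> * mono n (\<alpha>(k := \<alpha> k - 1)) (\<lambda>j. u j / 2)))) \<le> 2 * K"
proof -
  define a where "a = (\<lambda>j. u j / 2)"
  define D where "D k = (\<Sum>\<alpha>\<in>A. of_nat (\<alpha> k) * (c \<alpha> * mono n (\<alpha>(k := \<alpha> k - 1)) a))" for k
  define e where "e x = (if x = 0 then 1 else cnj x / of_real (cmod x))" for x :: complex
  have e1: "cmod (e x) = 1" for x by (simp add: e_def norm_divide)
  have e2: "e x * x = of_real (cmod x)" for x
  proof (cases "x = 0")
    case False
    have "cnj x * x = of_real ((cmod x)\<^sup>2)" unfolding complex_norm_square by simp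
    then show ?thesis using False by (simp add: e_def power2_eq_square)
  qed (simp add: e_def)
  \<comment> \<open>The phases make every term of the directional derivative equal to
    \<open>cmod (z k * D k)\<close>, so that nothing cancels.\<close>
  define y where "y k = e (z k * D k) * z k" for k
  define h where "h \<zeta> = (\<Sum>\<alpha>\<in>A. c \<alpha> * mono n \<alpha> (\<lambda>k. a k + \<zeta> * y k))" for \<zeta>
  \<comment> \<open>The point is the midpoint of \<open>u\<close> and
    \<open>2 * \<zeta> * y\<close>; the latter is dominated by \<open>z\<close> because
    \<open>cmod (2 * \<zeta>) \<le> 1\<close>.\<close>
  have pt: "(\<lambda>k. a k + \<zeta> * y k) \<in> B" if "cmod \<zeta> \<le> 1 / 2" for \<zeta>
  proof -
    have "(\<lambda>k. 2 * \<zeta> * y k) \<in> B"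
    proof (rule solid[OF z])
      fix k
      have "cmod (2 * \<zeta> * y k) = (2 * cmod \<zeta>) * cmod (z k)" by (simp add: y_def norm_mult e1)
      also have "\<dots> \<le> 1 * cmod (z k)" using that by (intro mult_right_mono) auto
      finally show "cmod (2 * \<zeta> * y k) \<le> cmod (z k)" by simp
    qed
    from midpoint[OF u this] show ?thesis by (simp add: a_def add_divide_distrib)
  qed
  have hol: "h holomorphic_on UNIV" unfolding h_def mono_def by (intro holomorphic_intros)
  have "(h has_field_derivative (\<Sum>\<alpha>\<in>A. c \<alpha> * (\<Sum>k<n. of_nat (\<alpha> k) * (y k * mono n (\<alpha>(k := \<alpha> k - 1)) a)))) (at 0)"
    unfolding h_def by (intro DERIV_sum DERIV_cmult mono_line_has_derivative)
  then have "deriv h 0 = (\<Sum>\<alpha>\<in>A. c \<alpha> * (\<Sum>k<n. of_nat (\<alpha> k) * (y k * mono n (\<alpha>(k := \<alpha> k - 1)) a)))"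
    by (rule DERIV_imp_deriv)
  also have "\<dots> = (\<Sum>k<n. y k * D k)"
    unfolding D_def sum_distrib_left by (subst sum.swap) (simp add: mult_ac)
  also have "\<dots> = (\<Sum>k<n. of_real (cmod (z k * D k)))"
    using e2 by (intro sum.cong refl) (simp add: y_def mult.assoc)
  finally have d: "deriv h 0 = of_real (\<Sum>k<n. cmod (z k) * cmod (D k))" by (simp add: norm_mult)
  have "cmod ((deriv ^^ 1) h 0) \<le> fact 1 * K / (1 / 2) ^ 1"
  proof (rule Cauchy_inequality)
    show "h holomorphic_on ball 0 (1 / 2)" using hol holomorphic_on_subset by blast
    show "continuous_on (cball 0 (1 / 2)) h"
      using hol holomorphic_on_subset holomorphic_on_imp_continuous_on by blast
    show "cmod (h x) \<le> K" if "cmod (0 - x) = 1 / 2" for x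
      unfolding h_def using that by (intro K pt) simp
  qed auto
  then have "cmod (of_real (\<Sum>k<n. cmod (z k) * cmod (D k))) \<le> 2 * K" using d by simp
  then have "\<bar>\<Sum>k<n. cmod (z k) * cmod (D k)\<bar> \<le> 2 * K" by (simp only: norm_of_real)
  then show ?thesis unfolding D_def a_def by linarith
qed

text \<open>The optimal design is taken for the monomials of degree at most \<open>m - 1\<close>,
  not for \<open>A\<close>: the sum is first dominated by the constant term and \<open>S\<close>,
  which involves only coefficients \<open>b k\<close> of partial derivatives. Minkowski's inequality
  in \<open>k\<close> keeps the weights \<open>cmod (z k)\<close> together, in the form needed for
  \<open>derivative_bound\<close>.\<close>

lemma absolute_sum_bound:
  assumes A: "A \<subseteq> bmi n m" and m: "1 \<le> m" and K: "\<And>z. z \<in> B \<Longrightarrow> cmod (\<Sum>\<alpha>\<in>A. c \<alpha> * mono n \<alpha> z) \<le> K"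
    and z: "z \<in> B"
  shows "(\<Sum>\<alpha>\<in>A. cmod (c \<alpha>) * cmod (mono n \<alpha> z)) \<le> (1 + 6 * 4 ^ (m - 1) * sqrt (6 * real (card (bmi n (m - 1))))) * K"
proof -
  have fin: "finite A" using A finite_bmi finite_subset by blast
  define A' where "A' = bmi n (m - 1)"
  have fin': "finite A'" "A' \<noteq> {}" using finite_bmi zero_in_bmi[of n "m - 1"] unfolding A'_def by blast+
  define b where "b k \<beta> = (if \<beta>(k := Suc (\<beta> k)) \<in> A then of_nat (Suc (\<beta> k)) * c (\<beta>(k := Suc (\<beta> k))) else 0)" for k \<beta>
  define S where "S = (\<Sum>k<n. \<Sum>\<beta>\<in>A'. cmod (z k) * cmod (b k \<beta>) * cmod (mono n \<beta> z))"
  have K0: "0 \<le> K" using K[OF z] norm_ge_zero order_trans by blast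
  have S1: "(\<Sum>\<alpha>\<in>A. cmod (c \<alpha>) * cmod (mono n \<alpha> z)) \<le> K + S"
  proof -
    have c0: "cmod (c (\<lambda>_. 0)) \<le> K" if "(\<lambda>_. 0) \<in> A"
    proof -
      have "mono n \<alpha> (\<lambda>_. 0) = 0" if "\<alpha> \<in> A - {\<lambda>_. 0}" for \<alpha>
      proof -
        have "\<alpha> \<in> mi n" "\<alpha> \<noteq> (\<lambda>_. 0)" using that A by (auto simp: bmi_def)
        then obtain k where "\<alpha> k \<noteq> 0" by auto
        then have "k < n" using \<open>\<alpha> \<in> mi n\<close> by (cases "k < n") (auto simp: mi_def)
        then show ?thesis unfolding mono_def using \<open>\<alpha> k \<noteq> 0\<close> by (intro prod_zero bexI[of _ k]) auto
      qed
      then have "(\<Sum>\<alpha>\<in>A. c \<alpha> * mono n \<alpha> (\<lambda>_. 0)) = c (\<lambda>_. 0)"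
        using fin that sum.remove[of A "\<lambda>_. 0" "\<lambda>\<alpha>. c \<alpha> * mono n \<alpha> (\<lambda>_. 0)"]
        by (simp add: mono_def[of n "\<lambda>_. 0"])
      then show ?thesis using K[OF zero_mem] by simp
    qed
    \<comment> \<open>A nonconstant monomial contains some \<open>z k\<close>; including all
      \<open>k\<close> with the multiplicities \<open>\<alpha> k\<close> of differentiation can only
      enlarge the right side.\<close>
    have trm: "cmod (c \<alpha>) * cmod (mono n \<alpha> z)
        \<le> (if \<alpha> = (\<lambda>_. 0) then K else 0) + (\<Sum>k<n. real (\<alpha> k) * (cmod (z k) * cmod (c \<alpha>) * cmod (mono n (\<alpha>(k := \<alpha> k - 1)) z)))"
      if \<alpha>: "\<alpha> \<in> A" for \<alpha>
    proof (cases "\<alpha> = (\<lambda>_. 0)")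
      case True
      then show ?thesis using c0 \<alpha> by (simp add: mono_def)
    next
      case False
      have \<alpha>mi: "\<alpha> \<in> mi n" using \<alpha> A by (auto simp: bmi_def)
      obtain k where k: "\<alpha> k \<noteq> 0" using False by auto
      then have kn: "k < n" using \<alpha>mi by (cases "k < n") (auto simp: mi_def)
      have "mono n \<alpha> z = z k * mono n (\<alpha>(k := \<alpha> k - 1)) z"
        using mono_upd[OF kn, of \<alpha> "\<alpha> k" z] mono_upd[OF kn, of \<alpha> "\<alpha> k - 1" z] k
        by (simp add: power_eq_if[of _ "\<alpha> k"])
      then have "cmod (c \<alpha>) * cmod (mono n \<alpha> z) = 1 * (cmod (z k) * cmod (c \<alpha>) * cmod (mono n (\<alpha>(k := \<alpha> k - 1)) z))"
        by (simp add: norm_mult)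
      also have "\<dots> \<le> real (\<alpha> k) * (cmod (z k) * cmod (c \<alpha>) * cmod (mono n (\<alpha>(k := \<alpha> k - 1)) z))"
        using k by (intro mult_right_mono) auto
      also have "\<dots> \<le> (\<Sum>k<n. real (\<alpha> k) * (cmod (z k) * cmod (c \<alpha>) * cmod (mono n (\<alpha>(k := \<alpha> k - 1)) z)))"
        using kn by (intro member_le_sum[of k "{..<n}" "\<lambda>k. real (\<alpha> k) * (cmod (z k) * cmod (c \<alpha>) * cmod (mono n (\<alpha>(k := \<alpha> k - 1)) z))"]) auto
      finally show ?thesis using False by simp
    qed
    have "(\<Sum>\<alpha>\<in>A. cmod (c \<alpha>) * cmod (mono n \<alpha> z)) \<le> (\<Sum>\<alpha>\<in>A. (if \<alpha> = (\<lambda>_. 0) then K else 0) +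
        (\<Sum>k<n. real (\<alpha> k) * (cmod (z k) * cmod (c \<alpha>) * cmod (mono n (\<alpha>(k := \<alpha> k - 1)) z))))"
      by (rule sum_mono) (rule trm)
    also have "\<dots> = (\<Sum>\<alpha>\<in>A. if \<alpha> = (\<lambda>_. 0) then K else 0) +
        (\<Sum>k<n. \<Sum>\<alpha>\<in>A. real (\<alpha> k) * (cmod (z k) * cmod (c \<alpha>) * cmod (mono n (\<alpha>(k := \<alpha> k - 1)) z)))"
      unfolding sum.distrib by (subst sum.swap) simp
    also have "(\<Sum>k<n. \<Sum>\<alpha>\<in>A. real (\<alpha> k) * (cmod (z k) * cmod (c \<alpha>) * cmod (mono n (\<alpha>(k := \<alpha> k - 1)) z))) = S"
      unfolding S_def A'_def
    proof (rule sum.cong[OF refl])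
      fix k assume "k \<in> {..<n}"
      then have kn: "k < n" by simp
      have "(\<Sum>\<alpha>\<in>A. real (\<alpha> k) * (cmod (z k) * cmod (c \<alpha>) * cmod (mono n (\<alpha>(k := \<alpha> k - 1)) z)))
        = (\<Sum>\<beta>\<in>bmi n (m - 1). if \<beta>(k := Suc (\<beta> k)) \<in> A then real (Suc (\<beta> k)) *
            (cmod (z k) * cmod (c (\<beta>(k := Suc (\<beta> k)))) * cmod (mono n \<beta> z)) else 0)"
        using sum_shift_index[OF A m kn, of "\<lambda>\<alpha> \<beta>. cmod (z k) * cmod (c \<alpha>) * cmod (mono n \<beta> z)"] .
      also have "\<dots> = (\<Sum>\<beta>\<in>bmi n (m - 1). cmod (z k) * cmod (b k \<beta>) * cmod (mono n \<beta> z))"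
        by (intro sum.cong refl) (simp add: b_def norm_mult del: of_nat_Suc)
      finally show "(\<Sum>\<alpha>\<in>A. real (\<alpha> k) * (cmod (z k) * cmod (c \<alpha>) * cmod (mono n (\<alpha>(k := \<alpha> k - 1)) z)))
        = (\<Sum>\<beta>\<in>bmi n (m - 1). cmod (z k) * cmod (b k \<beta>) * cmod (mono n \<beta> z))" .
    qed
    also have "(\<Sum>\<alpha>\<in>A. if \<alpha> = (\<lambda>_. 0) then K else 0) \<le> K" using fin K0 by simp
    finally show ?thesis by simp
  qed
  define D where "D k v = (\<Sum>\<beta>\<in>A'. b k \<beta> * mono n \<beta> v)" for k v
  have D_bound: "(\<Sum>k<n. cmod (z k) * cmod (D k (\<lambda>j. u j / 2))) \<le> 2 * K" if u: "u \<in> B" for u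
  proof -
    have "D k v = (\<Sum>\<alpha>\<in>A. of_nat (\<alpha> k) * (c \<alpha> * mono n (\<alpha>(k := \<alpha> k - 1)) v))" if "k < n" for k v
    proof -
      have "(\<Sum>\<alpha>\<in>A. of_nat (\<alpha> k) * (c \<alpha> * mono n (\<alpha>(k := \<alpha> k - 1)) v))
        = (\<Sum>\<beta>\<in>bmi n (m - 1). if \<beta>(k := Suc (\<beta> k)) \<in> A then of_nat (Suc (\<beta> k)) *
            (c (\<beta>(k := Suc (\<beta> k))) * mono n \<beta> v) else 0)"
        using sum_shift_index[OF A m that, of "\<lambda>\<alpha> \<beta>. c \<alpha> * mono n \<beta> v"] .
      also have "\<dots> = D k v"
        unfolding D_def A'_def by (intro sum.cong refl) (simp add: b_def)
      finally show ?thesis ..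
    qed
    then have "(\<Sum>k<n. cmod (z k) * cmod (D k (\<lambda>j. u j / 2)))
      = (\<Sum>k<n. cmod (z k) * cmod (\<Sum>\<alpha>\<in>A. of_nat (\<alpha> k) * (c \<alpha> * mono n (\<alpha>(k := \<alpha> k - 1)) (\<lambda>j. u j / 2))))"
      by (intro sum.cong refl) simp
    also have "\<dots> \<le> 2 * K" by (intro derivative_bound fin K u z)
    finally show ?thesis .
  qed
  define Y where "Y \<beta> = (\<Sum>k<n. cmod (z k) * cmod (b k \<beta>))" for \<beta>
  \<comment> \<open>The factor 3 and one power \<open>2 ^ (m - 1)\<close> come from
    \<open>torus_L2_le_L1\<close>, the other power from evaluating at \<open>s / 2\<close> instead
    of \<open>s\<close>, and \<open>2 * K\<close> from \<open>derivative_bound\<close>.\<close>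
  define Q where "Q = 6 * 4 ^ (m - 1) * K"
  have per_s: "(\<Sum>\<beta>\<in>A'. (cmod (mono n \<beta> s) * Y \<beta>)\<^sup>2) \<le> Q\<^sup>2" if s: "s \<in> B" for s
  proof -
    define L where "L = 2 * m"
    define q where "q = real L ^ n"
    have L: "2 * (m - 1) < L" "1 \<le> L" using m by (auto simp: L_def)
    have q: "q > 0" using L by (simp add: q_def)
    define s' where "s' = (\<lambda>j. s j / 2)"
    have half: "cmod (mono n \<beta> s) \<le> 2 ^ (m - 1) * cmod (mono n \<beta> s')" if "\<beta> \<in> A'" for \<beta>
    proof -
      have "mono n \<beta> s = (\<Prod>k<n. 2 ^ \<beta> k * s' k ^ \<beta> k)"
        unfolding mono_def s'_def by (intro prod.cong refl) (simp add: power_divide)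
      also have "\<dots> = 2 ^ (\<Sum>k<n. \<beta> k) * mono n \<beta> s'" by (simp add: prod.distrib power_sum mono_def)
      finally have "cmod (mono n \<beta> s) = 2 ^ (\<Sum>k<n. \<beta> k) * cmod (mono n \<beta> s')"
        by (simp add: norm_mult norm_power)
      also have "\<dots> \<le> 2 ^ (m - 1) * cmod (mono n \<beta> s')"
        using that by (intro mult_right_mono power_increasing) (auto simp: A'_def bmi_def mdeg_mi)
      finally show ?thesis .
    qed
    have split: "D k (\<lambda>j. scp n s \<tau> j / 2) = (\<Sum>\<beta>\<in>A'. (b k \<beta> * mono n \<beta> s') * mono n \<beta> \<tau>)" for k \<tau>
    proof -
      have "mono n \<beta> (\<lambda>j. scp n s \<tau> j / 2) = mono n \<beta> (scp n s' \<tau>)" for \<beta>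
        unfolding mono_def by (intro prod.cong refl) (simp add: scp_def s'_def)
      then show ?thesis by (simp add: D_def mono_scp mult_ac)
    qed
    have "L2_set (\<lambda>\<beta>. cmod (mono n \<beta> s) * Y \<beta>) A' = L2_set (\<lambda>\<beta>. \<Sum>k<n. cmod (z k) * (cmod (b k \<beta>) * cmod (mono n \<beta> s))) A'"
      unfolding Y_def by (intro L2_set_cong refl) (simp add: sum_distrib_left mult_ac)
    also have "\<dots> \<le> (\<Sum>k<n. L2_set (\<lambda>\<beta>. cmod (z k) * (cmod (b k \<beta>) * cmod (mono n \<beta> s))) A')"
      by (rule L2_set_sum_le) simp
    also have "\<dots> \<le> (\<Sum>k<n. cmod (z k) * (3 * 4 ^ (m - 1) * ((\<Sum>\<tau>\<in>torus n L. cmod (D k (\<lambda>j. scp n s \<tau> j / 2))) / q)))"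
    proof (rule sum_mono)
      fix k
      have "L2_set (\<lambda>\<beta>. cmod (z k) * (cmod (b k \<beta>) * cmod (mono n \<beta> s))) A'
          \<le> L2_set (\<lambda>\<beta>. (cmod (z k) * 2 ^ (m - 1)) * cmod (b k \<beta> * mono n \<beta> s')) A'"
      proof (rule L2_set_mono)
        fix \<beta> assume "\<beta> \<in> A'"
        then have "cmod (z k) * (cmod (b k \<beta>) * cmod (mono n \<beta> s)) \<le> cmod (z k) * (cmod (b k \<beta>) * (2 ^ (m - 1) * cmod (mono n \<beta> s')))"
          by (intro mult_left_mono half) auto
        then show "cmod (z k) * (cmod (b k \<beta>) * cmod (mono n \<beta> s)) \<le> (cmod (z k) * 2 ^ (m - 1)) * cmod (b k \<beta> * mono n \<beta> s')"
          by (simp add: norm_mult mult_ac)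
      qed auto
      also have "\<dots> = (cmod (z k) * 2 ^ (m - 1)) * sqrt (\<Sum>\<beta>\<in>A'. (cmod (b k \<beta> * mono n \<beta> s'))\<^sup>2)"
        by (subst L2_set_right_distrib[symmetric]) (auto simp: L2_set_def)
      also have "\<dots> \<le> (cmod (z k) * 2 ^ (m - 1)) * (3 * 2 ^ (m - 1) * ((\<Sum>\<tau>\<in>torus n L. cmod (\<Sum>\<beta>\<in>A'. (b k \<beta> * mono n \<beta> s') * mono n \<beta> \<tau>)) / real L ^ n))"
        by (intro mult_left_mono torus_L2_le_L1[OF _ L(1)]) (auto simp: A'_def)
      also have "\<dots> = cmod (z k) * (3 * 4 ^ (m - 1) * ((\<Sum>\<tau>\<in>torus n L. cmod (D k (\<lambda>j. scp n s \<tau> j / 2))) / q))"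
      proof -
        have "(4::real) ^ (m - 1) = 2 ^ (m - 1) * 2 ^ (m - 1)" by (simp add: power_mult_distrib[symmetric])
        then show ?thesis unfolding split q_def by (simp only: mult_ac)
      qed
      finally show "L2_set (\<lambda>\<beta>. cmod (z k) * (cmod (b k \<beta>) * cmod (mono n \<beta> s))) A'
        \<le> cmod (z k) * (3 * 4 ^ (m - 1) * ((\<Sum>\<tau>\<in>torus n L. cmod (D k (\<lambda>j. scp n s \<tau> j / 2))) / q))" .
    qed
    also have "\<dots> = 3 * 4 ^ (m - 1) / q * (\<Sum>k<n. \<Sum>\<tau>\<in>torus n L. cmod (z k) * cmod (D k (\<lambda>j. scp n s \<tau> j / 2)))"
      by (simp add: sum_distrib_left sum_divide_distrib mult_ac)
    also have "\<dots> = 3 * 4 ^ (m - 1) / q * (\<Sum>\<tau>\<in>torus n L. \<Sum>k<n. cmod (z k) * cmod (D k (\<lambda>j. scp n s \<tau> j / 2)))"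
      by (subst sum.swap) (rule refl)
    also have "\<dots> \<le> 3 * 4 ^ (m - 1) / q * (\<Sum>\<tau>\<in>torus n L. 2 * K)"
      using q s torus_norm[OF L(2)] by (intro mult_left_mono sum_mono D_bound scp_mem) auto
    also have "\<dots> = Q" using q L by (simp add: Q_def card_torus q_def)
    finally have le: "L2_set (\<lambda>\<beta>. cmod (mono n \<beta> s) * Y \<beta>) A' \<le> Q" .
    have "(\<Sum>\<beta>\<in>A'. (cmod (mono n \<beta> s) * Y \<beta>)\<^sup>2) = (L2_set (\<lambda>\<beta>. cmod (mono n \<beta> s) * Y \<beta>) A')\<^sup>2"
      unfolding L2_set_def by (rule real_sqrt_pow2[symmetric]) (auto intro: sum_nonneg)
    also have "\<dots> \<le> Q\<^sup>2" using le by (intro power_mono) auto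
    finally show ?thesis .
  qed
  obtain F l where F: "finite F" "F \<subseteq> B" "\<forall>s\<in>F. 0 \<le> l s" "(\<Sum>s\<in>F. l s) = (1::real)"
    and pos: "\<forall>a\<in>A'. 0 < (\<Sum>s\<in>F. l s * (cmod (mono n a s))\<^sup>2)"
    and opt: "\<forall>z\<in>B. (\<Sum>a\<in>A'. (cmod (mono n a z))\<^sup>2 / (\<Sum>s\<in>F. l s * (cmod (mono n a s))\<^sup>2)) \<le> 6 * real (card A')"
    using optimal_design[OF fin'] by (elim exE conjE) blast
  define x where "x \<alpha> = (\<Sum>s\<in>F. l s * (cmod (mono n \<alpha> s))\<^sup>2)" for \<alpha>
  have xpos: "0 < x \<alpha>" if "\<alpha> \<in> A'" for \<alpha> using pos that unfolding x_def by blast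
  have x0: "0 \<le> x \<alpha>" if "\<alpha> \<in> A'" for \<alpha> using xpos[OF that] by simp
  have opt: "(\<Sum>\<alpha>\<in>A'. (cmod (mono n \<alpha> z))\<^sup>2 / x \<alpha>) \<le> 6 * real (card A')"
    using opt z unfolding x_def by blast
  have "(\<Sum>\<beta>\<in>A'. x \<beta> * (Y \<beta>)\<^sup>2) = (\<Sum>\<beta>\<in>A'. \<Sum>s\<in>F. l s * (cmod (mono n \<beta> s) * Y \<beta>)\<^sup>2)"
    unfolding x_def sum_distrib_right by (intro sum.cong refl) (simp add: power_mult_distrib)
  also have "\<dots> = (\<Sum>s\<in>F. l s * (\<Sum>\<beta>\<in>A'. (cmod (mono n \<beta> s) * Y \<beta>)\<^sup>2))"
    by (subst sum.swap) (simp add: sum_distrib_left)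
  also have "\<dots> \<le> (\<Sum>s\<in>F. l s * Q\<^sup>2)" using F per_s by (intro sum_mono mult_left_mono) auto
  also have "\<dots> = Q\<^sup>2" using F(4) by (simp add: sum_distrib_right[symmetric])
  finally have xY: "(\<Sum>\<beta>\<in>A'. x \<beta> * (Y \<beta>)\<^sup>2) \<le> Q\<^sup>2" .
  have "S = (\<Sum>\<beta>\<in>A'. cmod (mono n \<beta> z) * Y \<beta>)"
    unfolding S_def Y_def by (subst sum.swap) (simp add: sum_distrib_left mult_ac)
  \<comment> \<open>Inserting \<open>sqrt (x \<beta>)\<close> splits the sum into a factor bounded
    by optimality of the design and a factor that is the average of \<open>per_s\<close> over the
    design.\<close>
  also have "\<dots> = (\<Sum>\<beta>\<in>A'. (cmod (mono n \<beta> z) / sqrt (x \<beta>)) * (sqrt (x \<beta>) * Y \<beta>))"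
  proof (rule sum.cong[OF refl])
    fix \<beta> assume "\<beta> \<in> A'"
    then have "sqrt (x \<beta>) \<noteq> 0" using xpos[of \<beta>] by simp
    then show "cmod (mono n \<beta> z) * Y \<beta> = (cmod (mono n \<beta> z) / sqrt (x \<beta>)) * (sqrt (x \<beta>) * Y \<beta>)"
      by (simp del: real_sqrt_eq_zero_cancel_iff)
  qed
  finally have "S\<^sup>2 = (\<Sum>\<beta>\<in>A'. (cmod (mono n \<beta> z) / sqrt (x \<beta>)) * (sqrt (x \<beta>) * Y \<beta>))\<^sup>2"
    by (rule arg_cong)
  also have "\<dots> \<le> (\<Sum>\<beta>\<in>A'. (cmod (mono n \<beta> z) / sqrt (x \<beta>))\<^sup>2) * (\<Sum>\<beta>\<in>A'. (sqrt (x \<beta>) * Y \<beta>)\<^sup>2)"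
    by (rule Cauchy_Schwarz_ineq_sum)
  also have "\<dots> = (\<Sum>\<beta>\<in>A'. (cmod (mono n \<beta> z))\<^sup>2 / x \<beta>) * (\<Sum>\<beta>\<in>A'. x \<beta> * (Y \<beta>)\<^sup>2)"
    using x0 by (intro arg_cong2[where f = "(*)"] sum.cong refl) (auto simp: power_divide power_mult_distrib)
  also have "\<dots> \<le> (6 * real (card A')) * Q\<^sup>2"
  proof (rule mult_mono[OF opt xY])
    show "0 \<le> (\<Sum>\<beta>\<in>A'. x \<beta> * (Y \<beta>)\<^sup>2)" using x0 by (intro sum_nonneg mult_nonneg_nonneg) auto
  qed simp
  also have "\<dots> = (sqrt (6 * real (card A')) * Q)\<^sup>2"
    unfolding power_mult_distrib by (subst real_sqrt_pow2) auto
  finally have "S\<^sup>2 \<le> (sqrt (6 * real (card A')) * Q)\<^sup>2" .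
  moreover have "0 \<le> sqrt (6 * real (card A')) * Q" using K0 by (simp add: Q_def)
  ultimately have "S \<le> sqrt (6 * real (card A')) * Q" by (rule power2_le_imp_le)
  then show ?thesis using S1 by (simp add: Q_def A'_def algebra_simps)
qed

end

section \<open>The unconditional basis constant from below\<close>

text \<open>The moment generating function of a random sign. For small arguments both exponentials
  lie below quadratic polynomials whose linear terms cancel; for large ones the argument is at most
  its square.\<close>

lemma exp_plus_exp_minus_le: "exp x + exp (- x) \<le> 2 * exp ((x::real)\<^sup>2)"
proof -
  have main: "exp y + exp (- y) \<le> 2 * exp (y\<^sup>2)" if y: "0 \<le> y" for y :: real
  proof (cases "y \<le> 1")
    case True
    have 1: "exp y \<le> 1 + y + y\<^sup>2" using exp_bound[of y] y True by simp
    have "1 \<le> 1 + y ^ 3" using y by simp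
    also have "\<dots> = (1 + y) * (1 - y + y\<^sup>2)" by (simp add: algebra_simps power2_eq_square power3_eq_cube)
    also have "\<dots> \<le> exp y * (1 - y + y\<^sup>2)"
      using True y exp_ge_add_one_self[of y] by (intro mult_right_mono) auto
    finally have "exp (- y) * 1 \<le> exp (- y) * (exp y * (1 - y + y\<^sup>2))" by (intro mult_left_mono) auto
    also have "\<dots> = 1 - y + y\<^sup>2" by (simp add: mult.assoc[symmetric] exp_add[symmetric])
    finally have 2: "exp (- y) \<le> 1 - y + y\<^sup>2" by simp
    have "1 + y\<^sup>2 \<le> exp (y\<^sup>2)" by (rule exp_ge_add_one_self)
    with 1 2 show ?thesis by linarith
  next
    case False
    then have "y \<le> y\<^sup>2" by (simp add: power2_eq_square)
    then have "exp y \<le> exp (y\<^sup>2)" "exp (- y) \<le> exp (y\<^sup>2)" using y by auto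
    then show ?thesis by linarith
  qed
  show ?thesis using main[of x] main[of "- x"] by (cases "0 \<le> x") auto
qed

text \<open>The method of conditional expectations: the average over both values of the sign treated in the
  induction step is below the bound, so one of them is.\<close>

lemma choose_signs:
  fixes a :: "'i \<Rightarrow> 'a \<Rightarrow> real"
  assumes "finite A" and "\<And>i. i \<in> I \<Longrightarrow> 0 \<le> b i"
  shows "\<exists>\<sigma>::'a \<Rightarrow> real. (\<forall>x. \<sigma> x = 1 \<or> \<sigma> x = -1) \<and>
     (\<Sum>i\<in>I. b i * exp (\<Sum>x\<in>A. \<sigma> x * a i x)) \<le> (\<Sum>i\<in>I. b i * exp (\<Sum>x\<in>A. (a i x)\<^sup>2))"
  using assms
proof (induction A arbitrary: b rule: finite_induct)
  case empty
  then show ?case by (intro exI[of _ "\<lambda>_. 1"]) auto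
next
  case (insert y A)
  \<comment> \<open>The guaranteed value after the remaining signs in \<open>A\<close> have been
    accounted for; the sign at \<open>y\<close> is chosen against it.\<close>
  define E where "E i = b i * exp (\<Sum>x\<in>A. (a i x)\<^sup>2)" for i
  have E0: "0 \<le> E i" if "i \<in> I" for i using insert.prems that by (simp add: E_def)
  have "(\<Sum>i\<in>I. E i * exp (a i y)) + (\<Sum>i\<in>I. E i * exp (- a i y)) = (\<Sum>i\<in>I. E i * (exp (a i y) + exp (- a i y)))"
    by (simp add: sum.distrib distrib_left)
  also have "\<dots> \<le> (\<Sum>i\<in>I. E i * (2 * exp ((a i y)\<^sup>2)))"
    by (intro sum_mono mult_left_mono exp_plus_exp_minus_le E0)
  also have "\<dots> = 2 * (\<Sum>i\<in>I. E i * exp ((a i y)\<^sup>2))" by (simp add: sum_distrib_left mult_ac)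
  finally have "(\<Sum>i\<in>I. E i * exp (a i y)) \<le> (\<Sum>i\<in>I. E i * exp ((a i y)\<^sup>2)) \<or>
      (\<Sum>i\<in>I. E i * exp (- a i y)) \<le> (\<Sum>i\<in>I. E i * exp ((a i y)\<^sup>2))" by linarith
  then have "\<exists>s::real. (s = 1 \<or> s = -1) \<and> (\<Sum>i\<in>I. E i * exp (s * a i y)) \<le> (\<Sum>i\<in>I. E i * exp ((a i y)\<^sup>2))"
  proof (elim disjE)
    assume "(\<Sum>i\<in>I. E i * exp (a i y)) \<le> (\<Sum>i\<in>I. E i * exp ((a i y)\<^sup>2))"
    then show ?thesis by (intro exI[of _ 1]) simp
  next
    assume "(\<Sum>i\<in>I. E i * exp (- a i y)) \<le> (\<Sum>i\<in>I. E i * exp ((a i y)\<^sup>2))"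
    then show ?thesis by (intro exI[of _ "-1"]) simp
  qed
  then obtain s :: real where s: "s = 1 \<or> s = -1" "(\<Sum>i\<in>I. E i * exp (s * a i y)) \<le> (\<Sum>i\<in>I. E i * exp ((a i y)\<^sup>2))"
    by blast
  \<comment> \<open>The weights are arbitrary in the induction so that the factor of the sign just
    fixed can be absorbed into them.\<close>
  have "\<exists>\<sigma>::'a \<Rightarrow> real. (\<forall>x. \<sigma> x = 1 \<or> \<sigma> x = -1) \<and>
     (\<Sum>i\<in>I. b i * exp (s * a i y) * exp (\<Sum>x\<in>A. \<sigma> x * a i x)) \<le> (\<Sum>i\<in>I. b i * exp (s * a i y) * exp (\<Sum>x\<in>A. (a i x)\<^sup>2))"
    by (rule insert.IH) (use insert.prems in simp)
  then obtain \<sigma> :: "'a \<Rightarrow> real" where \<sigma>: "\<forall>x. \<sigma> x = 1 \<or> \<sigma> x = -1"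
    "(\<Sum>i\<in>I. b i * exp (s * a i y) * exp (\<Sum>x\<in>A. \<sigma> x * a i x)) \<le> (\<Sum>i\<in>I. b i * exp (s * a i y) * exp (\<Sum>x\<in>A. (a i x)\<^sup>2))"
    by (elim exE conjE) (rule that)
  have "(\<Sum>i\<in>I. b i * exp (\<Sum>x\<in>insert y A. (\<sigma>(y := s)) x * a i x)) = (\<Sum>i\<in>I. b i * exp (s * a i y) * exp (\<Sum>x\<in>A. \<sigma> x * a i x))"
  proof (rule sum.cong[OF refl])
    fix i
    have "(\<Sum>x\<in>A. (\<sigma>(y := s)) x * a i x) = (\<Sum>x\<in>A. \<sigma> x * a i x)"
      using insert.hyps by (intro sum.cong refl) auto
    then show "b i * exp (\<Sum>x\<in>insert y A. (\<sigma>(y := s)) x * a i x) = b i * exp (s * a i y) * exp (\<Sum>x\<in>A. \<sigma> x * a i x)"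
      using insert.hyps by (simp add: exp_add)
  qed
  also note \<sigma>(2)
  also have "(\<Sum>i\<in>I. b i * exp (s * a i y) * exp (\<Sum>x\<in>A. (a i x)\<^sup>2)) = (\<Sum>i\<in>I. E i * exp (s * a i y))"
    by (simp add: E_def mult_ac)
  also note s(2)
  also have "(\<Sum>i\<in>I. E i * exp ((a i y)\<^sup>2)) = (\<Sum>i\<in>I. b i * exp (\<Sum>x\<in>insert y A. (a i x)\<^sup>2))"
    using insert.hyps by (simp add: E_def exp_add mult_ac)
  finally show ?case using \<sigma>(1) s(1) by (intro exI[of _ "\<sigma>(y := s)"]) auto
qed

section \<open>Rounding to Gaussian integers and counting the resulting points\<close>

text \<open>The modulus of an affine function is convex, so on the segment between consecutive
  integers around \<open>t\<close> it is largest at an endpoint.\<close>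

lemma affine_round_real:
  fixes a b :: complex
  shows "\<exists>p::int. \<bar>of_int p - t\<bar> \<le> 1 \<and> cmod (a + b * of_real t) \<le> cmod (a + b * of_int p)"
proof -
  define s where "s = t - of_int \<lfloor>t\<rfloor>"
  have s: "0 \<le> s" "s \<le> 1" unfolding s_def by linarith+
  have t: "t = (1 - s) * of_int \<lfloor>t\<rfloor> + s * of_int (\<lfloor>t\<rfloor> + 1)" by (simp add: s_def algebra_simps)
  let ?g = "\<lambda>p::int. a + b * of_int p"
  have "a + b * of_real t = of_real (1 - s) * ?g \<lfloor>t\<rfloor> + of_real s * ?g (\<lfloor>t\<rfloor> + 1)"
    by (subst t) (simp add: algebra_simps)
  then have "cmod (a + b * of_real t) \<le> cmod (of_real (1 - s) * ?g \<lfloor>t\<rfloor>) + cmod (of_real s * ?g (\<lfloor>t\<rfloor> + 1))"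
    by (metis norm_triangle_ineq)
  also have "\<dots> = (1 - s) * cmod (?g \<lfloor>t\<rfloor>) + s * cmod (?g (\<lfloor>t\<rfloor> + 1))"
    unfolding norm_mult norm_of_real using s by simp
  also have "\<dots> \<le> (1 - s) * max (cmod (?g \<lfloor>t\<rfloor>)) (cmod (?g (\<lfloor>t\<rfloor> + 1))) + s * max (cmod (?g \<lfloor>t\<rfloor>)) (cmod (?g (\<lfloor>t\<rfloor> + 1)))"
    using s by (intro add_mono mult_left_mono) auto
  also have "\<dots> = max (cmod (?g \<lfloor>t\<rfloor>)) (cmod (?g (\<lfloor>t\<rfloor> + 1)))" by (simp add: algebra_simps)
  finally have "cmod (a + b * of_real t) \<le> cmod (?g \<lfloor>t\<rfloor>) \<or> cmod (a + b * of_real t) \<le> cmod (?g (\<lfloor>t\<rfloor> + 1))"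
    by (auto simp: le_max_iff_disj)
  moreover have "\<bar>of_int \<lfloor>t\<rfloor> - t\<bar> \<le> 1" "\<bar>of_int (\<lfloor>t\<rfloor> + 1) - t\<bar> \<le> 1" using s by (auto simp: s_def)
  ultimately show ?thesis by blast
qed

lemma affine_round:
  fixes a b x :: complex
  shows "\<exists>p q::int. cmod (Complex (of_int p) (of_int q) - x) \<le> 2 \<and>
     cmod (a + b * x) \<le> cmod (a + b * Complex (of_int p) (of_int q))"
proof -
  obtain p :: int where p: "\<bar>of_int p - Re x\<bar> \<le> 1"
    "cmod ((a + b * \<i> * of_real (Im x)) + b * of_real (Re x)) \<le> cmod ((a + b * \<i> * of_real (Im x)) + b * of_int p)"
    using affine_round_real by blast
  obtain q :: int where q: "\<bar>of_int q - Im x\<bar> \<le> 1"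
    "cmod ((a + b * of_int p) + (b * \<i>) * of_real (Im x)) \<le> cmod ((a + b * of_int p) + (b * \<i>) * of_int q)"
    using affine_round_real by blast
  have x: "a + b * x = (a + b * \<i> * of_real (Im x)) + b * of_real (Re x)"
    by (subst (1) complex_eq[of x]) (simp add: algebra_simps)
  have z: "Complex (of_int p) (of_int q) = of_int p + \<i> * of_int q" by (simp add: complex_eq_iff)
  have "cmod (a + b * x) \<le> cmod (a + b * Complex (of_int p) (of_int q))"
    using p(2) q(2) unfolding x z by (simp add: algebra_simps)
  moreover have "cmod (Complex (of_int p) (of_int q) - x) \<le> \<bar>of_int p - Re x\<bar> + \<bar>of_int q - Im x\<bar>"
    using cmod_le[of "Complex (of_int p) (of_int q) - x"] by simp
  ultimately show ?thesis using p(1) q(1) by (intro exI[of _ p] exI[of _ q]) auto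
qed

text \<open>The coordinates are rounded one after another; each step applies
  \<open>affine_round\<close> with the other coordinates frozen, and the modulus never
  decreases.\<close>

lemma multiaffine_round:
  fixes f :: "(nat \<Rightarrow> complex) \<Rightarrow> complex"
  assumes "\<And>k z. k < n \<Longrightarrow> \<exists>a b. \<forall>x. f (z(k := x)) = a + b * x"
  shows "\<exists>p q::nat \<Rightarrow> int. (\<forall>k<n. cmod (Complex (of_int (p k)) (of_int (q k)) - z k) \<le> 2) \<and>
     cmod (f z) \<le> cmod (f (\<lambda>k. if k < n then Complex (of_int (p k)) (of_int (q k)) else z k))"
  using assms
proof (induction n)
  case 0
  then show ?case by simp
next
  case (Suc n)
  then obtain p q :: "nat \<Rightarrow> int" where pq: "\<forall>k<n. cmod (Complex (of_int (p k)) (of_int (q k)) - z k) \<le> 2"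
    "cmod (f z) \<le> cmod (f (\<lambda>k. if k < n then Complex (of_int (p k)) (of_int (q k)) else z k))"
    using less_SucI by blast
  let ?y = "\<lambda>k. if k < n then Complex (of_int (p k)) (of_int (q k)) else z k"
  obtain a b where ab: "\<And>x. f (?y(n := x)) = a + b * x" using Suc.prems[OF lessI, of ?y] by blast
  obtain r s :: int where rs: "cmod (Complex (of_int r) (of_int s) - z n) \<le> 2"
    "cmod (a + b * z n) \<le> cmod (a + b * Complex (of_int r) (of_int s))" using affine_round by blast
  have y: "?y(n := z n) = ?y" by auto
  have "cmod (f z) \<le> cmod (f (?y(n := z n)))" unfolding y by (rule pq(2))
  also have "\<dots> \<le> cmod (f (?y(n := Complex (of_int r) (of_int s))))" unfolding ab by (rule rs(2))
  also have "?y(n := Complex (of_int r) (of_int s)) =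
     (\<lambda>k. if k < Suc n then Complex (of_int ((p(n := r)) k)) (of_int ((q(n := s)) k)) else z k)"
    by (auto simp: fun_eq_iff less_Suc_eq)
  finally show ?case using pq(1) rs(1)
    by (intro exI[of _ "p(n := r)"] exI[of _ "q(n := s)"]) (auto simp: less_Suc_eq)
qed

text \<open>Rounding moves each coordinate by at most 2 and
  \<open>(r + 2)\<^sup>2 \<le> 2 * r\<^sup>2 + 8\<close>, so points of square sum at most
  \<open>n\<close> are rounded to points of square sum at most \<open>10 * n\<close>.\<close>

definition lattice_points :: "nat \<Rightarrow> (nat \<Rightarrow> complex) set" where
  "lattice_points n = {\<xi>. (\<exists>p q::nat \<Rightarrow> int. \<xi> = (\<lambda>k. if k < n then Complex (of_int (p k)) (of_int (q k)) else 0)) \<and>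
     (\<Sum>k<n. (cmod (\<xi> k))\<^sup>2) \<le> real (10 * n)}"

text \<open>A Gaussian integer vector is encoded by the positive and negative parts of its real and
  imaginary coordinates. An integer is at most its square, so each of the four parts has degree at
  most \<open>10 * n\<close>, and \<open>card_bmi_le\<close> with \<open>x = 1 / 2\<close> counts
  them.\<close>

lemma lattice_points_card:
  "finite (lattice_points n)" "real (card (lattice_points n)) \<le> (2 ^ (11 * n)) ^ 4"
proof -
  define D where "D = bmi n (10 * n)"
  define g where "g = (\<lambda>(a::nat \<Rightarrow> nat, b::nat \<Rightarrow> nat, c::nat \<Rightarrow> nat, d::nat \<Rightarrow> nat) k::nat.
     Complex (real (a k) - real (b k)) (real (c k) - real (d k)))"
  have finD: "finite D" unfolding D_def by (rule finite_bmi)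
  have part: "(\<lambda>k. if k < n then nat (r k) else 0) \<in> D" if "(\<Sum>k<n. (real_of_int (r k))\<^sup>2) \<le> real (10 * n)" for r :: "nat \<Rightarrow> int"
  proof -
    have mi: "(\<lambda>k. if k < n then nat (r k) else 0) \<in> mi n" by (auto simp: mi_def)
    have "real (\<Sum>k<n. nat (r k)) \<le> (\<Sum>k<n. (real_of_int (r k))\<^sup>2)"
      unfolding of_nat_sum
    proof (rule sum_mono)
      fix k
      have "int (nat (r k)) \<le> (r k)\<^sup>2"
      proof (cases "1 \<le> r k")
        case True
        then have "r k * 1 \<le> r k * r k" by (intro mult_left_mono) auto
        then show ?thesis using True by (simp add: power2_eq_square)
      qed (auto intro: order_trans[of _ 0])
      then have "real_of_int (int (nat (r k))) \<le> real_of_int ((r k)\<^sup>2)" by (simp only: of_int_le_iff)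
      then show "real (nat (r k)) \<le> (real_of_int (r k))\<^sup>2" by (simp only: of_int_of_nat_eq of_int_power)
    qed
    then have "(\<Sum>k<n. nat (r k)) \<le> 10 * n" using that by linarith
    then show ?thesis using mi by (simp add: D_def bmi_def mdeg_mi)
  qed
  have sub: "lattice_points n \<subseteq> g ` (D \<times> D \<times> D \<times> D)"
  proof
    fix \<xi> assume "\<xi> \<in> lattice_points n"
    then obtain p q :: "nat \<Rightarrow> int" where \<xi>: "\<xi> = (\<lambda>k. if k < n then Complex (of_int (p k)) (of_int (q k)) else 0)"
      and le: "(\<Sum>k<n. (cmod (\<xi> k))\<^sup>2) \<le> real (10 * n)" unfolding lattice_points_def by blast
    have sq: "(cmod (\<xi> k))\<^sup>2 = (real_of_int (p k))\<^sup>2 + (real_of_int (q k))\<^sup>2" if "k < n" for k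
      using that by (simp add: \<xi> cmod_power2)
    have "(\<Sum>k<n. (real_of_int (p k))\<^sup>2) \<le> (\<Sum>k<n. (cmod (\<xi> k))\<^sup>2)"
      by (rule sum_mono) (simp add: sq)
    with le have 1: "(\<Sum>k<n. (real_of_int (p k))\<^sup>2) \<le> real (10 * n)" by linarith
    have "(\<Sum>k<n. (real_of_int (q k))\<^sup>2) \<le> (\<Sum>k<n. (cmod (\<xi> k))\<^sup>2)"
      by (rule sum_mono) (simp add: sq)
    with le have 2: "(\<Sum>k<n. (real_of_int (q k))\<^sup>2) \<le> real (10 * n)" by linarith
    let ?N = "\<lambda>r::nat \<Rightarrow> int. \<lambda>k. if k < n then nat (r k) else 0"
    have "\<xi> = g (?N p, ?N (\<lambda>k. - p k), ?N q, ?N (\<lambda>k. - q k))"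
      by (auto simp: \<xi> g_def fun_eq_iff complex_eq_iff)
    moreover have "(?N p, ?N (\<lambda>k. - p k), ?N q, ?N (\<lambda>k. - q k)) \<in> D \<times> D \<times> D \<times> D"
      using 1 2 by (intro SigmaI part) auto
    ultimately show "\<xi> \<in> g ` (D \<times> D \<times> D \<times> D)" by blast
  qed
  show "finite (lattice_points n)" using sub finD by (meson finite_SigmaI finite_imageI finite_subset)
  have "real (card D) * ((1 / 2) ^ (10 * n) * (1 - 1 / 2) ^ n) \<le> 1"
    unfolding D_def by (rule card_bmi_le) auto
  moreover have "(1 / 2) ^ (10 * n) * (1 - 1 / 2) ^ n = 1 / (2::real) ^ (11 * n)"
    by (simp add: power_add[symmetric] power_one_over)
  ultimately have D2: "real (card D) \<le> 2 ^ (11 * n)" by (simp add: field_simps)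
  have "card (lattice_points n) \<le> card (D \<times> D \<times> D \<times> D)"
    using surj_card_le[OF _ sub] finD by simp
  then have "real (card (lattice_points n)) \<le> real (card (D \<times> D \<times> D \<times> D))" by (simp only: of_nat_le_iff)
  also have "\<dots> = real (card D) ^ 4" by (simp add: card_cartesian_product power4_eq_xxxx)
  also have "\<dots> \<le> (2 ^ (11 * n)) ^ 4" using D2 by (intro power_mono) auto
  finally show "real (card (lattice_points n)) \<le> (2 ^ (11 * n)) ^ 4" .
qed

text \<open>A Kahane--Salem--Zygmund polynomial. Being affine in each variable, it attains on Gaussian integer
  points at least its modulus at any given point, so a union bound over exponentially many points suffices.\<close>

lemma small_sign_polynomial:
  assumes n: "1 \<le> n" and m: "1 \<le> m"
  shows "\<exists>\<sigma>::(nat \<Rightarrow> nat) \<Rightarrow> real. (\<forall>\<alpha>. \<sigma> \<alpha> = 1 \<or> \<sigma> \<alpha> = -1) \<and>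
     (\<forall>z. (\<Sum>k<n. (cmod (z k))\<^sup>2) \<le> real n \<longrightarrow>
        cmod (\<Sum>\<alpha>\<in>Lambda_T m \<inter> mi n. of_real (\<sigma> \<alpha>) * mono n \<alpha> z) \<le> 94 * sqrt (real n) * sqrt ((30 * real n / real m) ^ m))"
proof -
  define \<Lambda> where "\<Lambda> = Lambda_T m \<inter> mi n"
  have fin: "finite \<Lambda>" unfolding \<Lambda>_def using Lambda_T_bmi finite_bmi finite_subset by blast
  \<comment> \<open>\<open>s0\<^sup>2\<close> bounds the sum of the squared moduli of the
    tetrahedral monomials on \<open>lattice_points n\<close>, by \<open>sum_Lambda_T_le\<close> with
    \<open>V = 10 * n\<close>; hence \<open>30 = 3 * 10\<close>.\<close>
  define s0 where "s0 = sqrt ((30 * real n / real m) ^ m)"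
  have s0: "0 < s0" "s0\<^sup>2 = (30 * real n / real m) ^ m" using n m by (auto simp: s0_def)
  \<comment> \<open>Makes the variance term in the exponent at most \<open>n\<close>, the order of
    the logarithm of the number of points.\<close>
  define l where "l = sqrt (real n) / s0"
  have l: "0 < l" "l\<^sup>2 * s0\<^sup>2 = real n" using n s0 by (auto simp: l_def power_divide)
  define F where "F = lattice_points n"
  have finF: "finite F" unfolding F_def by (rule lattice_points_card)
  \<comment> \<open>Real parts in these four directions control the real and imaginary parts of
    \<open>Q\<close>, hence its modulus.\<close>
  define U where "U = {1, \<i>, -1, -\<i>}"
  have cardU: "finite U" "real (card U) \<le> 4" unfolding U_def using card_length[of "[1, \<i>, -1, -\<i>]"] by auto
  have U1: "cmod u = 1" if "u \<in> U" for u using that by (auto simp: U_def)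
  define a where "a = (\<lambda>(\<xi>, u) \<alpha>. l * Re (u * mono n \<alpha> \<xi>))"
  obtain \<sigma> :: "(nat \<Rightarrow> nat) \<Rightarrow> real" where \<sigma>: "\<forall>x. \<sigma> x = 1 \<or> \<sigma> x = -1"
    and \<sigma>le: "(\<Sum>i\<in>F \<times> U. 1 * exp (\<Sum>x\<in>\<Lambda>. \<sigma> x * a i x)) \<le> (\<Sum>i\<in>F \<times> U. 1 * exp (\<Sum>x\<in>\<Lambda>. (a i x)\<^sup>2))"
    using choose_signs[OF fin, of "F \<times> U" "\<lambda>_. 1" a] by auto
  define Q where "Q z = (\<Sum>\<alpha>\<in>\<Lambda>. of_real (\<sigma> \<alpha>) * mono n \<alpha> z)" for z
  have var: "(\<Sum>x\<in>\<Lambda>. (a (\<xi>, u) x)\<^sup>2) \<le> real n" if "\<xi> \<in> F" "u \<in> U" for \<xi> u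
  proof -
    have "(\<Sum>x\<in>\<Lambda>. (a (\<xi>, u) x)\<^sup>2) \<le> (\<Sum>x\<in>\<Lambda>. l\<^sup>2 * (\<Prod>k<n. ((cmod (\<xi> k))\<^sup>2) ^ x k))"
    proof (rule sum_mono)
      fix x
      have "\<bar>Re (u * mono n x \<xi>)\<bar> \<le> cmod (mono n x \<xi>)"
        using abs_Re_le_cmod[of "u * mono n x \<xi>"] U1[OF that(2)] by (simp add: norm_mult)
      then have "\<bar>Re (u * mono n x \<xi>)\<bar>\<^sup>2 \<le> (cmod (mono n x \<xi>))\<^sup>2" by (intro power_mono) auto
      then have "l\<^sup>2 * (Re (u * mono n x \<xi>))\<^sup>2 \<le> l\<^sup>2 * (cmod (mono n x \<xi>))\<^sup>2" by (intro mult_left_mono) auto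
      moreover have "(cmod (mono n x \<xi>))\<^sup>2 = (\<Prod>k<n. ((cmod (\<xi> k))\<^sup>2) ^ x k)"
        unfolding mono_def prod_norm[symmetric] norm_power prod_power_distrib
        by (intro prod.cong refl) (simp add: power_mult[symmetric] mult.commute)
      ultimately show "(a (\<xi>, u) x)\<^sup>2 \<le> l\<^sup>2 * (\<Prod>k<n. ((cmod (\<xi> k))\<^sup>2) ^ x k)"
        by (simp add: a_def power_mult_distrib)
    qed
    also have "\<dots> = l\<^sup>2 * (\<Sum>x\<in>\<Lambda>. \<Prod>k<n. ((cmod (\<xi> k))\<^sup>2) ^ x k)" by (simp add: sum_distrib_left)
    also have "\<dots> \<le> l\<^sup>2 * (3 * real (10 * n) / real m) ^ m"
      unfolding \<Lambda>_def using that n m by (intro mult_left_mono sum_Lambda_T_le) (auto simp: F_def lattice_points_def)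
    also have "\<dots> = real n" using l s0 by simp
    finally show ?thesis .
  qed
  \<comment> \<open>There are at most \<open>2 ^ (44 * n)\<close> points and 4 directions, and the
    variance contributes \<open>exp n\<close>; replacing 2 by \<open>exp 1\<close> gives the
    exponent \<open>44 * n + 2 + n \<le> 47 * n\<close>. The doubling to 94 below comes from adding
    real and imaginary part.\<close>
  have sum_bound: "(\<Sum>i\<in>F \<times> U. exp (\<Sum>x\<in>\<Lambda>. \<sigma> x * a i x)) \<le> exp (47 * real n)"
  proof -
    have "(\<Sum>i\<in>F \<times> U. exp (\<Sum>x\<in>\<Lambda>. \<sigma> x * a i x)) \<le> (\<Sum>i\<in>F \<times> U. exp (\<Sum>x\<in>\<Lambda>. (a i x)\<^sup>2))"
      using \<sigma>le by simp
    also have "\<dots> \<le> (\<Sum>i\<in>F \<times> U. exp (real n))" using var by (intro sum_mono) auto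
    also have "\<dots> = real (card F) * real (card U) * exp (real n)" by (simp add: card_cartesian_product)
    also have "\<dots> \<le> (2 ^ (11 * n)) ^ 4 * 4 * exp (real n)"
      using lattice_points_card(2)[of n] cardU by (intro mult_right_mono mult_mono) (auto simp: F_def)
    also have "\<dots> = 2 ^ (44 * n + 2) * exp (real n)" by (simp add: power_mult[symmetric] power_add)
    also have "\<dots> \<le> exp 1 ^ (44 * n + 2) * exp (real n)"
      using exp_ge_add_one_self[of 1] by (intro mult_right_mono power_mono) auto
    also have "\<dots> = exp (real (44 * n + 2) + real n)" 
      by (simp only: exp_add exp_of_nat_mult[symmetric] mult_1_right)
    also have "\<dots> \<le> exp (47 * real n)" using n by simp
    finally show ?thesis .
  qed
  have QF: "cmod (Q \<xi>) \<le> 94 * sqrt (real n) * s0" if \<xi>: "\<xi> \<in> F" for \<xi>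
  proof -
    have Re: "Re (u * Q \<xi>) \<le> 47 * sqrt (real n) * s0" if u: "u \<in> U" for u
    proof -
      have Re_mult: "Re (of_real r * v) = r * Re v" for r v by simp
      have "u * Q \<xi> = (\<Sum>x\<in>\<Lambda>. of_real (\<sigma> x) * (u * mono n x \<xi>))"
        by (simp add: Q_def sum_distrib_left mult_ac)
      then have "l * Re (u * Q \<xi>) = (\<Sum>x\<in>\<Lambda>. l * (\<sigma> x * Re (u * mono n x \<xi>)))"
        by (simp only: Re_sum Re_mult sum_distrib_left)
      also have "\<dots> = (\<Sum>x\<in>\<Lambda>. \<sigma> x * a (\<xi>, u) x)"
        by (intro sum.cong refl) (simp only: a_def prod.case mult.left_commute)
      finally have "exp (l * Re (u * Q \<xi>)) = exp (\<Sum>x\<in>\<Lambda>. \<sigma> x * a (\<xi>, u) x)" by (rule arg_cong)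
      also have "\<dots> \<le> (\<Sum>i\<in>F \<times> U. exp (\<Sum>x\<in>\<Lambda>. \<sigma> x * a i x))"
        using finF cardU \<xi> u by (intro member_le_sum[of "(\<xi>, u)" "F \<times> U" "\<lambda>i. exp (\<Sum>x\<in>\<Lambda>. \<sigma> x * a i x)"]) auto
      also note sum_bound
      finally have "l * Re (u * Q \<xi>) \<le> 47 * real n" by simp
      also have "\<dots> = l * (47 * sqrt (real n) * s0)" using s0 by (simp add: l_def)
      finally show ?thesis using l by simp
    qed
    have "cmod (Q \<xi>) \<le> \<bar>Re (Q \<xi>)\<bar> + \<bar>Im (Q \<xi>)\<bar>" by (rule cmod_le)
    moreover have "\<bar>Re (Q \<xi>)\<bar> \<le> 47 * sqrt (real n) * s0" using Re[of 1] Re[of "-1"] by (simp add: U_def)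
    moreover have "\<bar>Im (Q \<xi>)\<bar> \<le> 47 * sqrt (real n) * s0" using Re[of \<i>] Re[of "-\<i>"] by (simp add: U_def)
    ultimately show ?thesis by linarith
  qed
  have aff: "\<exists>a b. \<forall>x. Q (z(k := x)) = a + b * x" if k: "k < n" for k z
  proof -
    have split: "mono n \<alpha> (z(k := x)) = x ^ \<alpha> k * (\<Prod>j\<in>{..<n} - {k}. z j ^ \<alpha> j)" for \<alpha> x
      unfolding mono_def using k by (subst prod.remove[of _ k]) auto
    have lin: "of_real (\<sigma> \<alpha>) * mono n \<alpha> (z(k := x)) =
        (if \<alpha> k = 0 then of_real (\<sigma> \<alpha>) * (\<Prod>j\<in>{..<n} - {k}. z j ^ \<alpha> j) else 0) +
        (if \<alpha> k = 0 then 0 else of_real (\<sigma> \<alpha>) * (\<Prod>j\<in>{..<n} - {k}. z j ^ \<alpha> j)) * x" if "\<alpha> \<in> \<Lambda>" for \<alpha> x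
    proof -
      have "\<alpha> k \<le> 1" using that by (auto simp: \<Lambda>_def Lambda_T_def)
      then have "\<alpha> k = 0 \<or> \<alpha> k = 1" by linarith
      then show ?thesis unfolding split by auto
    qed
    show ?thesis
      unfolding Q_def
      by (intro exI allI) (simp only: lin sum.distrib sum_distrib_right[symmetric] cong: sum.cong)
  qed
  show ?thesis
  proof (intro exI[of _ \<sigma>] conjI allI impI)
    show "\<sigma> \<alpha> = 1 \<or> \<sigma> \<alpha> = -1" for \<alpha> using \<sigma> by blast
    fix z :: "nat \<Rightarrow> complex" assume z: "(\<Sum>k<n. (cmod (z k))\<^sup>2) \<le> real n"
    obtain p q :: "nat \<Rightarrow> int" where pq: "\<forall>k<n. cmod (Complex (of_int (p k)) (of_int (q k)) - z k) \<le> 2"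
      "cmod (Q z) \<le> cmod (Q (\<lambda>k. if k < n then Complex (of_int (p k)) (of_int (q k)) else z k))"
      using multiaffine_round[of n Q z, OF aff] by blast
    define \<xi> where "\<xi> = (\<lambda>k. if k < n then Complex (of_int (p k)) (of_int (q k)) else 0)"
    have "mono n \<alpha> (\<lambda>k. if k < n then Complex (of_int (p k)) (of_int (q k)) else z k) = mono n \<alpha> \<xi>" for \<alpha>
      unfolding mono_def by (intro prod.cong refl) (simp add: \<xi>_def)
    then have Q\<xi>: "cmod (Q z) \<le> cmod (Q \<xi>)" using pq(2) by (simp add: Q_def)
    have "(\<Sum>k<n. (cmod (\<xi> k))\<^sup>2) \<le> (\<Sum>k<n. 2 * (cmod (z k))\<^sup>2 + 8)"
    proof (rule sum_mono)
      fix k assume "k \<in> {..<n}"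
      then have "cmod (\<xi> k - z k) \<le> 2" using pq(1) by (simp add: \<xi>_def)
      then have "cmod (\<xi> k) \<le> cmod (z k) + 2" using norm_triangle_ineq2[of "\<xi> k" "z k"] by linarith
      then have "(cmod (\<xi> k))\<^sup>2 \<le> (cmod (z k) + 2)\<^sup>2" by (intro power_mono) auto
      also have "\<dots> = 2 * (cmod (z k))\<^sup>2 + 8 - (cmod (z k) - 2)\<^sup>2" by (simp add: power2_eq_square algebra_simps)
      also have "\<dots> \<le> 2 * (cmod (z k))\<^sup>2 + 8" by simp
      finally show "(cmod (\<xi> k))\<^sup>2 \<le> 2 * (cmod (z k))\<^sup>2 + 8" .
    qed
    also have "\<dots> = 2 * (\<Sum>k<n. (cmod (z k))\<^sup>2) + 8 * real n" by (simp add: sum.distrib sum_distrib_left)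
    also have "\<dots> \<le> real (10 * n)" using z by simp
    finally have "\<xi> \<in> F" unfolding F_def lattice_points_def using \<xi>_def by blast
    from order_trans[OF Q\<xi> QF[OF this]]
    show "cmod (\<Sum>\<alpha>\<in>Lambda_T m \<inter> mi n. of_real (\<sigma> \<alpha>) * mono n \<alpha> z) \<le> 94 * sqrt (real n) * sqrt ((30 * real n / real m) ^ m)"
      by (simp add: Q_def \<Lambda>_def s0_def)
  qed
qed

context reinhardt_body
begin

text \<open>Divided by the values of the monomials at the corner \<open>W\<close> of the polydisc,
  the coefficients of the sign polynomial give a small norm on \<open>B\<close>; undoing the signs
  makes every tetrahedral monomial contribute 1 at \<open>W\<close>.\<close>

lemma unconditional_const_lower:
  assumes A: "A \<subseteq> bmi n m" "Lambda_T m \<inter> mi n \<subseteq> A" and m: "1 \<le> m" "m \<le> n"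
    and w: "\<And>k. k < n \<Longrightarrow> 0 < w k"
    and poly: "\<And>z. (\<forall>k\<ge>n. z k = 0) \<Longrightarrow> (\<forall>k<n. cmod (z k) \<le> w k) \<Longrightarrow> z \<in> B"
    and R: "0 < R" "\<And>z. z \<in> B \<Longrightarrow> (\<Sum>k<n. (cmod (z k) / w k)\<^sup>2) \<le> R * real n"
    and t: "0 \<le> t" "\<And>c \<epsilon>. (\<forall>\<alpha>. cmod (\<epsilon> \<alpha>) = 1) \<Longrightarrow> supn B (pol A (\<lambda>\<alpha>. \<epsilon> \<alpha> * c \<alpha>)) \<le> t * supn B (pol A c)"
  shows "(real n / real m) ^ m \<le> t * (sqrt R ^ m * (94 * sqrt (real n) * sqrt ((30 * real n / real m) ^ m)))"
proof -
  define \<Lambda> where "\<Lambda> = Lambda_T m \<inter> mi n"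
  have fin: "finite A" using A(1) finite_bmi finite_subset by blast
  define E where "E = 94 * sqrt (real n) * sqrt ((30 * real n / real m) ^ m)"
  obtain \<sigma> :: "(nat \<Rightarrow> nat) \<Rightarrow> real" where \<sigma>: "\<And>\<alpha>. \<sigma> \<alpha> = 1 \<or> \<sigma> \<alpha> = -1"
    and small: "\<And>z. (\<Sum>k<n. (cmod (z k))\<^sup>2) \<le> real n \<Longrightarrow> cmod (\<Sum>\<alpha>\<in>\<Lambda>. of_real (\<sigma> \<alpha>) * mono n \<alpha> z) \<le> E"
    using small_sign_polynomial[of n m] m unfolding \<Lambda>_def E_def by auto
  define W where "W = (\<lambda>k. if k < n then complex_of_real (w k) else 0)"
  define c where "c \<alpha> = (if \<alpha> \<in> \<Lambda> then of_real (\<sigma> \<alpha>) / mono n \<alpha> W else 0)" for \<alpha>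
  have WB: "W \<in> B" using w by (intro poly) (auto simp: W_def less_imp_le)
  have W0: "W k \<noteq> 0" if "k < n" for k using w[OF that] that by (simp add: W_def)
  have mW: "mono n \<alpha> W \<noteq> 0" for \<alpha> unfolding mono_def using W0 by simp
  have "pol A (\<lambda>\<alpha>. of_real (\<sigma> \<alpha>) * c \<alpha>) W = (\<Sum>\<alpha>\<in>A. if \<alpha> \<in> \<Lambda> then 1 else 0)"
    unfolding pol_def using WB
  proof (simp only: if_True, intro sum.cong refl)
    fix \<alpha>
    have "complex_of_real (\<sigma> \<alpha>) * of_real (\<sigma> \<alpha>) = 1" using \<sigma>[of \<alpha>] by auto
    then show "of_real (\<sigma> \<alpha>) * c \<alpha> * mono n \<alpha> W = (if \<alpha> \<in> \<Lambda> then 1 else 0)"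
      using mW[of \<alpha>] by (simp add: c_def)
  qed
  also have "\<dots> = of_nat (card \<Lambda>)"
    using fin A(2) by (subst sum.inter_restrict[symmetric]) (auto simp: \<Lambda>_def Int_absorb1)
  finally have "real (card \<Lambda>) = cmod (pol A (\<lambda>\<alpha>. of_real (\<sigma> \<alpha>) * c \<alpha>) W)" by simp
  also have "\<dots> \<le> supn B (pol A (\<lambda>\<alpha>. of_real (\<sigma> \<alpha>) * c \<alpha>))" by (rule supn_upper[OF pol_Linf[OF fin] WB])
  also have "\<dots> \<le> t * supn B (pol A c)"
  proof (rule t(2), rule allI)
    fix \<alpha> show "cmod (of_real (\<sigma> \<alpha>)) = 1" using \<sigma>[of \<alpha>] by auto
  qed
  also have "supn B (pol A c) \<le> sqrt R ^ m * E"
  proof (rule supn_least[OF body_nonempty])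
    fix z assume z: "z \<in> B"
    \<comment> \<open>Rescaled so that the square sum is at most \<open>n\<close>. By homogeneity of
      degree \<open>m\<close> the rescaling costs exactly \<open>sqrt R ^ m\<close>.\<close>
    define y where "y k = z k / (W k * of_real (sqrt R))" for k
    have "(\<Sum>k<n. (cmod (y k))\<^sup>2) = (\<Sum>k<n. (cmod (z k) / w k)\<^sup>2 / R)"
      using w R(1) by (intro sum.cong refl) (auto simp: y_def W_def norm_divide norm_mult power_divide power_mult_distrib)
    also have "\<dots> = (\<Sum>k<n. (cmod (z k) / w k)\<^sup>2) / R" by (simp only: sum_divide_distrib)
    also have "\<dots> \<le> real n" using R(2)[OF z] R(1) by (simp add: pos_divide_le_eq mult.commute)
    finally have small': "cmod (\<Sum>\<alpha>\<in>\<Lambda>. of_real (\<sigma> \<alpha>) * mono n \<alpha> y) \<le> E" by (rule small)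
    have "pol A c z = (\<Sum>\<alpha>\<in>\<Lambda>. c \<alpha> * mono n \<alpha> z)"
    proof -
      have "pol A c z = (\<Sum>\<alpha>\<in>A. c \<alpha> * mono n \<alpha> z)" using z by (simp add: pol_def)
      also have "\<dots> = (\<Sum>\<alpha>\<in>\<Lambda>. c \<alpha> * mono n \<alpha> z)"
        using fin A(2) by (intro sum.mono_neutral_right) (auto simp: \<Lambda>_def c_def)
      finally show ?thesis .
    qed
    also have "\<dots> = (\<Sum>\<alpha>\<in>\<Lambda>. of_real (sqrt R) ^ m * (of_real (\<sigma> \<alpha>) * mono n \<alpha> y))"
    proof (intro sum.cong refl)
      fix \<alpha> assume \<alpha>: "\<alpha> \<in> \<Lambda>"
      then have deg: "(\<Sum>k<n. \<alpha> k) = m" by (auto simp: \<Lambda>_def Lambda_T_def mdeg_mi)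
      have "mono n \<alpha> z = (\<Prod>k<n. W k ^ \<alpha> k * (of_real (sqrt R) ^ \<alpha> k * y k ^ \<alpha> k))"
        unfolding mono_def using W0 R(1)
        by (intro prod.cong refl) (auto simp: y_def power_divide power_mult_distrib)
      also have "\<dots> = mono n \<alpha> W * (of_real (sqrt R) ^ m * mono n \<alpha> y)"
        by (simp only: prod.distrib power_sum[symmetric] deg mono_def)
      finally show "c \<alpha> * mono n \<alpha> z = of_real (sqrt R) ^ m * (of_real (\<sigma> \<alpha>) * mono n \<alpha> y)"
        using mW[of \<alpha>] \<alpha> by (simp add: c_def)
    qed
    also have "\<dots> = of_real (sqrt R) ^ m * (\<Sum>\<alpha>\<in>\<Lambda>. of_real (\<sigma> \<alpha>) * mono n \<alpha> y)"
      by (simp only: sum_distrib_left)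
    finally have "cmod (pol A c z) = sqrt R ^ m * cmod (\<Sum>\<alpha>\<in>\<Lambda>. of_real (\<sigma> \<alpha>) * mono n \<alpha> y)"
      using R(1) by (simp add: norm_mult norm_power)
    also have "\<dots> \<le> sqrt R ^ m * E" using small' R(1) by (intro mult_left_mono) auto
    finally show "cmod (pol A c z) \<le> sqrt R ^ m * E" .
  qed
  finally have "real (card \<Lambda>) \<le> t * (sqrt R ^ m * E)" using t(1) by (simp add: mult_left_mono)
  then show ?thesis using card_Lambda_T_ge[OF m(2)] unfolding \<Lambda>_def E_def by linarith
qed

end

section \<open>The theorem\<close>

context reinhardt_body
begin

definition unconditional_bound :: "(nat \<Rightarrow> nat) set \<Rightarrow> real \<Rightarrow> bool" where
  "unconditional_bound A t \<longleftrightarrow> (\<forall>c \<epsilon>. (\<forall>\<alpha>. cmod (\<epsilon> \<alpha>) = 1) \<longrightarrow>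
      supn B (pol A (\<lambda>\<alpha>. \<epsilon> \<alpha> * c \<alpha>)) \<le> t * supn B (pol A c))"

lemma pol_nonzero:
  assumes fin: "finite A" and \<alpha>: "\<alpha> \<in> A"
  shows "\<exists>c. 0 < supn B (pol A c)"
proof -
  obtain w where w: "w \<in> B" "\<And>k. k < n \<Longrightarrow> w k \<noteq> 0" using nonflat by blast
  let ?c = "\<lambda>\<beta>. if \<beta> = \<alpha> then 1 else (0::complex)"
  have "pol A ?c w = (\<Sum>\<beta>\<in>A. if \<beta> = \<alpha> then mono n \<alpha> w else 0)"
    using w(1) by (auto simp: pol_def intro!: sum.cong)
  also have "\<dots> = mono n \<alpha> w" using fin \<alpha> by simp
  finally have "pol A ?c w \<noteq> 0" using w(2) by (simp add: mono_def)
  then have "0 < cmod (pol A ?c w)" by simp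
  also have "\<dots> \<le> supn B (pol A ?c)" by (rule supn_upper[OF pol_Linf[OF fin] w(1)])
  finally show ?thesis by blast
qed

lemma projection_norm_ge_1:
  assumes "finite A" "A \<noteq> {}" and P: "bounded_projection B (range (pol A)) P t"
  shows "1 \<le> t"
proof -
  obtain \<alpha> where "\<alpha> \<in> A" using assms by blast
  then obtain c where c: "0 < supn B (pol A c)" using pol_nonzero assms by blast
  have "supn B (P (pol A c)) \<le> t * supn B (pol A c)"
    by (rule bounded_projectionD(5)[OF P pol_Linf[OF assms(1)]])
  moreover have "P (pol A c) = pol A c" by (rule bounded_projectionD(4)[OF P]) auto
  ultimately show ?thesis using c by simp
qed

lemma unconditional_bound_ge_1:
  assumes "finite A" "A \<noteq> {}" and t: "unconditional_bound A t"
  shows "1 \<le> t"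
proof -
  obtain \<alpha> where "\<alpha> \<in> A" using assms by blast
  then obtain c where c: "0 < supn B (pol A c)" using pol_nonzero assms by blast
  have "supn B (pol A (\<lambda>\<alpha>. 1 * c \<alpha>)) \<le> t * supn B (pol A c)"
    using t[unfolded unconditional_bound_def, THEN spec[of _ c], THEN spec[of _ "\<lambda>_. 1"]] by simp
  then show ?thesis using c by simp
qed

lemma unconditional_bound_upper:
  assumes A: "A \<subseteq> bmi n m" and m: "1 \<le> m"
  shows "unconditional_bound A (1 + 6 * 4 ^ (m - 1) * sqrt (6 * real (card (bmi n (m - 1)))))"
  unfolding unconditional_bound_def
proof (intro allI impI)
  fix c \<epsilon> :: "(nat \<Rightarrow> nat) \<Rightarrow> complex" assume \<epsilon>: "\<forall>\<alpha>. cmod (\<epsilon> \<alpha>) = 1"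
  have fin: "finite A" using A finite_bmi finite_subset by blast
  show "supn B (pol A (\<lambda>\<alpha>. \<epsilon> \<alpha> * c \<alpha>))
    \<le> (1 + 6 * 4 ^ (m - 1) * sqrt (6 * real (card (bmi n (m - 1))))) * supn B (pol A c)"
  proof (rule supn_least[OF body_nonempty])
    fix z assume z: "z \<in> B"
    have "cmod (pol A (\<lambda>\<alpha>. \<epsilon> \<alpha> * c \<alpha>) z) \<le> (\<Sum>\<alpha>\<in>A. cmod (\<epsilon> \<alpha> * c \<alpha> * mono n \<alpha> z))"
      using z by (simp add: pol_def norm_sum)
    also have "\<dots> = (\<Sum>\<alpha>\<in>A. cmod (c \<alpha>) * cmod (mono n \<alpha> z))" using \<epsilon> by (simp add: norm_mult)
    also have "\<dots> \<le> (1 + 6 * 4 ^ (m - 1) * sqrt (6 * real (card (bmi n (m - 1))))) * supn B (pol A c)"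
    proof (rule absolute_sum_bound[OF A m _ z])
      show "cmod (\<Sum>\<alpha>\<in>A. c \<alpha> * mono n \<alpha> y) \<le> supn B (pol A c)" if "y \<in> B" for y
        using supn_upper[OF pol_Linf[OF fin] that, of c] that by (simp add: pol_def)
    qed
    finally show "cmod (pol A (\<lambda>\<alpha>. \<epsilon> \<alpha> * c \<alpha>) z)
      \<le> (1 + 6 * 4 ^ (m - 1) * sqrt (6 * real (card (bmi n (m - 1))))) * supn B (pol A c)" .
  qed
qed

lemma pol_constant: "pol {\<lambda>_. 0} c z = (if z \<in> B then c (\<lambda>_. 0) else 0)"
  by (simp add: pol_def mono_def)

lemma supn_pol_constant: "supn B (pol {\<lambda>_. 0} c) = cmod (c (\<lambda>_. 0))"
proof (rule antisym)
  show "supn B (pol {\<lambda>_. 0} c) \<le> cmod (c (\<lambda>_. 0))"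
    by (rule supn_least[OF body_nonempty]) (simp add: pol_constant)
  show "cmod (c (\<lambda>_. 0)) \<le> supn B (pol {\<lambda>_. 0} c)"
    using supn_upper[OF pol_Linf zero_mem, of "{\<lambda>_. 0}" c] zero_mem by (simp add: pol_constant)
qed

lemma constant_projection: "bounded_projection B (range (pol {\<lambda>_. 0})) (\<lambda>f. pol {\<lambda>_. 0} (\<lambda>_. f (\<lambda>_. 0))) 1"
  unfolding bounded_projection_def
proof (intro conjI ballI allI)
  show "pol {\<lambda>_. 0} (\<lambda>_. v (\<lambda>_. 0)) = v" if "v \<in> range (pol {\<lambda>_. 0})" for v
    using that zero_mem by (auto simp: pol_constant fun_eq_iff)
  show "supn B (pol {\<lambda>_. 0} (\<lambda>_. f (\<lambda>_. 0))) \<le> 1 * supn B f" if "f \<in> Linf B" for f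
    using supn_upper[OF that zero_mem] by (simp add: supn_pol_constant)
qed (auto simp: pol_constant fun_eq_iff)

lemma constant_unconditional: "unconditional_bound {\<lambda>_. 0} 1"
  unfolding unconditional_bound_def by (simp add: supn_pol_constant norm_mult)

end

lemma sqrt_square_mult_power: "0 \<le> a \<Longrightarrow> sqrt (a\<^sup>2 * x ^ k) = a * sqrt x ^ k"
  by (simp only: real_sqrt_mult real_sqrt_abs real_sqrt_power[of x] abs_of_nonneg)

lemma power_le_self_power: "1 \<le> (x::real) \<Longrightarrow> 1 \<le> m \<Longrightarrow> x \<le> x ^ m"
  using power_increasing[of 1 m x] by simp

section \<open>The four estimates with explicit constants\<close>

locale two_convex_lattice = seq_lattice +
  fixes M :: real
  assumes M: "two_convex_with X N M" "1 \<le> M"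
begin

text \<open>Nonemptiness of \<open>J \<inter> mi n\<close> excludes the zero space, which occurs for
  instance when \<open>n < m\<close> and \<open>J = Lambda_T m\<close>; both constants would then be
  0 and the lower bounds false.\<close>

context
  fixes J :: "(nat \<Rightarrow> nat) set" and n m :: nat
  assumes J: "degree_at_most J m" "Lambda_T m \<subseteq> J" "J \<inter> mi n \<noteq> {}"
begin

lemma index_bmi: "J \<inter> mi n \<subseteq> bmi n m" using J(1) by (auto simp: degree_at_most_def bmi_def)

lemma index_finite: "finite (J \<inter> mi n)" using index_bmi finite_bmi finite_subset by blast

lemma polyfun_eq: "polyfun N J n = ball.pol n (J \<inter> mi n)"
  by (auto simp: polyfun_def ball.pol_def fun_eq_iff)

lemma lambda_PJ_eq: "lambda_PJ N J n = proj_const (ballX N n) (range (ball.pol n (J \<inter> mi n)))"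
  unfolding lambda_PJ_def PJ_def polyfun_eq ..

lemma chi_mon_eq: "chi_mon N J n = Inf {t. t \<ge> 0 \<and> ball.unconditional_bound n (J \<inter> mi n) t}"
  unfolding chi_mon_def polyfun_eq ball.unconditional_bound_def ..

lemma chi_mon_le: "0 \<le> t \<Longrightarrow> ball.unconditional_bound n (J \<inter> mi n) t \<Longrightarrow> chi_mon N J n \<le> t"
  unfolding chi_mon_eq by (rule cInf_lower) (auto intro: bdd_belowI)

lemma chi_mon_ge:
  assumes "0 \<le> t0" "ball.unconditional_bound n (J \<inter> mi n) t0"
    and "\<And>t. 0 \<le> t \<Longrightarrow> ball.unconditional_bound n (J \<inter> mi n) t \<Longrightarrow> a \<le> t"
  shows "a \<le> chi_mon N J n"
  unfolding chi_mon_eq using assms by (intro cInf_greatest) auto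

text \<open>Division by zero makes \<open>n / m\<close> equal to 0 here, so the claimed bounds all
  reduce to 1. The space consists of constants, and evaluation at the origin is a projection of norm
  1.\<close>

lemma degree_zero_bounds:
  assumes "m = 0"
  shows "lambda_PJ N J n = 1" "chi_mon N J n = 1"
proof -
  have A: "J \<inter> mi n = {\<lambda>_. 0}"
  proof (rule antisym)
    show "J \<inter> mi n \<subseteq> {\<lambda>_. 0}"
      using index_bmi bmi_le[of _ n m] assms by fastforce
    show "{\<lambda>_. 0} \<subseteq> J \<inter> mi n"
      using \<open>J \<inter> mi n \<subseteq> {\<lambda>_. 0}\<close> J(3) by blast
  qed
  show "lambda_PJ N J n = 1" unfolding lambda_PJ_eq A
  proof (rule antisym)
    show "proj_const (ballX N n) (range (ball.pol n {\<lambda>_. 0})) \<le> 1"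
      by (rule proj_const_le[OF _ ball.constant_projection]) simp
    show "1 \<le> proj_const (ballX N n) (range (ball.pol n {\<lambda>_. 0}))"
      by (rule proj_const_ge[OF ball.constant_projection]) (auto intro: ball.projection_norm_ge_1)
  qed
  show "chi_mon N J n = 1"
  proof (rule antisym)
    show "chi_mon N J n \<le> 1" by (rule chi_mon_le) (auto simp: A ball.constant_unconditional)
    show "1 \<le> chi_mon N J n"
      by (rule chi_mon_ge[of 1]) (auto simp: A ball.constant_unconditional intro: ball.unconditional_bound_ge_1)
  qed
qed

context
  assumes m: "1 \<le> m"
begin

lemma lambda_upper: "lambda_PJ N J n \<le> 6 ^ m * sqrt (1 + real n / real m) ^ m"
proof -
  obtain P where P: "bounded_projection (ballX N n) (range (ball.pol n (J \<inter> mi n))) P (sqrt (6 * real (card (J \<inter> mi n))))"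
    using ball.proj_const_upper[OF index_bmi J(3)] by blast
  have "lambda_PJ N J n \<le> sqrt (6 * real (card (J \<inter> mi n)))"
    unfolding lambda_PJ_eq by (rule proj_const_le[OF _ P]) simp
  also have "\<dots> \<le> sqrt ((6 ^ m)\<^sup>2 * (1 + real n / real m) ^ m)"
  proof (rule real_sqrt_le_mono)
    have "6 * real (card (J \<inter> mi n)) \<le> 6 ^ m * real (card (bmi n m))"
      using power_le_self_power[of 6 m] m card_mono[OF finite_bmi index_bmi] by (intro mult_mono) auto
    also have "\<dots> \<le> 6 ^ m * (3 ^ m * (2 * (1 + real n / real m)) ^ m)"
      using card_bmi_le_ratio[OF m] by (intro mult_left_mono) auto
    also have "\<dots> = 6 ^ m * ((3 * 2) ^ m * (1 + real n / real m) ^ m)"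
      unfolding power_mult_distrib by (simp only: mult.assoc)
    also have "\<dots> = (6 ^ m)\<^sup>2 * (1 + real n / real m) ^ m" by (simp add: power2_eq_square)
    finally show "6 * real (card (J \<inter> mi n)) \<le> (6 ^ m)\<^sup>2 * (1 + real n / real m) ^ m" .
  qed
  also have "\<dots> = 6 ^ m * sqrt (1 + real n / real m) ^ m" by (rule sqrt_square_mult_power) simp
  finally show ?thesis .
qed

text \<open>\<open>168 = 7 * 24\<close>, where 24 is the 4 of \<open>absolute_sum_bound\<close>
  times the 6 from counting, and 7 collects the remaining numerical factors.\<close>

lemma chi_upper: "chi_mon N J n \<le> 168 ^ m * sqrt (1 + real n / real m) ^ (m - 1)"
proof -
  define q where "q = sqrt (1 + real n / real m) ^ (m - 1)"
  have q: "1 \<le> q" unfolding q_def by (intro one_le_power) simp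
  have "sqrt (6 * real (card (bmi n (m - 1)))) \<le> sqrt ((6 ^ m)\<^sup>2 * (1 + real n / real m) ^ (m - 1))"
  proof (rule real_sqrt_le_mono)
    have "6 * real (card (bmi n (m - 1))) \<le> 6 ^ m * (3 ^ m * (2 * (1 + real n / real m)) ^ (m - 1))"
      using power_le_self_power[of 6 m] m card_bmi_le_ratio[OF m, of n "m - 1"] by (intro mult_mono) auto
    also have "\<dots> \<le> 6 ^ m * (3 ^ m * (2 ^ m * (1 + real n / real m) ^ (m - 1)))"
      unfolding power_mult_distrib by (intro mult_left_mono mult_right_mono power_increasing) auto
    also have "\<dots> = 6 ^ m * ((3 * 2) ^ m * (1 + real n / real m) ^ (m - 1))"
      unfolding power_mult_distrib[of 3] by (simp only: mult.assoc)
    also have "\<dots> = (6 ^ m)\<^sup>2 * (1 + real n / real m) ^ (m - 1)" by (simp add: power2_eq_square)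
    finally show "6 * real (card (bmi n (m - 1))) \<le> (6 ^ m)\<^sup>2 * (1 + real n / real m) ^ (m - 1)" .
  qed
  also have "\<dots> = 6 ^ m * q" unfolding q_def by (rule sqrt_square_mult_power) simp
  finally have s: "sqrt (6 * real (card (bmi n (m - 1)))) \<le> 6 ^ m * q" .
  have "chi_mon N J n \<le> 1 + 6 * 4 ^ (m - 1) * sqrt (6 * real (card (bmi n (m - 1))))"
    by (rule chi_mon_le[OF _ ball.unconditional_bound_upper[OF index_bmi m]]) auto
  also have "\<dots> \<le> 1 + 6 * 4 ^ m * (6 ^ m * q)"
    using s by (intro add_left_mono mult_mono) (auto intro: power_increasing)
  also have "\<dots> = 1 + 6 * (24 ^ m * q)" by (simp add: power_mult_distrib[symmetric] mult.assoc[symmetric])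
  also have "\<dots> \<le> 24 ^ m * q + 6 * (24 ^ m * q)"
  proof (rule add_right_mono)
    have "1 * 1 \<le> 24 ^ m * q" using q by (intro mult_mono) auto
    then show "1 \<le> 24 ^ m * q" by simp
  qed
  also have "\<dots> = 7 * (24 ^ m * q)" by simp
  also have "\<dots> \<le> 7 ^ m * (24 ^ m * q)" using q power_le_self_power[of 7 m] m by (intro mult_right_mono) auto
  also have "\<dots> = 168 ^ m * q" by (simp add: power_mult_distrib[symmetric] mult.assoc[symmetric])
  finally show ?thesis unfolding q_def .
qed

lemma lambda_ge_1: "1 \<le> lambda_PJ N J n"
proof -
  obtain P where P: "bounded_projection (ballX N n) (range (ball.pol n (J \<inter> mi n))) P (sqrt (6 * real (card (J \<inter> mi n))))"
    using ball.proj_const_upper[OF index_bmi J(3)] by blast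
  show ?thesis unfolding lambda_PJ_eq
    by (rule proj_const_ge[OF P]) (auto intro: ball.projection_norm_ge_1[OF index_finite J(3)])
qed

lemma chi_ge_1: "1 \<le> chi_mon N J n"
  by (rule chi_mon_ge[OF _ ball.unconditional_bound_upper[OF index_bmi m]])
    (auto intro: ball.unconditional_bound_ge_1[OF index_finite J(3)])

lemma sqrt_ratio_le: "m \<le> n \<Longrightarrow> sqrt (1 + real n / real m) \<le> 2 * sqrt (real n / real m)"
proof -
  assume "m \<le> n"
  then have "1 + real n / real m \<le> 2\<^sup>2 * (real n / real m)" using m by (simp add: field_simps)
  then have "sqrt (1 + real n / real m) \<le> sqrt (2\<^sup>2 * (real n / real m))" by (rule real_sqrt_le_mono)
  then show ?thesis by (simp only: real_sqrt_mult real_sqrt_abs abs_numeral)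
qed

lemma sqrt_24: "sqrt (24 * M\<^sup>2) \<le> 5 * M"
  using M(2) by (intro real_le_lsqrt) (auto simp: power_mult_distrib)

lemma lambda_lower: "sqrt (1 + real n / real m) ^ m \<le> (40 * M) ^ m * lambda_PJ N J n"
proof (cases "m \<le> n")
  case False
  \<comment> \<open>For \<open>n < m\<close> the base \<open>1 + n / m\<close> is at most 2, and the
    trivial lower bound 1 suffices.\<close>
  have "1 + real n / real m \<le> 2\<^sup>2" using False m by (simp add: field_simps)
  then have "sqrt (1 + real n / real m) \<le> 2" by (rule real_le_lsqrt[rotated]) auto
  then have "sqrt (1 + real n / real m) ^ m \<le> (40 * M) ^ m" using M(2) by (intro power_mono) auto
  also have "\<dots> \<le> (40 * M) ^ m * lambda_PJ N J n"
    using mult_left_mono[OF lambda_ge_1, of "(40 * M) ^ m"] M(2) by simp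
  finally show ?thesis .
next
  case True
  define y where "y = sqrt (real n / real m)"
  define R where "R = 24 * M\<^sup>2"
  have n: "1 \<le> n" using m True by simp
  have y: "0 < y" "y\<^sup>2 = real n / real m" using n m by (auto simp: y_def)
  have R: "0 < R" using M(2) by (simp add: R_def)
  obtain w where w: "\<forall>k<n. 0 < w k"
    "\<forall>z. (\<forall>k\<ge>n. z k = 0) \<and> (\<forall>k<n. cmod (z k) \<le> w k) \<longrightarrow> z \<in> ballX N n"
    "\<forall>z\<in>ballX N n. (\<Sum>k<n. (cmod (z k) / w k)\<^sup>2) \<le> R * real n"
    using ball_sandwich[OF M n, folded R_def] by (elim exE conjE) (rule that)
  obtain P0 where P0: "bounded_projection (ballX N n) (range (ball.pol n (J \<inter> mi n))) P0 (sqrt (6 * real (card (J \<inter> mi n))))"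
    using ball.proj_const_upper[OF index_bmi J(3)] by blast
  have "y ^ m * (1 / (4 * sqrt R)) ^ m \<le> lambda_PJ N J n"
    unfolding lambda_PJ_eq
  proof (rule proj_const_ge[OF P0])
    fix P t assume t: "0 \<le> t" and P: "bounded_projection (ballX N n) (range (ball.pol n (J \<inter> mi n))) P t"
    have "(real n / real m) ^ m * (sqrt (real m / (R * real n)) / 2) ^ m \<le> t * exp (real m / 2)"
      by (rule ball.proj_const_lower[where w = w, OF index_bmi _ m True _ _ R _ t P]) (use w J(2) in auto)
    also have "exp (real m / 2) \<le> 2 ^ m"
    proof -
      have "exp (real m / 2) = exp (1 / 2) ^ m" by (simp add: exp_of_nat_mult[symmetric])
      also have "\<dots> \<le> 2 ^ m"
      proof (intro power_mono)
        show "exp (1 / 2 :: real) \<le> 2" using exp_bound[of "1 / 2"] by (simp add: power2_eq_square)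
      qed auto
      finally show ?thesis .
    qed
    finally have 1: "(real n / real m) ^ m * (sqrt (real m / (R * real n)) / 2) ^ m \<le> t * 2 ^ m"
      using t by (simp add: mult_left_mono)
    \<comment> \<open>Per degree, \<open>y\<^sup>2\<close> from the number of monomials times
      \<open>1 / (2 * sqrt R * y)\<close> from the Riesz scale leaves
      \<open>y / (2 * sqrt R)\<close>; the further factor 2 in \<open>4 * sqrt R\<close> pays for
      \<open>exp (1 / 2) \<le> 2\<close>.\<close>
    have "sqrt (real m / (R * real n)) = 1 / (sqrt R * y)"
      using n m by (simp add: y_def real_sqrt_mult real_sqrt_divide)
    then have "(real n / real m) * (sqrt (real m / (R * real n)) / 2) = 2 * (y * (1 / (4 * sqrt R)))"
      using y R unfolding y(2)[symmetric] by (simp add: power2_eq_square)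
    then have "(2 * (y * (1 / (4 * sqrt R)))) ^ m \<le> t * 2 ^ m" using 1 unfolding power_mult_distrib[symmetric] by simp
    then have "2 ^ m * (y * (1 / (4 * sqrt R))) ^ m \<le> 2 ^ m * t" unfolding power_mult_distrib[of 2] by (simp only: mult.commute)
    then have "(y * (1 / (4 * sqrt R))) ^ m \<le> t" by (rule mult_left_le_imp_le) simp
    then show "y ^ m * (1 / (4 * sqrt R)) ^ m \<le> t" by (simp only: power_mult_distrib)
  qed simp
  then have le: "(8 * sqrt R) ^ m * (y ^ m * (1 / (4 * sqrt R)) ^ m) \<le> (8 * sqrt R) ^ m * lambda_PJ N J n"
    using R by (intro mult_left_mono) auto
  have "8 * sqrt R * (y * (1 / (4 * sqrt R))) = 2 * y" using R by simp
  then have "(8 * sqrt R) ^ m * (y ^ m * (1 / (4 * sqrt R)) ^ m) = (2 * y) ^ m"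
    by (simp only: power_mult_distrib[symmetric])
  with le have "(2 * y) ^ m \<le> (8 * sqrt R) ^ m * lambda_PJ N J n" by (simp only:)
  also have "\<dots> \<le> (40 * M) ^ m * lambda_PJ N J n"
    using sqrt_24 R lambda_ge_1 unfolding R_def by (intro mult_right_mono power_mono) auto
  finally have "(2 * y) ^ m \<le> (40 * M) ^ m * lambda_PJ N J n" .
  moreover have "sqrt (1 + real n / real m) ^ m \<le> (2 * y) ^ m"
    using sqrt_ratio_le[OF True] by (intro power_mono) (auto simp: y_def)
  ultimately show ?thesis by linarith
qed

lemma chi_lower: "sqrt (1 + real n / real m) ^ (m - 1) \<le> (12000 * M) ^ m * chi_mon N J n"
proof (cases "m \<le> n")
  case False
  have "1 + real n / real m \<le> 2\<^sup>2" using False m by (simp add: field_simps)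
  then have "sqrt (1 + real n / real m) \<le> 2" by (rule real_le_lsqrt[rotated]) auto
  then have "sqrt (1 + real n / real m) ^ (m - 1) \<le> (12000 * M) ^ (m - 1)" using M(2) by (intro power_mono) auto
  also have "\<dots> \<le> (12000 * M) ^ m" using M(2) by (intro power_increasing) auto
  also have "\<dots> \<le> (12000 * M) ^ m * chi_mon N J n"
    using mult_left_mono[OF chi_ge_1, of "(12000 * M) ^ m"] M(2) by simp
  finally show ?thesis .
next
  case True
  define y where "y = sqrt (real n / real m)"
  define R where "R = 24 * M\<^sup>2"
  have n: "1 \<le> n" using m True by simp
  have y: "0 < y" "y\<^sup>2 = real n / real m" using n m by (auto simp: y_def)
  have R: "0 < R" using M(2) by (simp add: R_def)
  obtain w where w: "\<forall>k<n. 0 < w k"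
    "\<forall>z. (\<forall>k\<ge>n. z k = 0) \<and> (\<forall>k<n. cmod (z k) \<le> w k) \<longrightarrow> z \<in> ballX N n"
    "\<forall>z\<in>ballX N n. (\<Sum>k<n. (cmod (z k) / w k)\<^sup>2) \<le> R * real n"
    using ball_sandwich[OF M n, folded R_def] by (elim exE conjE) (rule that)
  \<comment> \<open>\<open>1128 = 94 * 2 * 6\<close>, where 2 absorbs \<open>sqrt m\<close> and 6
    bounds \<open>sqrt 30\<close>; \<open>5 * M\<close> bounds \<open>sqrt R\<close>.\<close>
  define D where "D = (1128 * (5 * M)) ^ m"
  have D: "0 < D" using M(2) by (simp add: D_def)
  have "y ^ (m - 1) / D \<le> chi_mon N J n"
  proof (rule chi_mon_ge[OF _ ball.unconditional_bound_upper[OF index_bmi m]])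
    fix t assume t: "0 \<le> t" and ub: "ball.unconditional_bound n (J \<inter> mi n) t"
    have "(real n / real m) ^ m \<le> t * (sqrt R ^ m * (94 * sqrt (real n) * sqrt ((30 * real n / real m) ^ m)))"
      by (rule ball.unconditional_const_lower[where w = w, OF index_bmi _ m True _ _ R _ t])
        (use w J(2) ub in \<open>auto simp: ball.unconditional_bound_def\<close>)
    also have "sqrt (real n) = sqrt (real m) * y"
      using m by (simp add: y_def real_sqrt_divide)
    also have "sqrt ((30 * real n / real m) ^ m) = sqrt 30 ^ m * y ^ m"
      by (simp add: y_def real_sqrt_power real_sqrt_mult[symmetric] power_mult_distrib[symmetric])
    also have "t * (sqrt R ^ m * (94 * (sqrt (real m) * y) * (sqrt 30 ^ m * y ^ m)))
      \<le> t * ((5 * M) ^ m * (94 ^ m * (2 ^ m * y) * (6 ^ m * y ^ m)))"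
    proof (intro mult_left_mono[OF _ t] mult_mono power_mono)
      show "sqrt R \<le> 5 * M" unfolding R_def by (rule sqrt_24)
      show "94 \<le> (94::real) ^ m" using m by (intro power_le_self_power) auto
      have "real m \<le> 2 ^ m" using of_nat_less_two_power[of m, where 'a = real] by simp
      also have "\<dots> \<le> (2 ^ m)\<^sup>2" by (simp add: power2_eq_square)
      finally show "sqrt (real m) \<le> 2 ^ m" by (rule real_le_lsqrt[rotated]) auto
      show "sqrt 30 \<le> (6::real)" by (rule real_le_lsqrt) auto
    qed (use y R M(2) in auto)
    also have "\<dots> = y ^ Suc m * (t * D)"
    proof -
      have "D = (5 * M) ^ m * (94 ^ m * (2 ^ m * 6 ^ m))"
        unfolding D_def by (simp only: power_mult_distrib[symmetric]) (simp add: mult_ac)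
      then show ?thesis by (simp only: power_Suc mult_ac)
    qed
    \<comment> \<open>The left side is \<open>y ^ (2 * m)\<close> against \<open>y ^ m\<close> from
      the sign polynomial and one more \<open>y\<close> from its factor \<open>sqrt n\<close>; the
      difference is the exponent \<open>m - 1\<close>.\<close>
    also have "(real n / real m) ^ m = y ^ Suc m * y ^ (m - 1)"
    proof -
      have "2 * m = Suc m + (m - 1)" using m by simp
      then show ?thesis unfolding y(2)[symmetric] by (simp only: power_mult[symmetric] power_add[symmetric])
    qed
    finally have "y ^ Suc m * y ^ (m - 1) \<le> y ^ Suc m * (t * D)" .
    then have "y ^ (m - 1) \<le> t * D" by (rule mult_left_le_imp_le) (use y in simp)
    then show "y ^ (m - 1) / D \<le> t" using D by (simp add: pos_divide_le_eq)
  qed auto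
  then have yD: "y ^ (m - 1) \<le> D * chi_mon N J n" using D by (simp add: pos_divide_le_eq mult.commute)
  have "sqrt (1 + real n / real m) ^ (m - 1) \<le> (2 * y) ^ (m - 1)"
    using sqrt_ratio_le[OF True] by (intro power_mono) (auto simp: y_def)
  also have "\<dots> = 2 ^ (m - 1) * y ^ (m - 1)" by (rule power_mult_distrib)
  also have "\<dots> \<le> 2 ^ m * (D * chi_mon N J n)"
    by (rule mult_mono[OF power_increasing yD]) (use y(1) in simp_all)
  also have "\<dots> = (11280 * M) ^ m * chi_mon N J n"
  proof -
    have "2 * (1128 * (5 * M)) = 11280 * M" by simp
    then have "2 ^ m * D = (11280 * M) ^ m" unfolding D_def by (simp only: power_mult_distrib[symmetric])
    then show ?thesis by (simp only: mult.assoc[symmetric])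
  qed
  also have "\<dots> \<le> (12000 * M) ^ m * chi_mon N J n"
    using M(2) chi_ge_1 by (intro mult_right_mono power_mono) auto
  finally show ?thesis .
qed

end

end

end

lemma sqrt_power_powr: "0 < x \<Longrightarrow> sqrt x ^ k = x powr (real k / 2)"
  by (simp add: powr_half_sqrt[symmetric] powr_realpow[symmetric] powr_powr)

theorem theorem2p16:
  shows "\<forall>M::real. \<exists>C>0. \<forall>(X::(nat \<Rightarrow> complex) set) (N::(nat \<Rightarrow> complex) \<Rightarrow> real)
            (J::nat \<Rightarrow> (nat \<Rightarrow> nat) set).
     banach_seq_lattice X N \<and> two_convex X N \<and> two_convexity_const X N = M \<and>
     (\<forall>m. index_set (J m) \<and> degree_at_most (J m) m) \<longrightarrow>
     (\<forall>n m. Lambda_T m \<subseteq> J m \<and> J m \<inter> mi n \<noteq> {} \<longrightarrow>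
        inverse C ^ m * (1 + real n / real m) powr (real m / 2) \<le> lambda_PJ N (J m) n \<and>
        lambda_PJ N (J m) n \<le> C ^ m * (1 + real n / real m) powr (real m / 2) \<and>
        inverse C ^ m * (1 + real n / real m) powr ((real m - 1) / 2) \<le> chi_mon N (J m) n \<and>
        chi_mon N (J m) n \<le> C ^ m * (1 + real n / real m) powr ((real m - 1) / 2))"
proof
  fix M :: real
  \<comment> \<open>Strictly above the infimum, so that it is an admissible 2-convexity constant,
    and at least 1, so that its powers may be enlarged freely; it depends on \<open>M\<close>
    alone.\<close>
  define M' where "M' = \<bar>M\<bar> + 1"
  have M': "1 \<le> M'" "M < M'" by (auto simp: M'_def)
  define C where "C = 12000 * M'"
  have C: "0 < C" "168 \<le> C" "40 * M' \<le> C" using M' by (auto simp: C_def)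
  have transfer: "inverse C ^ m * a \<le> b" if "a \<le> C ^ m * b" for m and a b :: real
  proof -
    have "inverse C ^ m * a \<le> inverse C ^ m * (C ^ m * b)" using that C(1) by (intro mult_left_mono) auto
    also have "\<dots> = b" using C(1) by (simp add: mult.assoc[symmetric] power_mult_distrib[symmetric])
    finally show ?thesis .
  qed
  show "\<exists>C>0. \<forall>(X::(nat \<Rightarrow> complex) set) (N::(nat \<Rightarrow> complex) \<Rightarrow> real) (J::nat \<Rightarrow> (nat \<Rightarrow> nat) set).
     banach_seq_lattice X N \<and> two_convex X N \<and> two_convexity_const X N = M \<and>
     (\<forall>m. index_set (J m) \<and> degree_at_most (J m) m) \<longrightarrow>
     (\<forall>n m. Lambda_T m \<subseteq> J m \<and> J m \<inter> mi n \<noteq> {} \<longrightarrow>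
        inverse C ^ m * (1 + real n / real m) powr (real m / 2) \<le> lambda_PJ N (J m) n \<and>
        lambda_PJ N (J m) n \<le> C ^ m * (1 + real n / real m) powr (real m / 2) \<and>
        inverse C ^ m * (1 + real n / real m) powr ((real m - 1) / 2) \<le> chi_mon N (J m) n \<and>
        chi_mon N (J m) n \<le> C ^ m * (1 + real n / real m) powr ((real m - 1) / 2))"
  proof (intro exI[of _ C] conjI[OF C(1)] allI impI)
    fix X :: "(nat \<Rightarrow> complex) set" and N :: "(nat \<Rightarrow> complex) \<Rightarrow> real" and J :: "nat \<Rightarrow> (nat \<Rightarrow> nat) set" and n m :: nat
    assume X: "banach_seq_lattice X N \<and> two_convex X N \<and> two_convexity_const X N = M \<and>
       (\<forall>m. index_set (J m) \<and> degree_at_most (J m) m)"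
      and Jm: "Lambda_T m \<subseteq> J m \<and> J m \<inter> mi n \<noteq> {}"
    interpret seq_lattice X N using X by unfold_locales blast
    interpret two_convex_lattice X N M'
      using two_convex_with_const[of M'] X M' by unfold_locales auto
    have J: "degree_at_most (J m) m" "Lambda_T m \<subseteq> J m" "J m \<inter> mi n \<noteq> {}" using X Jm by auto
    show "inverse C ^ m * (1 + real n / real m) powr (real m / 2) \<le> lambda_PJ N (J m) n \<and>
        lambda_PJ N (J m) n \<le> C ^ m * (1 + real n / real m) powr (real m / 2) \<and>
        inverse C ^ m * (1 + real n / real m) powr ((real m - 1) / 2) \<le> chi_mon N (J m) n \<and>
        chi_mon N (J m) n \<le> C ^ m * (1 + real n / real m) powr ((real m - 1) / 2)"
    proof (cases "m = 0")
      case True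
      then show ?thesis using degree_zero_bounds[OF J True] by simp
    next
      case False
      then have m: "1 \<le> m" by simp
      have r: "0 < 1 + real n / real m" by (simp add: add_pos_nonneg)
      have e1: "(1 + real n / real m) powr (real m / 2) = sqrt (1 + real n / real m) ^ m"
        by (rule sqrt_power_powr[OF r, symmetric])
      have e2: "(1 + real n / real m) powr ((real m - 1) / 2) = sqrt (1 + real n / real m) ^ (m - 1)"
        using sqrt_power_powr[OF r, of "m - 1"] m by (simp add: of_nat_diff)
      have "sqrt (1 + real n / real m) ^ m \<le> (40 * M') ^ m * lambda_PJ N (J m) n"
        by (rule lambda_lower[OF J m])
      also have "\<dots> \<le> C ^ m * lambda_PJ N (J m) n"
        using C M' lambda_ge_1[OF J m] by (intro mult_right_mono power_mono) auto
      finally have 1: "sqrt (1 + real n / real m) ^ m \<le> C ^ m * lambda_PJ N (J m) n" .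
      have "lambda_PJ N (J m) n \<le> 6 ^ m * sqrt (1 + real n / real m) ^ m" by (rule lambda_upper[OF J m])
      also have "\<dots> \<le> C ^ m * sqrt (1 + real n / real m) ^ m"
        using C r by (intro mult_right_mono power_mono) auto
      finally have 2: "lambda_PJ N (J m) n \<le> C ^ m * sqrt (1 + real n / real m) ^ m" .
      have 3: "sqrt (1 + real n / real m) ^ (m - 1) \<le> C ^ m * chi_mon N (J m) n"
        unfolding C_def by (rule chi_lower[OF J m])
      have "chi_mon N (J m) n \<le> 168 ^ m * sqrt (1 + real n / real m) ^ (m - 1)" by (rule chi_upper[OF J m])
      also have "\<dots> \<le> C ^ m * sqrt (1 + real n / real m) ^ (m - 1)"
        using C r by (intro mult_right_mono power_mono) auto
      finally have 4: "chi_mon N (J m) n \<le> C ^ m * sqrt (1 + real n / real m) ^ (m - 1)" .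
      show ?thesis unfolding e1 e2 using transfer[OF 1] 2 transfer[OF 3] 4 by blast
    qed
  qed
qed

end
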